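(* Let $p>7$ be a prime. Then $$\sum_{k=0}^{p-1}\binom{2k}{k}\frac{S_k}{7^k}\equiv \sum_{k=0}^{p-1}\binom{2k}{k}\frac{S_k}{25^k}\equiv\begin{cases}4x^2\pmod p&\text{if } p\equiv 1,2,4\pmod 7,\\ 0\pmod p&\text{if } p\equiv 3,5,6\pmod 7,\end{cases}$$ where in the first case $x,y$ are integers with $p=x^2+7y^2$ (such integers exist).
   Context: For nonnegative integers $n$, $S_n=\sum_{k=0}^n\binom{n}{k}\binom{2k}{k}\binom{2n-2k}{n-k}$. Congruences modulo $p$ are taken in the ring of rational numbers whose denominator is not divisible by $p$. *)

theory Defs
  imports Complex_Main "HOL-Computational_Algebra.Primes"
begin

definition S :: "nat \<Rightarrow> nat" where
  "S n = (\<Sum>k=0..n. (n choose k) * ((2 * k) choose k) * ((2 * n - 2 * k) choose (n - k)))"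

(* Rational numbers whose denominator in lowest terms is not divisible by p;
   quotient_of yields the reduced fraction with positive denominator. *)
definition p_integral_rats :: "nat \<Rightarrow> rat set" where
  "p_integral_rats p = {r. \<not> int p dvd snd (quotient_of r)}"

(* Congruence modulo the ideal generated by p in the ring p_integral_rats p, with both
   sides required to lie in that ring.  The library's cong is not usable on type rat:
   there it is congruence in a field, hence trivial for a nonzero modulus. *)
definition rat_cong :: "rat \<Rightarrow> rat \<Rightarrow> nat \<Rightarrow> bool" ("(1[_ \<equiv> _] '(rmod _'))") where
  "[a \<equiv> b] (rmod p) \<longleftrightarrow>
     a \<in> p_integral_rats p \<and> b \<in> p_integral_rats p \<and>
     (\<exists>c \<in> p_integral_rats p. a - b = of_nat p * c)"

end

theory Submission
  imports Defs "HOL-Computational_Algebra.Computational_Algebra"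
    "HOL-Computational_Algebra.Field_as_Ring" "HOL-Number_Theory.Quadratic_Reciprocity"
    "HOL-Library.Discrete_Functions"
begin

text \<open>
Write s for a square root of -7, alpha = (1 + s)/2 and h = (p - 1)/2.

Both sums reduce to one integer. Modulo p the central binomial coefficient binom(2k,k) equals
(-4)^k binom(h,k), so the two sums are values of a binomial transform of S. The exponential generating
function of S is e^(4z) I(z)^2 with I(z) the sum of z^(2i)/i!^2, and this makes the transform explicit:
the sums are W/(-7)^h and W/25^h for the same integer W, called wsum h below
(\<open>S_sum_residue\<close>). Since 25^h = 5^(p-1) = 1 and (-7)^h is the Legendre symbol of -7, it remains to find
W modulo p, and to know that W = 0 whenever that symbol is -1.

W is the square of a Hasse invariant. Let f = x(x+1)(x+lam) with lam = 3 alpha - 1; the elliptic curve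
y^2 = f(x) has complex multiplication by Z[alpha]. Its Hasse invariant A is the coefficient of x^(p-1) in
f^h. It is a truncated hypergeometric polynomial, and Clausen's identity F(x)^2 = G(x - 64x^2), which survives
truncation modulo p, squares it; at the value belonging to lam the argument x - 64x^2 is 1/81, and one
obtains W alpha^(p-1) = A^2 (\<open>hasse_square\<close>).

If -7 is a non-residue, Frobenius interchanges alpha and its conjugate. Comparing one coefficient in a power
of the polynomial identity that expresses multiplication by alpha on the curve gives
A (alpha^p - alpha) = 0, so A = 0 (\<open>hasse_frobenius\<close>).

If -7 is a residue, p = x^2 + 7y^2 by Thue's lemma, that is, p = pi pi' with pi = x + ys.
Multiplication by pi on the curve acts on the x-coordinate by a fraction N/D of degree p. Its derivative is
divisible by pi, so modulo pi only N = x^p and D = 1 survive, and dividing the differential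
equation of the multiplication map by pi^2 shows that (N'D - ND')/pi is f^h up to sign. The coefficient of
x^(p-1) gives pi' = A up to sign modulo pi (\<open>hasse_invariant_mod_pi\<close>), hence
W = A^2 = pi'^2 = (pi + pi')^2 = 4x^2 modulo pi; both ends are integers, so they agree modulo p.

The existence of N/D is proved with rational functions alone. The multiplication maps are the rational solutions X of
f(x) X'^2 = beta^2 f(X) with X/x tending to 1/beta^2 at infinity. Such a solution is unique for given beta,
the chord construction turns solutions for beta and gamma into one for beta + gamma, and the
parallelogram law for degrees gives the norm of beta as the degree.
\<close>

(* The coeff, monom and smult of univariate polynomial rings over carrier sets would
   otherwise hide the operations on the type of polynomials. *)
hide_const (open) up_ring.coeff up_ring.monom module.smult

section \<open>The field Q(sqrt(-7))\<close>

text \<open>Quad a b stands for a + b sqrt(-7).\<close>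
datatype quad = Quad (qre: rat) (qim: rat)

lemma quad_eq_iff: "a = b \<longleftrightarrow> qre a = qre b \<and> qim a = qim b"
  by (auto intro: quad.expand)

lemma quad_norm_eq_0_iff: "x ^ 2 + 7 * y ^ 2 = 0 \<longleftrightarrow> x = 0 \<and> y = 0" for x y :: rat
  by (simp add: add_nonneg_eq_0_iff)

instantiation quad :: field
begin

definition zero_quad :: quad where "0 = Quad 0 0"
definition one_quad :: quad where "1 = Quad 1 0"
definition plus_quad :: "quad \<Rightarrow> quad \<Rightarrow> quad" where
  "a + b = Quad (qre a + qre b) (qim a + qim b)"
definition uminus_quad :: "quad \<Rightarrow> quad" where "- a = Quad (- qre a) (- qim a)"
definition minus_quad :: "quad \<Rightarrow> quad \<Rightarrow> quad" where
  "a - b = Quad (qre a - qre b) (qim a - qim b)"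
definition times_quad :: "quad \<Rightarrow> quad \<Rightarrow> quad" where
  "a * b = Quad (qre a * qre b - 7 * qim a * qim b) (qre a * qim b + qim a * qre b)"
definition inverse_quad :: "quad \<Rightarrow> quad" where
  "inverse a = Quad (qre a / (qre a ^ 2 + 7 * qim a ^ 2)) (- qim a / (qre a ^ 2 + 7 * qim a ^ 2))"
definition divide_quad :: "quad \<Rightarrow> quad \<Rightarrow> quad" where "a div b = a * inverse (b :: quad)"

lemmas quad_defs = zero_quad_def one_quad_def plus_quad_def uminus_quad_def minus_quad_def
  times_quad_def

instance
proof
  fix a :: quad
  assume "a \<noteq> 0"
  then have "qre a ^ 2 + 7 * qim a ^ 2 \<noteq> 0"
    by (simp add: quad_eq_iff zero_quad_def quad_norm_eq_0_iff)
  then show "inverse a * a = 1"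
    by (simp add: inverse_quad_def quad_defs) (simp add: divide_simps power2_eq_square)
qed (simp_all add: quad_defs divide_quad_def inverse_quad_def algebra_simps)

end

lemma quad_sel [simp]:
  "qre 0 = 0" "qim 0 = 0" "qre 1 = 1" "qim 1 = 0"
  "qre (a + b) = qre a + qre b" "qim (a + b) = qim a + qim b"
  "qre (- a) = - qre a" "qim (- a) = - qim a"
  "qre (a - b) = qre a - qre b" "qim (a - b) = qim a - qim b"
  "qre (a * b) = qre a * qre b - 7 * qim a * qim b"
  "qim (a * b) = qre a * qim b + qim a * qre b"
  by (simp_all add: quad_defs)

lemma quad_of_nat [simp]: "qre (of_nat n) = of_nat n" "qim (of_nat n) = 0"
  by (induction n) auto

instance quad :: field_char_0
  by standard (auto simp: inj_def quad_eq_iff)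

lemma quad_of_int [simp]: "qre (of_int n) = of_int n" "qim (of_int n) = 0"
  by (cases n rule: int_cases2; simp)+

lemma quad_numeral [simp]: "qre (numeral n) = numeral n" "qim (numeral n) = 0"
  using quad_of_nat[of "numeral n"] by simp_all

text \<open>Quotients of polynomials over quad are brought to lowest terms below; for this the field
  carries its trivial Euclidean structure.\<close>
instantiation quad ::
  "{unique_euclidean_ring, normalization_euclidean_semiring, normalization_semidom_multiplicative}"
begin

definition [simp]: "normalize_quad = (normalize_field :: quad \<Rightarrow> _)"
definition [simp]: "unit_factor_quad = (unit_factor_field :: quad \<Rightarrow> _)"
definition [simp]: "modulo_quad = (mod_field :: quad \<Rightarrow> _)"
definition [simp]: "euclidean_size_quad = (euclidean_size_field :: quad \<Rightarrow> _)"
definition [simp]: "division_segment (x :: quad) = 1"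

instance
  by standard
    (simp_all add: dvd_field_iff field_split_simps split: if_splits)

end

instantiation quad :: euclidean_ring_gcd
begin

definition gcd_quad :: "quad \<Rightarrow> quad \<Rightarrow> quad" where
  "gcd_quad = Euclidean_Algorithm.gcd"
definition lcm_quad :: "quad \<Rightarrow> quad \<Rightarrow> quad" where
  "lcm_quad = Euclidean_Algorithm.lcm"
definition Gcd_quad :: "quad set \<Rightarrow> quad" where
 "Gcd_quad = Euclidean_Algorithm.Gcd"
definition Lcm_quad :: "quad set \<Rightarrow> quad" where
 "Lcm_quad = Euclidean_Algorithm.Lcm"

instance by standard (simp_all add: gcd_quad_def lcm_quad_def Gcd_quad_def Lcm_quad_def)

end

instance quad :: field_gcd ..

section \<open>Rational functions: derivative and behaviour at infinity\<close>

lemma coeff_mult_at_bound: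
  fixes p q :: "'a::comm_semiring_0 poly"
  assumes "degree p \<le> m" "degree q \<le> n"
  shows "coeff (p * q) (m + n) = coeff p m * coeff q n"
proof -
  have "coeff (p * q) (m + n) = (\<Sum>i\<le>m+n. coeff p i * coeff q (m + n - i))"
    by (simp add: coeff_mult)
  also have "\<dots> = (\<Sum>i\<in>{m}. coeff p i * coeff q (m + n - i))"
  proof (rule sum.mono_neutral_right)
    show "\<forall>i\<in>{..m + n} - {m}. coeff p i * coeff q (m + n - i) = 0"
    proof
      fix i assume i: "i \<in> {..m + n} - {m}"
      show "coeff p i * coeff q (m + n - i) = 0"
      proof (cases "i > m")
        case True
        with assms show ?thesis by (simp add: coeff_eq_0)
      next
        case False
        with i have "m + n - i > n" by auto
        with assms show ?thesis by (simp add: coeff_eq_0)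
      qed
    qed
  qed auto
  finally show ?thesis by simp
qed

text \<open>The quotient rule applied to an arbitrary representative.\<close>
definition fderiv :: "'a::{idom} poly fract \<Rightarrow> 'a poly fract" where
  "fderiv q = (let nd = (SOME nd. snd nd \<noteq> 0 \<and> q = Fract (fst nd) (snd nd))
     in Fract (pderiv (fst nd) * snd nd - fst nd * pderiv (snd nd)) (snd nd ^ 2))"

lemma fderiv_Fract:
  fixes n d :: "'a::idom poly"
  assumes "d \<noteq> 0"
  shows "fderiv (Fract n d) = Fract (pderiv n * d - n * pderiv d) (d ^ 2)"
proof -
  define nd where "nd = (SOME nd. snd nd \<noteq> 0 \<and> Fract n d = Fract (fst nd) (snd nd))"
  have "snd nd \<noteq> 0 \<and> Fract n d = Fract (fst nd) (snd nd)"
    unfolding nd_def by (rule someI[of _ "(n, d)"]) (use assms in auto)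
  moreover obtain n1 d1 where nd1: "nd = (n1, d1)" by (cases nd)
  ultimately have d1: "d1 \<noteq> 0" and eq: "n * d1 = n1 * d"
    using assms by (auto simp: eq_fract)
  have "pderiv (n * d1) = pderiv (n1 * d)" by (simp add: eq)
  hence eq': "n * pderiv d1 + d1 * pderiv n = n1 * pderiv d + d * pderiv n1"
    by (simp add: pderiv_mult)
  have "(pderiv n1 * d1 - n1 * pderiv d1) * d ^ 2 = (pderiv n * d - n * pderiv d) * d1 ^ 2"
    using eq eq' by Groebner_Basis.algebra
  hence "Fract (pderiv n1 * d1 - n1 * pderiv d1) (d1 ^ 2) =
      Fract (pderiv n * d - n * pderiv d) (d ^ 2)"
    using assms d1 by (simp add: eq_fract)
  thus ?thesis
    by (simp add: fderiv_def nd_def[symmetric] nd1)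
qed

lemma fderiv_add: "fderiv (p + q) = fderiv p + fderiv (q :: 'a::idom poly fract)"
proof (cases p; cases q)
  fix a b c d assume "p = Fract a b" "b \<noteq> 0" "q = Fract c d" "d \<noteq> 0"
  thus ?thesis
    by (simp add: fderiv_Fract eq_fract pderiv_mult pderiv_add) (simp add: algebra_simps power2_eq_square)
qed

lemma fderiv_mult: "fderiv (p * q) = fderiv p * q + p * fderiv (q :: 'a::idom poly fract)"
proof (cases p; cases q)
  fix a b c d assume "p = Fract a b" "b \<noteq> 0" "q = Fract c d" "d \<noteq> 0"
  thus ?thesis
    by (simp add: fderiv_Fract eq_fract pderiv_mult) (simp add: algebra_simps power2_eq_square)
qed

definition fconst :: "'a::idom \<Rightarrow> 'a poly fract" where "fconst c = Fract [:c:] 1"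

lemma fconst_simps [simp]:
  "fconst 0 = 0" "fconst 1 = 1" "fconst (a + b) = fconst a + fconst b"
  "fconst (a - b) = fconst a - fconst b" "fconst (a * b) = fconst a * fconst b"
  "fconst (- a) = - fconst a"
  by (simp_all add: fconst_def eq_fract Zero_fract_def One_fract_def one_pCons[symmetric])

lemma fconst_eq_iff [simp]: "fconst a = fconst b \<longleftrightarrow> a = b"
  by (simp add: fconst_def eq_fract)

lemma fconst_eq_0_iff [simp]: "fconst a = 0 \<longleftrightarrow> a = 0"
  using fconst_eq_iff[of a 0] by (simp del: fconst_eq_iff)

lemma fconst_power [simp]: "fconst (a ^ n) = fconst a ^ n"
  by (induction n) auto

lemma fconst_numeral [simp]: "fconst (numeral n) = numeral n"
proof -
  have "fconst (of_nat k) = of_nat k" for k :: nat by (induction k) auto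
  from this[of "numeral n"] show ?thesis by simp
qed

lemma fderiv_const [simp]: "fderiv (fconst c) = 0"
  by (simp add: fconst_def fderiv_Fract fract_collapse pderiv_pCons)

lemma fderiv_minus: "fderiv (- p) = - fderiv (p :: 'a::idom poly fract)"
  using fderiv_mult[of "fconst (-1)" p] fderiv_const[of "-1 :: 'a"] by simp

lemma fderiv_diff: "fderiv (p - q) = fderiv p - fderiv (q :: 'a::idom poly fract)"
  using fderiv_add[of p "- q"] by (simp add: fderiv_minus)

lemma fderiv_divide:
  assumes "q \<noteq> (0 :: 'a::idom poly fract)"
  shows "fderiv (p / q) = (fderiv p - (p / q) * fderiv q) / q"
  using fderiv_mult[of "p / q" q] assms by (simp add: field_simps)

lemma degree_pderiv_bound: "degree (pderiv p) \<le> degree p - 1"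
  by (rule degree_le) (simp add: coeff_pderiv coeff_eq_0)

text \<open>The value of a rational function at infinity, read off algebraically: the coefficient of the
  numerator in the degree of the denominator, divided by the leading coefficient of the denominator. It
  is 0 when the numerator has smaller degree.\<close>
definition lim_inf :: "'a::idom poly fract \<Rightarrow> 'a \<Rightarrow> bool" where
  "lim_inf q c \<longleftrightarrow> (\<exists>n d. d \<noteq> 0 \<and> q = Fract n d \<and> degree n \<le> degree d \<and>
      coeff n (degree d) = c * lead_coeff d)"

lemma lim_inf_Fract:
  fixes n d :: "'a::idom poly"
  assumes "d \<noteq> 0"
  shows "lim_inf (Fract n d) c \<longleftrightarrow> degree n \<le> degree d \<and> coeff n (degree d) = c * lead_coeff d"
proof
  assume "lim_inf (Fract n d) c"
  then obtain n1 d1 where d1: "d1 \<noteq> 0" and eq: "n * d1 = n1 * d" and deg: "degree n1 \<le> degree d1"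
    and c: "coeff n1 (degree d1) = c * lead_coeff d1"
    using assms by (auto simp: lim_inf_def eq_fract)
  have le: "degree n \<le> degree d"
  proof (cases "n = 0")
    case False
    with d1 have "degree (n * d1) = degree n + degree d1" by (simp add: degree_mult_eq)
    moreover have "degree (n1 * d) \<le> degree d1 + degree d"
      using degree_mult_le[of n1 d] deg by linarith
    ultimately show ?thesis using eq by simp
  qed auto
  have "coeff (n * d1) (degree d + degree d1) = coeff n (degree d) * lead_coeff d1"
    by (rule coeff_mult_at_bound[OF le order.refl])
  moreover have "coeff (n1 * d) (degree d1 + degree d) = coeff n1 (degree d1) * lead_coeff d"
    by (rule coeff_mult_at_bound[OF deg order.refl])
  ultimately have "coeff n (degree d) * lead_coeff d1 = (c * lead_coeff d) * lead_coeff d1"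
    using eq c by (simp only: add.commute[of "degree d1"]) (simp add: mult_ac)
  hence "coeff n (degree d) = c * lead_coeff d"
    using d1 by (subst (asm) mult_cancel_right) auto
  with le show "degree n \<le> degree d \<and> coeff n (degree d) = c * lead_coeff d" by simp
next
  assume "degree n \<le> degree d \<and> coeff n (degree d) = c * lead_coeff d"
  with assms show "lim_inf (Fract n d) c" unfolding lim_inf_def by blast
qed

lemma lim_inf_const [simp]: "lim_inf (fconst c) c"
  by (simp add: fconst_def lim_inf_Fract)

lemma lim_inf_unique: "lim_inf q c \<Longrightarrow> lim_inf q d \<Longrightarrow> c = (d :: 'a::idom)"
proof (cases q)
  fix a b assume "q = Fract a b" "b \<noteq> 0" "lim_inf q c" "lim_inf q d"
  thus ?thesis by (simp add: lim_inf_Fract)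
qed

lemma lim_inf_add:
  assumes "lim_inf p a" "lim_inf q b" shows "lim_inf (p + q) (a + b :: 'a::idom)"
proof (cases p; cases q)
  fix n d n' d' assume *: "p = Fract n d" "d \<noteq> 0" "q = Fract n' d'" "d' \<noteq> 0"
  with assms have l: "degree n \<le> degree d" "degree n' \<le> degree d'"
    "coeff n (degree d) = a * lead_coeff d" "coeff n' (degree d') = b * lead_coeff d'"
    by (simp_all add: lim_inf_Fract)
  have "degree (n * d' + n' * d) \<le> degree d + degree d'"
    by (rule degree_add_le; rule order.trans[OF degree_mult_le]) (use l in auto)
  moreover have "coeff (n * d') (degree d + degree d') = coeff n (degree d) * lead_coeff d'"
    by (rule coeff_mult_at_bound) (use l in auto)
  moreover have "coeff (n' * d) (degree d' + degree d) = coeff n' (degree d') * lead_coeff d"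
    by (rule coeff_mult_at_bound) (use l in auto)
  moreover have "lead_coeff (d * d') = lead_coeff d * lead_coeff d'"
    by (rule lead_coeff_mult)
  ultimately show ?thesis using * l
    by (simp add: lim_inf_Fract degree_mult_eq algebra_simps)
qed

lemma lim_inf_mult:
  assumes "lim_inf p a" "lim_inf q b" shows "lim_inf (p * q) (a * b :: 'a::idom)"
proof (cases p; cases q)
  fix n d n' d' assume *: "p = Fract n d" "d \<noteq> 0" "q = Fract n' d'" "d' \<noteq> 0"
  with assms have l: "degree n \<le> degree d" "degree n' \<le> degree d'"
    "coeff n (degree d) = a * lead_coeff d" "coeff n' (degree d') = b * lead_coeff d'"
    by (simp_all add: lim_inf_Fract)
  have "degree (n * n') \<le> degree d + degree d'"
    by (rule order.trans[OF degree_mult_le]) (use l in auto)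
  moreover have "coeff (n * n') (degree d + degree d') = coeff n (degree d) * coeff n' (degree d')"
    by (rule coeff_mult_at_bound) (use l in auto)
  moreover have "lead_coeff (d * d') = lead_coeff d * lead_coeff d'"
    by (rule lead_coeff_mult)
  ultimately show ?thesis using * l
    by (simp add: lim_inf_Fract degree_mult_eq algebra_simps)
qed

lemma lim_inf_minus: "lim_inf p a \<Longrightarrow> lim_inf (- p) (- a :: 'a::idom)"
  using lim_inf_mult[of "fconst (-1)" "-1" p a] lim_inf_const[of "-1 :: 'a"] by simp

lemma lim_inf_diff: "lim_inf p a \<Longrightarrow> lim_inf q b \<Longrightarrow> lim_inf (p - q) (a - b :: 'a::idom)"
  using lim_inf_add[of p a "- q" "- b"] by (simp add: lim_inf_minus)

lemma lim_inf_power: "lim_inf p a \<Longrightarrow> lim_inf (p ^ n) (a ^ n :: 'a::idom)"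
  using lim_inf_const[of "1::'a"] by (induction n) (auto intro: lim_inf_mult)

lemma lim_inf_inverse:
  assumes "lim_inf p a" "a \<noteq> 0" shows "lim_inf (inverse p) (inverse a :: 'a::field)"
proof (cases p)
  fix n d assume *: "p = Fract n d" "d \<noteq> 0"
  with assms have l: "degree n \<le> degree d" "coeff n (degree d) = a * lead_coeff d"
    by (simp_all add: lim_inf_Fract)
  with * assms have "coeff n (degree d) \<noteq> 0" by simp
  hence "degree n = degree d" "n \<noteq> 0"
    using l(1) le_degree[of n "degree d"] by (auto simp del: l(2))
  with * l assms show ?thesis by (simp add: lim_inf_Fract)
qed

lemma lim_inf_divide:
  "lim_inf p a \<Longrightarrow> lim_inf q b \<Longrightarrow> b \<noteq> 0 \<Longrightarrow> lim_inf (p / q) (a / b :: 'a::field)"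
  using lim_inf_mult[OF _ lim_inf_inverse] by (simp add: divide_inverse)

definition fX :: "'a::idom poly fract" where "fX = Fract [:0, 1:] 1"

lemma fX_nonzero [simp]: "fX \<noteq> 0"
  by (simp add: fX_def Zero_fract_def eq_fract)

lemma fderiv_X [simp]: "fderiv (fX :: 'a::idom poly fract) = 1"
  by (simp add: fX_def fderiv_Fract One_fract_def pderiv_pCons one_pCons power2_eq_square)

lemma lim_inf_inverse_X: "lim_inf (inverse fX) (0 :: 'a::field)"
  by (simp add: fX_def lim_inf_Fract)

lemma fract_div_X:
  "d \<noteq> 0 \<Longrightarrow> Fract n d / fX = Fract n (pCons 0 (d :: 'a::field poly))"
  by (simp add: fX_def)

text \<open>If q grows like c x, its derivative tends to c: multiplying out, the contribution of the
  derivative of the denominator cancels all but one copy of the leading term.\<close>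
lemma lim_inf_fderiv:
  fixes c :: "'a::field"
  assumes "lim_inf (q / fX) c" shows "lim_inf (fderiv q) c"
proof (cases q)
  fix n d assume *: "q = Fract n d" "d \<noteq> 0"
  define D where "D = degree d"
  have dn: "degree n \<le> Suc D" and cn: "coeff n (Suc D) = c * lead_coeff d"
    using assms * by (simp_all add: fract_div_X lim_inf_Fract D_def)
  have n': "degree (pderiv n) \<le> D" using dn degree_pderiv_bound[of n] by linarith
  have c1: "coeff (pderiv n * d) (D + D) = coeff (pderiv n) D * lead_coeff d"
    unfolding D_def by (rule coeff_mult_at_bound) (use n' D_def in auto)
  have c2: "coeff (n * pderiv d) (D + D) = of_nat D * c * lead_coeff d ^ 2
      \<and> degree (n * pderiv d) \<le> D + D"
  proof (cases D)
    case 0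
    hence "degree d = 0" by (simp add: D_def)
    then obtain a where "d = [:a:]" by (rule degree_eq_zeroE)
    hence "pderiv d = 0" by (simp add: pderiv_pCons)
    thus ?thesis using 0 by simp
  next
    case (Suc E)
    have dd: "degree (pderiv d) \<le> E" using degree_pderiv_bound[of d] Suc by (simp add: D_def)
    have "coeff (n * pderiv d) (Suc D + E) = coeff n (Suc D) * coeff (pderiv d) E"
      by (rule coeff_mult_at_bound[OF dn dd])
    moreover have "coeff (pderiv d) E = of_nat D * lead_coeff d"
      using Suc by (simp add: coeff_pderiv D_def)
    moreover have "degree (n * pderiv d) \<le> Suc D + E"
      using degree_mult_le[of n "pderiv d"] dn dd by linarith
    ultimately show ?thesis using Suc cn by (simp add: power2_eq_square)
  qed
  have "degree (pderiv n * d - n * pderiv d) \<le> D + D"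
    by (rule degree_diff_le) (use c2 degree_mult_le[of "pderiv n" d] n' in \<open>auto simp: D_def\<close>)
  moreover have "coeff (pderiv n * d - n * pderiv d) (D + D) = c * lead_coeff d ^ 2"
    using c1 c2 cn by (simp add: coeff_pderiv algebra_simps power2_eq_square)
  moreover have dd: "degree (d ^ 2) = D + D"
    using * by (simp add: degree_power_eq D_def)
  moreover have "coeff (d ^ 2) (D + D) = lead_coeff d ^ 2"
    using lead_coeff_power[of d 2] unfolding dd by simp
  ultimately show ?thesis using *
    by (simp add: fderiv_Fract lim_inf_Fract)
qed

text \<open>x q'/q tends to the order of the pole of q at infinity. The integrality of this limit is what
  rules out a second multiplication map in \<open>mult_by_unique\<close>.\<close>
lemma lim_inf_logderiv:
  fixes q :: "'a::field poly fract"
  assumes "q \<noteq> 0"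
  shows "\<exists>k :: int. lim_inf (fX * fderiv q / q) (of_int k)"
proof -
  obtain m e where *: "q = Fract m e" "e \<noteq> 0" "m \<noteq> 0"
    using assms by (cases q rule: Fract_cases_nonzero) auto
  define T :: "'a poly \<Rightarrow> 'a poly" where "T p = pCons 0 (pderiv p)" for p
  have cT: "coeff (T p) i = of_nat i * coeff p i" for p i
    by (cases i) (auto simp: T_def coeff_pderiv)
  have dT: "degree (T p) \<le> degree p" for p
    by (rule degree_le) (simp add: cT coeff_eq_0)
  have "fX * fderiv q / q = Fract (e * (T m * e - m * T e)) (e * (m * e))"
    using * by (simp add: fX_def fderiv_Fract T_def power2_eq_square eq_fract algebra_simps)
  also have "\<dots> = Fract (T m * e - m * T e) (m * e)"
    using * by (intro mult_fract_cancel)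
  finally have eq: "fX * fderiv q / q = Fract (T m * e - m * T e) (m * e)" .
  have "degree (T m * e - m * T e) \<le> degree m + degree e"
    by (rule degree_diff_le; rule order.trans[OF degree_mult_le]) (use dT[of m] dT[of e] in auto)
  moreover have "coeff (T m * e) (degree m + degree e) = coeff (T m) (degree m) * lead_coeff e"
    by (rule coeff_mult_at_bound) (use dT in auto)
  moreover have "coeff (m * T e) (degree m + degree e) = lead_coeff m * coeff (T e) (degree e)"
    by (rule coeff_mult_at_bound) (use dT in auto)
  moreover have "lead_coeff (m * e) = lead_coeff m * lead_coeff e" by (rule lead_coeff_mult)
  ultimately have "lim_inf (Fract (T m * e - m * T e) (m * e))
      (of_int (int (degree m) - int (degree e)))"
    using * by (simp add: lim_inf_Fract degree_mult_eq cT algebra_simps)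
  with eq show ?thesis by metis
qed

section \<open>Chord law\<close>

text \<open>On the curve f S^2 = X^3 + a X^2 + b X the line z \<mapsto> L (z - X) + S through (X,S) and
  (Y,T) meets the curve in three points. Substituting the line leaves a monic cubic with roots X, Y and
  X3; the other two identities are the derivative of this cubic at X and at Y.\<close>
lemma chord_cubic:
  fixes f S T X Y L a b c X3 z :: "'a::field"
  assumes S: "f * S ^ 2 = X ^ 3 + a * X ^ 2 + b * X" and T: "f * T ^ 2 = Y ^ 3 + a * Y ^ 2 + b * Y"
    and XY: "X \<noteq> Y" and L: "L = (S - T) / (X - Y)" and X3: "X3 = f * L ^ 2 - a - X - Y"
  shows "(z ^ 3 + a * z ^ 2 + b * z) - f * (L * (z - X) + S) ^ 2 = (z - X) * (z - Y) * (z - X3)"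
    and "3 * X ^ 2 + 2 * a * X + b - 2 * f * L * S = (X - Y) * (X - X3)"
    and "3 * Y ^ 2 + 2 * a * Y + b - 2 * f * L * T = (Y - X) * (Y - X3)"
proof -
  have ST: "S - T = L * (X - Y)" using XY L by simp
  have "(X - Y) * (X ^ 2 + X * Y + Y ^ 2 + a * (X + Y) + b) = f * S ^ 2 - f * T ^ 2"
    unfolding S T by Groebner_Basis.algebra
  also have "\<dots> = (X - Y) * (f * L * (S + T))" using ST by Groebner_Basis.algebra
  finally have K: "X ^ 2 + X * Y + Y ^ 2 + a * (X + Y) + b = f * L * (S + T)"
    using XY by simp
  show "3 * X ^ 2 + 2 * a * X + b - 2 * f * L * S = (X - Y) * (X - X3)"
    using K ST X3 by Groebner_Basis.algebra
  show "3 * Y ^ 2 + 2 * a * Y + b - 2 * f * L * T = (Y - X) * (Y - X3)"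
    using K ST X3 by Groebner_Basis.algebra
  show "(z ^ 3 + a * z ^ 2 + b * z) - f * (L * (z - X) + S) ^ 2 = (z - X) * (z - Y) * (z - X3)"
    using K ST X3 S by Groebner_Basis.algebra
qed

text \<open>The additivity of the invariant differential in differential form: if the derivatives of X
  and Y are \<beta> S and \<gamma> T, then the derivative of the third abscissa X3 is \<beta> + \<gamma>
  times the ordinate of the sum. Here f is itself a function with derivative f', and S', T' come from
  differentiating the two curve equations.\<close>
lemma chord_derivation:
  fixes f S T X Y L a b X3 f' S' T' X' Y' L' \<beta> \<gamma> :: "'a::field"
  assumes S: "f * S ^ 2 = X ^ 3 + a * X ^ 2 + b * X" and T: "f * T ^ 2 = Y ^ 3 + a * Y ^ 2 + b * Y"
    and XY: "X \<noteq> Y" and L: "L = (S - T) / (X - Y)" and X3: "X3 = f * L ^ 2 - a - X - Y"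
    and dX: "X' = \<beta> * S" and dY: "Y' = \<gamma> * T"
    and dS: "2 * f * S' = \<beta> * (3 * X ^ 2 + 2 * a * X + b) - f' * S"
    and dT: "2 * f * T' = \<gamma> * (3 * Y ^ 2 + 2 * a * Y + b) - f' * T"
    and dL: "L' = (S' - T' - L * (X' - Y')) / (X - Y)"
  shows "f' * L ^ 2 + 2 * f * L * L' - X' - Y' = (\<beta> + \<gamma>) * - (L * (X3 - X) + S)"
proof -
  note c = chord_cubic(2,3)[OF S T XY L X3]
  have ST: "S - T = L * (X - Y)" using XY L by simp
  have "(X - Y) * (2 * f * L') = 2 * f * S' - 2 * f * T' - 2 * f * L * (X' - Y')"
  proof -
    have "(X - Y) * L' = S' - T' - L * (X' - Y')" using XY dL by simp
    thus ?thesis by Groebner_Basis.algebra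
  qed
  also have "\<dots> = \<beta> * ((X - Y) * (X - X3)) - \<gamma> * ((Y - X) * (Y - X3)) - f' * (S - T)"
    unfolding dS dT dX dY c[symmetric] by Groebner_Basis.algebra
  also have "\<dots> = (X - Y) * (\<beta> * (X - X3) + \<gamma> * (Y - X3) - f' * L)"
    unfolding ST by Groebner_Basis.algebra
  finally have "2 * f * L' = \<beta> * (X - X3) + \<gamma> * (Y - X3) - f' * L"
    using XY by simp
  thus ?thesis using ST dX dY by Groebner_Basis.algebra
qed

text \<open>X3 and X4 are the abscissas of the sum and of the difference of the two points. Their
  symmetric functions are rational in X and Y alone, which is the source of the parallelogram law for
  degrees.\<close>
lemma chord_sum_product:
  fixes f S T X Y a b X3 X4 :: "'a::field"
  assumes S: "f * S ^ 2 = X ^ 3 + a * X ^ 2 + b * X" and T: "f * T ^ 2 = Y ^ 3 + a * Y ^ 2 + b * Y"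
    and XY: "X \<noteq> Y" "X \<noteq> 0" "Y \<noteq> 0"
    and X3: "X3 = f * ((S - T) / (X - Y)) ^ 2 - a - X - Y"
    and X4: "X4 = f * ((S + T) / (X - Y)) ^ 2 - a - X - Y"
  shows "(X3 + X4) * (X - Y) ^ 2 = 2 * ((X + Y) * (X * Y + b) + 2 * a * X * Y)"
    and "(X3 * X4) * (X - Y) ^ 2 = (X * Y - b) ^ 2"
proof -
  define L M where "L = (S - T) / (X - Y)" and "M = (S + T) / (X - Y)"
  have L: "L * (X - Y) = S - T" and M: "M * (X - Y) = S + T"
    using XY by (simp_all add: L_def M_def)
  have X3': "X3 = f * L ^ 2 - a - X - Y" and X4': "X4 = f * M ^ 2 - a - X - Y"
    using X3 X4 by (simp_all add: L_def M_def)
  show "(X3 + X4) * (X - Y) ^ 2 = 2 * ((X + Y) * (X * Y + b) + 2 * a * X * Y)"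
    using L M X3' X4' S T by Groebner_Basis.algebra
  have 1: "f * (S - L * X) ^ 2 = X * Y * X3"
    using chord_cubic(1)[OF S T XY(1) L_def X3', of 0] by (simp add: algebra_simps)
  have T': "f * (- T) ^ 2 = Y ^ 3 + a * Y ^ 2 + b * Y" using T by simp
  have M': "M = (S - - T) / (X - Y)" by (simp add: M_def)
  have 2: "f * (S - M * X) ^ 2 = X * Y * X4"
    using chord_cubic(1)[OF S T' XY(1) M' X4', of 0] by (simp add: algebra_simps)
  have 3: "(S - L * X) * (X - Y) = T * X - S * Y" "(S - M * X) * (X - Y) = - (T * X + S * Y)"
    using L M by Groebner_Basis.algebra+
  have "(X * Y) ^ 2 * ((X3 * X4) * (X - Y) ^ 4) =
      (X * Y * X3) * (X * Y * X4) * (X - Y) ^ 4" by Groebner_Basis.algebra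
  also have "\<dots> = f ^ 2 * ((S - L * X) * (X - Y)) ^ 2 * ((S - M * X) * (X - Y)) ^ 2"
    unfolding 1[symmetric] 2[symmetric] by Groebner_Basis.algebra
  also have "\<dots> = (f * T ^ 2 * X ^ 2 - f * S ^ 2 * Y ^ 2) ^ 2"
    unfolding 3 by Groebner_Basis.algebra
  also have "\<dots> = (X * Y) ^ 2 * ((X * Y - b) ^ 2 * (X - Y) ^ 2)"
    unfolding S T by Groebner_Basis.algebra
  finally have "(X3 * X4) * (X - Y) ^ 4 = (X * Y - b) ^ 2 * (X - Y) ^ 2"
    using XY by simp
  hence "(X - Y) ^ 2 * ((X3 * X4) * (X - Y) ^ 2) = (X - Y) ^ 2 * (X * Y - b) ^ 2" by Groebner_Basis.algebra
  thus "(X3 * X4) * (X - Y) ^ 2 = (X * Y - b) ^ 2" using XY by simp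
qed

section \<open>Multiplication maps\<close>

text \<open>The curve y^2 = x (x + 1) (x + lam); the excluded values are those where the cubic has a
  double root.\<close>
locale legendre_curve =
  fixes lam :: "'a::{field_char_0, field_gcd}"
  assumes lam_nonzero: "lam \<noteq> 0" and lam_not_1: "lam \<noteq> 1"
begin

definition g :: "'a poly fract \<Rightarrow> 'a poly fract" where
  "g X = X * (X + 1) * (X + fconst lam)"

text \<open>X is the action on abscissas of an endomorphism that multiplies the invariant differential
  dx/y by \<beta>. The differential equation is the square of that condition; it also holds for the
  endomorphism followed by a translation, and the limit at infinity, which says that the origin is fixed,
  excludes these.\<close>
definition mult_by :: "'a \<Rightarrow> 'a poly fract \<Rightarrow> bool" where
  "mult_by \<beta> X \<longleftrightarrow> \<beta> \<noteq> 0 \<and> g fX * fderiv X ^ 2 = fconst (\<beta> ^ 2) * g X \<and>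
     lim_inf (X / fX) (1 / \<beta> ^ 2)"

lemma g_expand: "g X = X ^ 3 + fconst (1 + lam) * X ^ 2 + fconst lam * X"
  unfolding g_def by (simp add: algebra_simps power2_eq_square power3_eq_cube)

lemma mult_byD:
  assumes "mult_by \<beta> X"
  shows "\<beta> \<noteq> 0" "lim_inf (X / fX) (1 / \<beta> ^ 2)" "X \<noteq> 0"
    "lim_inf (fderiv X / fconst \<beta>) (1 / \<beta> ^ 3)"
    "g fX * (fderiv X / fconst \<beta>) ^ 2 = g X"
proof -
  show b: "\<beta> \<noteq> 0" and l: "lim_inf (X / fX) (1 / \<beta> ^ 2)" using assms by (auto simp: mult_by_def)
  show "X \<noteq> 0"
    using lim_inf_unique[OF l, of 0] lim_inf_const[of "0::'a"] b by auto
  have "lim_inf (fderiv X / fconst \<beta>) (1 / \<beta> ^ 2 / \<beta>)"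
    by (intro lim_inf_divide lim_inf_fderiv l lim_inf_const b)
  thus "lim_inf (fderiv X / fconst \<beta>) (1 / \<beta> ^ 3)" by (simp add: power3_eq_cube power2_eq_square)
  show "g fX * (fderiv X / fconst \<beta>) ^ 2 = g X"
    using assms b by (simp add: mult_by_def power_divide)
qed

lemma mult_by_minus: "mult_by (- \<beta>) X \<longleftrightarrow> mult_by \<beta> X"
  by (simp add: mult_by_def)

lemma lim_inf_g: "lim_inf (g fX / fX ^ 3) 1"
proof -
  have "g fX / fX ^ 3 = (1 + inverse fX) * (1 + fconst lam * inverse fX)"
    by (simp add: g_def field_simps power3_eq_cube)
  moreover have "lim_inf ((1 + inverse fX) * (1 + fconst lam * inverse fX)) ((1 + 0) * (1 + lam * 0))"
    using lim_inf_const[of "1::'a"]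
    by (intro lim_inf_mult lim_inf_add lim_inf_inverse_X lim_inf_const) simp_all
  ultimately show ?thesis by simp
qed

lemma g_fX_nonzero: "g fX \<noteq> 0"
  using lim_inf_unique[OF lim_inf_g, of 0] lim_inf_const[of "0::'a"] by auto

text \<open>For two different solutions put e = X - Y. Subtracting the differential equations and letting
  x tend to infinity gives the limit 3/2 for x e'/e, whereas this limit is an integer.\<close>
lemma mult_by_unique:
  assumes X: "mult_by \<beta> X" and Y: "mult_by \<beta> Y" shows "X = Y"
proof (rule ccontr)
  assume "X \<noteq> Y"
  define e where "e = X - Y"
  define B where "B = fconst \<beta>"
  define S T where "S = fderiv X / B" and "T = fderiv Y / B"
  have e: "e \<noteq> 0" using \<open>X \<noteq> Y\<close> by (simp add: e_def)
  have b: "\<beta> \<noteq> 0" and B: "B \<noteq> 0" using X by (auto simp: mult_by_def B_def)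
  have SX: "g fX * S ^ 2 = g X" and TY: "g fX * T ^ 2 = g Y"
    using mult_byD(5)[OF X] mult_byD(5)[OF Y] by (simp_all add: S_def T_def B_def)
  have lS: "lim_inf S (1 / \<beta> ^ 3)" and lT: "lim_inf T (1 / \<beta> ^ 3)"
    using mult_byD(4)[OF X] mult_byD(4)[OF Y] by (simp_all add: S_def T_def B_def)
  define Q where "Q = X ^ 2 + X * Y + Y ^ 2 + fconst (1 + lam) * (X + Y) + fconst lam"
  have eS: "S - T = fderiv e / B"
    by (simp add: S_def T_def e_def fderiv_diff diff_divide_distrib)
  have "g fX * ((S - T) * (S + T)) = g X - g Y"
    unfolding SX[symmetric] TY[symmetric] by (simp add: algebra_simps power2_eq_square)
  also have "\<dots> = e * Q" unfolding g_expand e_def Q_def by Groebner_Basis.algebra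
  finally have 1: "g fX * (fderiv e / B) * (S + T) = e * Q" unfolding eS by (simp add: mult.assoc)
  have "(fX * fderiv e / e) * (g fX / fX ^ 3) * ((S + T) / B) =
      (g fX * (fderiv e / B) * (S + T)) / (e * fX ^ 2)"
    using e B by (simp add: field_simps power3_eq_cube power2_eq_square)
  also have "\<dots> = Q / fX ^ 2" unfolding 1 using e by simp
  also have "\<dots> = (X / fX) ^ 2 + (X / fX) * (Y / fX) + (Y / fX) ^ 2
      + fconst (1 + lam) * inverse fX * (X / fX + Y / fX) + fconst lam * inverse fX ^ 2"
    by (simp add: Q_def field_simps power2_eq_square)
  finally have eq: "(fX * fderiv e / e) * (g fX / fX ^ 3) * ((S + T) / B) = \<dots>" .
  obtain k :: int where k: "lim_inf (fX * fderiv e / e) (of_int k)"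
    using lim_inf_logderiv[OF e] by blast
  have l1: "lim_inf ((fX * fderiv e / e) * (g fX / fX ^ 3) * ((S + T) / B))
      (of_int k * 1 * ((1 / \<beta> ^ 3 + 1 / \<beta> ^ 3) / \<beta>))"
    unfolding B_def
    by (intro lim_inf_mult lim_inf_divide[OF _ lim_inf_const b] lim_inf_add k lim_inf_g lS lT)
  have l2: "lim_inf ((X / fX) ^ 2 + (X / fX) * (Y / fX) + (Y / fX) ^ 2
      + fconst (1 + lam) * inverse fX * (X / fX + Y / fX) + fconst lam * inverse fX ^ 2)
      ((1 / \<beta> ^ 2) ^ 2 + (1 / \<beta> ^ 2) * (1 / \<beta> ^ 2) + (1 / \<beta> ^ 2) ^ 2
       + (1 + lam) * 0 * (1 / \<beta> ^ 2 + 1 / \<beta> ^ 2) + lam * 0 ^ 2)"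
    by (intro lim_inf_add lim_inf_mult lim_inf_power lim_inf_const lim_inf_inverse_X
        mult_byD(2)[OF X] mult_byD(2)[OF Y])
  have "of_int k * 1 * ((1 / \<beta> ^ 3 + 1 / \<beta> ^ 3) / \<beta>) =
      (1 / \<beta> ^ 2) ^ 2 + (1 / \<beta> ^ 2) * (1 / \<beta> ^ 2) + (1 / \<beta> ^ 2) ^ 2
       + (1 + lam) * 0 * (1 / \<beta> ^ 2 + 1 / \<beta> ^ 2) + lam * 0 ^ 2"
    using lim_inf_unique[OF l1] l2 unfolding eq by blast
  hence "of_int k * 2 = (3 :: 'a)"
    using b by (simp add: field_simps power2_eq_square power3_eq_cube)
  hence "of_int (k * 2) = (of_int 3 :: 'a)" by simp
  hence "k * 2 = 3" by (simp only: of_int_eq_iff)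
  thus False by presburger
qed

definition chord :: "'a \<Rightarrow> 'a \<Rightarrow> 'a poly fract \<Rightarrow> 'a poly fract \<Rightarrow> 'a poly fract" where
  "chord \<beta> \<gamma> X Y = g fX * ((fderiv X / fconst \<beta> - fderiv Y / fconst \<gamma>) / (X - Y)) ^ 2
     - fconst (1 + lam) - X - Y"

lemma mult_by_neq:
  assumes X: "mult_by \<beta> X" and Y: "mult_by \<gamma> Y" and "\<beta> \<noteq> \<gamma>" "\<beta> \<noteq> - \<gamma>"
  shows "X \<noteq> Y"
proof
  assume "X = Y"
  hence "1 / \<beta> ^ 2 = 1 / \<gamma> ^ 2" using lim_inf_unique mult_byD(2)[OF X] mult_byD(2)[OF Y] by blast
  hence "\<beta> ^ 2 = \<gamma> ^ 2" using mult_byD(1)[OF X] mult_byD(1)[OF Y] by simp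
  with assms show False by (simp add: power2_eq_iff)
qed

text \<open>The differential equation of the sum is \<open>chord_derivation\<close>. The limit at
  infinity is the elementary identity ((u^3 - v^3)/(u^2 - v^2))^2 - u^2 - v^2 = (u v/(u + v))^2 with u =
  1/\<beta> and v = 1/\<gamma>.\<close>
lemma mult_by_chord:
  assumes X: "mult_by \<beta> X" and Y: "mult_by \<gamma> Y" and ne: "\<beta> \<noteq> \<gamma>" "\<beta> \<noteq> - \<gamma>"
  shows "mult_by (\<beta> + \<gamma>) (chord \<beta> \<gamma> X Y)"
proof -
  define f S T where "f = g fX" and "S = fderiv X / fconst \<beta>" and "T = fderiv Y / fconst \<gamma>"
  define L where "L = (S - T) / (X - Y)"
  define a b where "a = fconst (1 + lam)" and "b = fconst lam"
  define X3 where "X3 = f * L ^ 2 - a - X - Y"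
  have X3: "chord \<beta> \<gamma> X Y = X3" by (simp add: chord_def X3_def L_def S_def T_def f_def a_def)
  have XY: "X \<noteq> Y" by (rule mult_by_neq[OF assms])
  have b: "\<beta> \<noteq> 0" "\<gamma> \<noteq> 0" using mult_byD(1) X Y by auto
  have f: "f \<noteq> 0" using g_fX_nonzero by (simp add: f_def)
  have S: "f * S ^ 2 = X ^ 3 + a * X ^ 2 + b * X" and T: "f * T ^ 2 = Y ^ 3 + a * Y ^ 2 + b * Y"
    using mult_byD(5)[OF X] mult_byD(5)[OF Y] unfolding g_expand a_def b_def f_def S_def T_def by auto
  have lS: "lim_inf S (1 / \<beta> ^ 3)" and lT: "lim_inf T (1 / \<gamma> ^ 3)"
    using mult_byD(4)[OF X] mult_byD(4)[OF Y] by (simp_all add: S_def T_def)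
  have dX: "fderiv X = fconst \<beta> * S" and dY: "fderiv Y = fconst \<gamma> * T"
    using b by (simp_all add: S_def T_def)
  have S0: "S \<noteq> 0" "T \<noteq> 0"
    using lim_inf_unique[OF lS, of 0] lim_inf_unique[OF lT, of 0] lim_inf_const[of "0::'a"] b by auto
  have sq: "fderiv (q ^ 2) = 2 * q * fderiv q" and cu: "fderiv (q ^ 3) = 3 * q ^ 2 * fderiv q"
    for q :: "'a poly fract"
    by (simp_all add: power2_eq_square power3_eq_cube fderiv_mult algebra_simps)
  have dab: "fderiv a = 0" "fderiv b = 0" unfolding a_def b_def by (rule fderiv_const)+
  have key: "2 * f * fderiv U = fconst \<delta> * (3 * Z ^ 2 + 2 * a * Z + b) - fderiv f * U"
    if "f * U ^ 2 = Z ^ 3 + a * Z ^ 2 + b * Z" "fderiv Z = fconst \<delta> * U" "U \<noteq> 0" for U Z \<delta>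
  proof -
    have "fderiv (f * U ^ 2) = fderiv (Z ^ 3 + a * Z ^ 2 + b * Z)" using that by simp
    hence "U * (2 * f * fderiv U + fderiv f * U) = U * (fconst \<delta> * (3 * Z ^ 2 + 2 * a * Z + b))"
      using that(2) dab by (simp add: fderiv_mult fderiv_add sq cu) Groebner_Basis.algebra
    hence "2 * f * fderiv U + fderiv f * U = fconst \<delta> * (3 * Z ^ 2 + 2 * a * Z + b)"
      using that(3) by (simp only: mult_cancel_left) simp
    thus ?thesis by (simp add: algebra_simps)
  qed
  have dL: "fderiv L = (fderiv S - fderiv T - L * (fderiv X - fderiv Y)) / (X - Y)"
    using XY unfolding L_def by (simp add: fderiv_divide fderiv_diff)
  define S3 where "S3 = - (L * (X3 - X) + S)"
  have "fderiv X3 = fderiv f * L ^ 2 + 2 * f * L * fderiv L - fderiv X - fderiv Y"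
    unfolding X3_def by (simp add: fderiv_diff fderiv_add fderiv_mult sq dab algebra_simps)
  also have "\<dots> = (fconst \<beta> + fconst \<gamma>) * S3" unfolding S3_def
    by (rule chord_derivation[OF S T XY L_def X3_def dX dY key[OF S dX S0(1)] key[OF T dY S0(2)] dL])
  finally have d3: "fderiv X3 = fconst (\<beta> + \<gamma>) * S3" by simp
  have S3: "f * S3 ^ 2 = X3 ^ 3 + a * X3 ^ 2 + b * X3"
    using chord_cubic(1)[OF S T XY L_def X3_def, of X3] by (simp add: S3_def power2_eq_square algebra_simps)
  have bg: "\<beta> + \<gamma> \<noteq> 0" "1 / \<beta> ^ 2 - 1 / \<gamma> ^ 2 \<noteq> 0"
  proof -
    show "\<beta> + \<gamma> \<noteq> 0" using ne by (simp add: eq_neg_iff_add_eq_0)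
    show "1 / \<beta> ^ 2 - 1 / \<gamma> ^ 2 \<noteq> 0"
      using ne b by (simp add: power2_eq_iff)
  qed
  have "X3 / fX = (f / fX ^ 3) * ((S - T) / (X / fX - Y / fX)) ^ 2 - a * inverse fX - X / fX - Y / fX"
  proof -
    have "(S - T) / (X / fX - Y / fX) = fX * L"
      by (simp add: L_def flip: diff_divide_distrib)
    thus ?thesis by (simp add: X3_def field_simps power2_eq_square power3_eq_cube)
  qed
  moreover have "lim_inf \<dots> (1 * ((1 / \<beta> ^ 3 - 1 / \<gamma> ^ 3) / (1 / \<beta> ^ 2 - 1 / \<gamma> ^ 2)) ^ 2
       - (1 + lam) * 0 - 1 / \<beta> ^ 2 - 1 / \<gamma> ^ 2)"
    unfolding f_def a_def
    by (intro lim_inf_diff lim_inf_mult lim_inf_power lim_inf_divide lim_inf_g lS lT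
        lim_inf_const lim_inf_inverse_X mult_byD(2)[OF X] mult_byD(2)[OF Y] bg)
  moreover have "1 * ((1 / \<beta> ^ 3 - 1 / \<gamma> ^ 3) / (1 / \<beta> ^ 2 - 1 / \<gamma> ^ 2)) ^ 2
       - (1 + lam) * 0 - 1 / \<beta> ^ 2 - 1 / \<gamma> ^ 2 = 1 / (\<beta> + \<gamma>) ^ 2"
  proof -
    define u v where "u = 1 / \<beta>" and "v = 1 / \<gamma>"
    have uv: "u \<noteq> 0" "v \<noteq> 0" using b by (simp_all add: u_def v_def)
    have beq: "\<beta> = 1 / u" "\<gamma> = 1 / v" by (simp_all add: u_def v_def)
    have "u - v \<noteq> 0" "u + v \<noteq> 0" using ne b by (auto simp: u_def v_def field_simps eq_neg_iff_add_eq_0)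
    have "(u ^ 3 - v ^ 3) = (u - v) * (u ^ 2 + u * v + v ^ 2)" "u ^ 2 - v ^ 2 = (u - v) * (u + v)"
      by (simp_all add: algebra_simps power2_eq_square power3_eq_cube)
    hence "(u ^ 3 - v ^ 3) / (u ^ 2 - v ^ 2) = (u ^ 2 + u * v + v ^ 2) / (u + v)"
      using \<open>u - v \<noteq> 0\<close> by simp
    moreover have "((u ^ 2 + u * v + v ^ 2) / (u + v)) ^ 2 - u ^ 2 - v ^ 2 = (u * v / (u + v)) ^ 2"
    proof -
      have "(u ^ 2 + u * v + v ^ 2) ^ 2 = (u * v) ^ 2 + (u ^ 2 + v ^ 2) * (u + v) ^ 2" by Groebner_Basis.algebra
      hence "((u ^ 2 + u * v + v ^ 2) / (u + v)) ^ 2 = (u * v / (u + v)) ^ 2 + (u ^ 2 + v ^ 2)"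
        using \<open>u + v \<noteq> 0\<close> unfolding power_divide by (simp add: add_divide_distrib)
      thus ?thesis by simp
    qed
    moreover have "1 / (\<beta> + \<gamma>) = u * v / (u + v)"
      using uv \<open>u + v \<noteq> 0\<close> unfolding beq by (simp add: field_simps)
    ultimately show ?thesis
      unfolding beq by (simp add: power_one_over[symmetric])
  qed
  ultimately have l3: "lim_inf (X3 / fX) (1 / (\<beta> + \<gamma>) ^ 2)" by simp
  have "g fX * fderiv X3 ^ 2 = fconst ((\<beta> + \<gamma>) ^ 2) * g X3"
    using S3 unfolding g_expand d3 a_def b_def f_def fconst_power by Groebner_Basis.algebra
  with l3 bg(1) show ?thesis unfolding X3 mult_by_def by blast
qed

text \<open>Evaluate the cubic of the chord at a root e of g: its constant side is then minus f times a
  square. This is the homomorphism property of the map x - e to square classes.\<close>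
lemma chord_square_class:
  assumes X: "mult_by \<beta> X" and Y: "mult_by \<gamma> Y" and ne: "\<beta> \<noteq> \<gamma>" "\<beta> \<noteq> - \<gamma>"
    and e: "g e = 0"
  shows "\<exists>l. (chord \<beta> \<gamma> X Y - e) * (X - e) * (Y - e) = g fX * l ^ 2"
proof -
  have S: "g fX * (fderiv X / fconst \<beta>) ^ 2 = X ^ 3 + fconst (1 + lam) * X ^ 2 + fconst lam * X"
    and T: "g fX * (fderiv Y / fconst \<gamma>) ^ 2 = Y ^ 3 + fconst (1 + lam) * Y ^ 2 + fconst lam * Y"
    using mult_byD(5)[OF X] mult_byD(5)[OF Y] unfolding g_expand by auto
  have e': "e ^ 3 + fconst (1 + lam) * e ^ 2 + fconst lam * e = 0" using e by (simp only: g_expand)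
  define l where "l = (fderiv X / fconst \<beta> - fderiv Y / fconst \<gamma>) / (X - Y) * (e - X) + fderiv X / fconst \<beta>"
  have "0 - g fX * l ^ 2 = (e - X) * (e - Y) * (e - chord \<beta> \<gamma> X Y)"
    using chord_cubic(1)[OF S T mult_by_neq[OF X Y ne] refl chord_def[of \<beta> \<gamma> X Y], of e]
    unfolding e' l_def .
  hence "(chord \<beta> \<gamma> X Y - e) * (X - e) * (Y - e) = g fX * l ^ 2"
    by (simp add: algebra_simps)
  thus ?thesis by blast
qed

lemma mult_by_1: "mult_by 1 fX"
  using lim_inf_const[of "1::'a"] by (simp add: mult_by_def)

end

section \<open>Degrees\<close>

lemma dvd_of_dvd_mult_coprime:
  fixes b :: "'a::euclidean_ring_gcd"
  assumes "coprime c d" "b dvd c * C" "b dvd d * C"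
  shows "b dvd C"
proof -
  obtain u v where "u * c + v * d = 1"
    using bezout_coefficients_fst_snd[of c d] assms(1) by (metis coprime_iff_gcd_eq_1)
  hence "(u * c + v * d) * C = C" by simp
  hence "C = u * (c * C) + v * (d * C)" by (simp add: algebra_simps)
  moreover have "b dvd u * (c * C) + v * (d * C)" by (rule dvd_add[OF dvd_mult[OF assms(2)] dvd_mult[OF assms(3)]])
  ultimately show ?thesis by simp
qed

text \<open>For a/b and c/d in lowest terms, the pair formed by their sum and their product has exact
  common denominator bd: any common denominator C of both is divisible by bd.\<close>
lemma denominators_dvd:
  fixes b :: "'a::euclidean_ring_gcd"
  assumes ab: "coprime a b" and cd: "coprime c d" and "b \<noteq> 0"
    and eqA: "(a * d + c * b) * C = A * (b * d)" and eqB: "a * c * C = B * (b * d)"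
  shows "b * d dvd C"
proof -
  have ba: "coprime b a" and dc: "coprime d c" using ab cd by (simp_all add: coprime_commute)
  have "b dvd (a * d + c * b) * C" unfolding eqA by simp
  moreover have "(a * d + c * b) * C = b * (c * C) + a * (d * C)" by (simp add: algebra_simps)
  ultimately have "b dvd a * (d * C)" by (simp add: dvd_add_right_iff)
  hence 1: "b dvd d * C" using ba by (simp add: coprime_dvd_mult_right_iff)
  have "a * (c * C) = b * (B * d)" using eqB by (simp add: mult_ac)
  hence "b dvd a * (c * C)" by simp
  hence 2: "b dvd c * C" using ba by (simp add: coprime_dvd_mult_right_iff)
  from dvd_of_dvd_mult_coprime[OF cd 2 1] obtain C1 where C1: "C = b * C1" by (elim dvdE)
  have "b * ((a * d + c * b) * C1) = b * (A * d)" using eqA C1 by (simp add: mult_ac)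
  hence "(a * d + c * b) * C1 = A * d" using \<open>b \<noteq> 0\<close> by simp
  hence "d dvd (a * d + c * b) * C1" by simp
  moreover have "(a * d + c * b) * C1 = d * (a * C1) + c * (b * C1)" by (simp add: algebra_simps)
  ultimately have "d dvd c * (b * C1)" by (simp add: dvd_add_right_iff)
  hence 3: "d dvd b * C1" using dc by (simp add: coprime_dvd_mult_right_iff)
  have "b * (a * c * C1) = b * (B * d)" using eqB C1 by (simp add: mult_ac)
  hence "a * c * C1 = B * d" using \<open>b \<noteq> 0\<close> by simp
  moreover have "c * (a * C1) = a * c * C1" by (simp add: mult_ac)
  ultimately have "d dvd c * (a * C1)" by simp
  hence 4: "d dvd a * C1" using dc by (simp add: coprime_dvd_mult_right_iff)
  have "d dvd C1" by (rule dvd_of_dvd_mult_coprime[OF ab 4 3])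
  thus ?thesis using C1 by simp
qed

lemma dvd_const_mult_cancel:
  "c \<noteq> 0 \<Longrightarrow> r dvd [:c:] * q \<longleftrightarrow> r dvd (q :: 'a::field poly)"
  by (simp add: dvd_smult_iff)

text \<open>Up to squares and constants the three forms are the denominator and the two numerators of sum
  and product in \<open>chord_sum_product\<close>. A common prime factor would divide n1^2 - lam d1^2 and
  2 n1 + (1 + lam) d1, hence the discriminant multiple (1 - lam)^2 d1^2.\<close>
lemma parallelogram_forms_coprime:
  fixes lam :: "'a::{field_char_0, field_gcd}" and r :: "'a poly"
  assumes lam: "lam \<noteq> 0" "lam \<noteq> 1" and r: "prime_elem r"
    and cop: "coprime n1 d1" "coprime n2 d2"
    and rC: "r dvd n1 * d2 - n2 * d1" and rB: "r dvd n1 * n2 - [:lam:] * (d1 * d2)"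
    and rA: "r dvd (n1 * d2 + n2 * d1) * (n1 * n2 + [:lam:] * (d1 * d2)) + [:2 * (1 + lam):] * (n1 * n2 * d1 * d2)"
  shows False
proof -
  have nu: "\<not> is_unit r" using r by (simp add: prime_elem_def)
  have c1: "\<not> (r dvd n1 \<and> r dvd d1)" "\<not> (r dvd n2 \<and> r dvd d2)"
    using cop nu by (auto dest: coprime_common_divisor)
  have pd: "r dvd u * v \<longleftrightarrow> r dvd u \<or> r dvd v" for u v using r by (rule prime_elem_dvd_mult_iff)
  have iff: "r dvd d1 \<longleftrightarrow> r dvd d2"
  proof
    assume "r dvd d1"
    hence "r dvd n1 * d2" using rC by (simp add: dvd_diff_left_iff)
    thus "r dvd d2" using \<open>r dvd d1\<close> c1 pd by blast
  next
    assume "r dvd d2"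
    hence "r dvd n2 * d1" using rC by (simp add: dvd_diff_right_iff)
    thus "r dvd d1" using \<open>r dvd d2\<close> c1 pd by blast
  qed
  have nd: "\<not> r dvd d1" "\<not> r dvd d2"
  proof -
    have "\<not> r dvd d1"
    proof
      assume "r dvd d1"
      hence "r dvd [:lam:] * (d1 * d2)" by (intro dvd_mult dvd_mult2)
      hence "r dvd n1 * n2" using rB by (simp only: dvd_diff_left_iff)
      thus False using \<open>r dvd d1\<close> iff c1 pd by blast
    qed
    thus "\<not> r dvd d1" "\<not> r dvd d2" using iff by auto
  qed
  \<comment> \<open>Modulo r one has n2 d1 = n1 d2, which eliminates n2 from the other two forms.\<close>
  have "r dvd d1 * (n1 * n2 - [:lam:] * (d1 * d2)) + n1 * (n1 * d2 - n2 * d1)"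
    by (rule dvd_add[OF dvd_mult[OF rB] dvd_mult[OF rC]])
  also have "\<dots> = d2 * (n1 ^ 2 - [:lam:] * d1 ^ 2)" by Groebner_Basis.algebra
  finally have 1: "r dvd n1 ^ 2 - [:lam:] * d1 ^ 2" using pd nd by blast
  have "r dvd ((n1 * d2 + n2 * d1) * (n1 * n2 + [:lam:] * (d1 * d2)) + [:2 * (1 + lam):] * (n1 * n2 * d1 * d2))
      + (n1 * d2 - n2 * d1) * (n1 * n2 + [:lam:] * (d1 * d2))
      - (n1 * n2 - [:lam:] * (d1 * d2)) * (2 * n1 * d2 + [:2 * (1 + lam):] * (d1 * d2))"
    by (rule dvd_diff[OF dvd_add[OF rA dvd_mult2[OF rC]] dvd_mult2[OF rB]])
  also have "\<dots> = [:2 * lam:] * (d1 * d2 ^ 2 * (2 * n1 + [:1 + lam:] * d1))"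
  proof -
    have c: "[:2 * (1 + lam):] = 2 * (1 + [:lam:])" "[:2 * lam:] = 2 * [:lam:]" "[:1 + lam:] = 1 + [:lam:]"
      by (simp_all add: one_pCons numeral_poly)
    show ?thesis unfolding c by Groebner_Basis.algebra
  qed
  finally have 2: "r dvd 2 * n1 + [:1 + lam:] * d1"
    using lam pd nd prime_elem_dvd_power[OF r] by (auto simp: dvd_smult_iff)
  have "r dvd (2 * n1 + [:1 + lam:] * d1) * (2 * n1 - [:1 + lam:] * d1) - 4 * (n1 ^ 2 - [:lam:] * d1 ^ 2)"
    by (rule dvd_diff[OF dvd_mult2[OF 2] dvd_mult[OF 1]])
  also have "\<dots> = [:- ((1 - lam) ^ 2):] * d1 ^ 2"
  proof -
    have c: "[:- ((1 - lam) ^ 2):] = - ((1 - [:lam:]) ^ 2)" "[:1 + lam:] = 1 + [:lam:]"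
      by (simp_all add: one_pCons power2_eq_square algebra_simps)
    show ?thesis unfolding c by Groebner_Basis.algebra
  qed
  finally have "r dvd d1 ^ 2" using lam by (simp add: dvd_smult_iff)
  thus False using nd prime_elem_dvd_power[OF r] by blast
qed

text \<open>Sum and product of a/b and c/d are given by forms in the two original fractions. Since the
  forms have no common factor, the cofactor k between the two denominators is a constant, and the degrees
  can be read off from the product.\<close>
lemma parallelogram_degree:
  fixes lam :: "'a::{field_char_0, field_gcd}" and a b c d n1 d1 n2 d2 :: "'a poly"
  assumes lam: "lam \<noteq> 0" "lam \<noteq> 1"
    and cop: "coprime n1 d1" "coprime n2 d2" "coprime a b" "coprime c d"
    and deg: "degree d1 < degree n1" "degree d2 < degree n2" and b: "b \<noteq> 0" and d: "d \<noteq> 0"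
    and ne: "n1 * d2 \<noteq> n2 * d1"
    and A: "A = 2 * ((n1 * d2 + n2 * d1) * (n1 * n2 + [:lam:] * (d1 * d2))
              + [:2 * (1 + lam):] * (n1 * n2 * d1 * d2))"
    and eqA: "(a * d + c * b) * (n1 * d2 - n2 * d1) ^ 2 = A * (b * d)"
    and eqB: "a * c * (n1 * d2 - n2 * d1) ^ 2 = (n1 * n2 - [:lam:] * (d1 * d2)) ^ 2 * (b * d)"
  shows "degree a + degree c = 2 * degree n1 + 2 * degree n2"
proof -
  obtain k where k: "(n1 * d2 - n2 * d1) ^ 2 = (b * d) * k"
    using denominators_dvd[OF cop(3,4) b eqA eqB] by (elim dvdE)
  have k0: "k \<noteq> 0" using k ne by auto
  have "(b * d) * ((a * d + c * b) * k) = (b * d) * A" using eqA k by (simp add: mult_ac)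
  hence Ak: "A = (a * d + c * b) * k" using b d by simp
  have "(b * d) * (a * c * k) = (b * d) * (n1 * n2 - [:lam:] * (d1 * d2)) ^ 2"
    using eqB k by (simp add: mult_ac)
  hence Bk: "(n1 * n2 - [:lam:] * (d1 * d2)) ^ 2 = a * c * k"
    using b d by (metis mult_cancel_left no_zero_divisors)
  have "is_unit k"
  proof (rule ccontr)
    assume "\<not> is_unit k"
    then obtain r where r: "r dvd k" "prime r" using k0 prime_divisor_exists by blast
    hence pr: "prime_elem r" by simp
    have "r dvd (n1 * d2 - n2 * d1) ^ 2" using r k by simp
    hence rC: "r dvd n1 * d2 - n2 * d1" using prime_elem_dvd_power[OF pr] by blast
    have "r dvd (n1 * n2 - [:lam:] * (d1 * d2)) ^ 2" using r Bk by simp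
    hence rB: "r dvd n1 * n2 - [:lam:] * (d1 * d2)" using prime_elem_dvd_power[OF pr] by blast
    have "r dvd [:2:] * ((n1 * d2 + n2 * d1) * (n1 * n2 + [:lam:] * (d1 * d2))
              + [:2 * (1 + lam):] * (n1 * n2 * d1 * d2))"
      using r Ak A by (simp add: numeral_poly)
    hence "r dvd (n1 * d2 + n2 * d1) * (n1 * n2 + [:lam:] * (d1 * d2))
              + [:2 * (1 + lam):] * (n1 * n2 * d1 * d2)"
      by (subst (asm) dvd_const_mult_cancel) auto
    from parallelogram_forms_coprime[OF lam pr cop(1,2) rC rB this] show False .
  qed
  hence dk: "degree k = 0" using k0 by (simp add: is_unit_iff_degree)
  define P where "P = n1 * n2 - [:lam:] * (d1 * d2)"
  have n0: "n1 \<noteq> 0" "n2 \<noteq> 0" using deg by auto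
  have "degree ([:lam:] * (d1 * d2)) \<le> degree d1 + degree d2"
    using degree_mult_le[of d1 d2] by simp
  also have "\<dots> < degree (n1 * n2)" using n0 deg by (simp add: degree_mult_eq)
  finally have P: "degree P = degree n1 + degree n2"
    unfolding P_def using n0 by (subst diff_conv_add_uminus, subst degree_add_eq_left) (auto simp: degree_mult_eq)
  hence P0: "P \<noteq> 0" using deg by auto
  have ac: "a \<noteq> 0" "c \<noteq> 0" using Bk P0 unfolding P_def by auto
  have "degree (P ^ 2) = degree (a * c * k)" using Bk by (simp add: P_def)
  thus ?thesis using ac k0 dk P P0 by (simp add: degree_mult_eq degree_power_eq)
qed

text \<open>The degree of the numerator in lowest terms; for a multiplication map the numerator has the
  larger degree, so this is the degree of the map.\<close>
definition rdeg :: "'a::field_gcd poly fract \<Rightarrow> nat" where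
  "rdeg X = degree (fst (quot_of_fract X))"

lemma rdeg_Fract:
  fixes n d :: "'a::field_gcd poly"
  assumes "coprime n d" "d \<noteq> 0"
  shows "rdeg (Fract n d) = degree n"
proof -
  define n' d' where "n' = fst (quot_of_fract (Fract n d))" and "d' = snd (quot_of_fract (Fract n d))"
  have d': "d' \<noteq> 0" and cop: "coprime n' d'"
    using coprime_quot_of_fract by (auto simp: n'_def d'_def)
  have "Fract n' d' = Fract n d" by (simp add: n'_def d'_def)
  hence eq: "n' * d = n * d'" using d' assms by (simp add: eq_fract)
  have "n dvd n'" using eq assms(1) by (metis coprime_dvd_mult_left_iff dvd_triv_left)
  moreover have "n' dvd n" using eq cop by (metis coprime_dvd_mult_left_iff dvd_triv_left)
  ultimately have "degree n = degree n'"
    by (metis antisym dvd_0_left dvd_imp_degree_le)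
  thus ?thesis by (simp add: rdeg_def n'_def)
qed

lemma fract_coprime_rep:
  fixes X :: "'a::field_gcd poly fract"
  obtains n d where "X = Fract n d" "d \<noteq> 0" "coprime n d" "rdeg X = degree n"
  using that[of "fst (quot_of_fract X)" "snd (quot_of_fract X)"] coprime_quot_of_fract[of X]
  by (simp add: rdeg_def)

lemma coprime_if_const_remainder:
  fixes n d :: "'a::field_gcd poly"
  assumes "n = d * q + [:r:]" "r \<noteq> 0" shows "coprime n d"
proof (rule coprimeI)
  fix c assume c: "c dvd n" "c dvd d"
  hence "c dvd n - d * q" by (metis dvd_diff dvd_mult2)
  hence "c dvd [:r:]" using assms by simp
  thus "is_unit c" using assms(2) by (metis dvd_trans is_unit_const_poly_iff dvd_field_iff)
qed

lemma to_fract_numeral: "to_fract (numeral k) = (numeral k :: 'a::idom poly fract)"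
  using fconst_numeral[of k, where 'a = 'a]
  by (simp add: fconst_def to_fract_def numeral_poly)

context legendre_curve
begin

lemma mult_by_degree:
  assumes "mult_by \<beta> (Fract n d)" "d \<noteq> 0"
  shows "degree n = Suc (degree d)" "lead_coeff n = lead_coeff d / \<beta> ^ 2"
proof -
  have "lim_inf (Fract n (pCons 0 d)) (1 / \<beta> ^ 2)"
    using mult_byD(2)[OF assms(1)] assms(2) by (simp add: fract_div_X)
  hence *: "degree n \<le> Suc (degree d)" "coeff n (Suc (degree d)) = lead_coeff d / \<beta> ^ 2"
    using assms(2) by (simp_all add: lim_inf_Fract)
  moreover have "coeff n (Suc (degree d)) \<noteq> 0"
    unfolding *(2) using mult_byD(1)[OF assms(1)] assms(2) by simp
  ultimately show "degree n = Suc (degree d)" by (metis le_antisym le_degree)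
  with * show "lead_coeff n = lead_coeff d / \<beta> ^ 2" by simp
qed

lemma rdeg_parallelogram:
  assumes X: "mult_by \<beta> X" and Y: "mult_by \<gamma> Y" and ne: "\<beta> \<noteq> \<gamma>" "\<beta> \<noteq> - \<gamma>"
    and U: "mult_by (\<beta> + \<gamma>) U" and V: "mult_by (\<beta> - \<gamma>) V"
  shows "rdeg U + rdeg V = 2 * rdeg X + 2 * rdeg Y"
proof -
  obtain n1 d1 where 1: "X = Fract n1 d1" "d1 \<noteq> 0" "coprime n1 d1" "rdeg X = degree n1"
    by (rule fract_coprime_rep)
  obtain n2 d2 where 2: "Y = Fract n2 d2" "d2 \<noteq> 0" "coprime n2 d2" "rdeg Y = degree n2"
    by (rule fract_coprime_rep)
  obtain a b where 3: "U = Fract a b" "b \<noteq> 0" "coprime a b" "rdeg U = degree a"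
    by (rule fract_coprime_rep)
  obtain c d where 4: "V = Fract c d" "d \<noteq> 0" "coprime c d" "rdeg V = degree c"
    by (rule fract_coprime_rep)
  have XY: "X \<noteq> Y" by (rule mult_by_neq[OF X Y ne])
  have U': "U = chord \<beta> \<gamma> X Y" by (rule mult_by_unique[OF U mult_by_chord[OF X Y ne]])
  have Y': "mult_by (- \<gamma>) Y" using Y by (simp add: mult_by_minus)
  have "mult_by (\<beta> + - \<gamma>) (chord \<beta> (- \<gamma>) X Y)"
    by (rule mult_by_chord[OF X Y']) (use ne in auto)
  hence V': "V = chord \<beta> (- \<gamma>) X Y" using V mult_by_unique by simp
  define S T where "S = fderiv X / fconst \<beta>" and "T = fderiv Y / fconst \<gamma>"
  have S: "g fX * S ^ 2 = X ^ 3 + fconst (1 + lam) * X ^ 2 + fconst lam * X"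
    and T: "g fX * T ^ 2 = Y ^ 3 + fconst (1 + lam) * Y ^ 2 + fconst lam * Y"
    using mult_byD(5)[OF X] mult_byD(5)[OF Y] unfolding g_expand S_def T_def by auto
  have U'': "U = g fX * ((S - T) / (X - Y)) ^ 2 - fconst (1 + lam) - X - Y"
    unfolding U' by (simp only: chord_def S_def T_def)
  have V'': "V = g fX * ((S + T) / (X - Y)) ^ 2 - fconst (1 + lam) - X - Y"
    unfolding V' by (simp add: chord_def S_def T_def)
  note sp = chord_sum_product[OF S T XY mult_byD(3)[OF X] mult_byD(3)[OF Y] U'' V'']
  define \<tau> where "\<tau> = (to_fract :: 'a poly \<Rightarrow> _)"
  have e1: "\<tau> n1 = X * \<tau> d1" and e2: "\<tau> n2 = Y * \<tau> d2" and e3: "\<tau> a = U * \<tau> b" and e4: "\<tau> c = V * \<tau> d"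
    using 1 2 3 4 by (simp_all add: Fract_conv_to_fract \<tau>_def)
  have \<tau>c: "fconst k = \<tau> [:k:]" for k by (simp add: fconst_def \<tau>_def to_fract_def)
  define A where "A = 2 * ((n1 * d2 + n2 * d1) * (n1 * n2 + [:lam:] * (d1 * d2))
              + [:2 * (1 + lam):] * (n1 * n2 * d1 * d2))"
  have "\<tau> ((a * d + c * b) * (n1 * d2 - n2 * d1) ^ 2)
      = (\<tau> b * \<tau> d * (\<tau> d1 * \<tau> d2) ^ 2) * ((U + V) * (X - Y) ^ 2)"
    using e1 e2 e3 e4 by (simp add: \<tau>_def power2_eq_square algebra_simps to_fract_numeral)
  also have "\<dots> = \<tau> (A * (b * d))"
  proof -
    have 2: "[:2 * (1 + lam):] = 2 * [:1 + lam:]" by (simp add: numeral_poly)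
    define l m where "l = [:lam:]" and "m = [:1 + lam:]"
    show ?thesis unfolding sp(1) A_def \<tau>c 2 l_def[symmetric] m_def[symmetric] using e1 e2
      by (simp add: \<tau>_def power2_eq_square algebra_simps to_fract_numeral)
  qed
  finally have eqA: "(a * d + c * b) * (n1 * d2 - n2 * d1) ^ 2 = A * (b * d)"
    by (simp only: \<tau>_def to_fract_eq_iff)
  have "\<tau> (a * c * (n1 * d2 - n2 * d1) ^ 2)
      = (\<tau> b * \<tau> d * (\<tau> d1 * \<tau> d2) ^ 2) * ((U * V) * (X - Y) ^ 2)"
    using e1 e2 e3 e4 by (simp add: \<tau>_def power2_eq_square algebra_simps to_fract_numeral)
  also have "\<dots> = \<tau> ((n1 * n2 - [:lam:] * (d1 * d2)) ^ 2 * (b * d))"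
  proof -
    define l where "l = [:lam:]"
    show ?thesis unfolding sp(2) \<tau>c l_def[symmetric] using e1 e2
      by (simp add: \<tau>_def power2_eq_square algebra_simps to_fract_numeral)
  qed
  finally have eqB: "a * c * (n1 * d2 - n2 * d1) ^ 2 = (n1 * n2 - [:lam:] * (d1 * d2)) ^ 2 * (b * d)"
    by (simp only: \<tau>_def to_fract_eq_iff)
  have deg: "degree d1 < degree n1" "degree d2 < degree n2"
    using mult_by_degree(1) X Y 1 2 by simp_all
  have "n1 * d2 \<noteq> n2 * d1" using XY 1 2 by (auto simp: eq_fract)
  from parallelogram_degree[OF lam_nonzero lam_not_1 1(3) 2(3) 3(3) 4(3) deg 3(2) 4(2) this A_def eqA eqB]
  show ?thesis using 1 2 3 4 by simp
qed

end

section \<open>Complex multiplication\<close>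

text \<open>al is a root of t^2 - t + 2, so it plays the role of (1 + sqrt(-7))/2, and lam = 3 al - 1 is
  the fourth power of its conjugate.\<close>
locale cm_curve =
  fixes al :: "'a::{field_char_0, field_gcd}"
  assumes al: "al ^ 2 = al - 2"
begin

sublocale legendre_curve "3 * al - 1"
proof
  have "(3 * al - 1) * (1 - (3 * al - 1)) = 16" using al by Groebner_Basis.algebra
  thus "3 * al - 1 \<noteq> 0" "3 * al - 1 \<noteq> 1" by auto
qed

abbreviation ab :: 'a where "ab \<equiv> 1 - al"

lemma al_nonzero: "al \<noteq> 0" and ab_nonzero: "ab \<noteq> 0"
proof -
  have "al * ab = 2" using al by Groebner_Basis.algebra
  thus "al \<noteq> 0" "ab \<noteq> 0" by auto
qed

lemma fconst_al: "fconst al ^ 2 = fconst al - 2"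
  using arg_cong[OF al, of fconst] by simp

text \<open>Multiplication by al and by its conjugate ab have degree 2; their kernels are generated by
  (0,0) and by (-1,0), and the corresponding quotient curves are isomorphic to the curve itself.\<close>
definition X_al :: "'a poly fract" where
  "X_al = (fX - fconst (ab ^ 2)) ^ 2 / (fconst (al ^ 2) * fX)"

definition X_ab :: "'a poly fract" where
  "X_ab = fX * (fX + fconst (3 * al - 1)) / (fconst (ab ^ 2) * (fX + 1))"

lemma fX_plus_1_nonzero: "fX + 1 \<noteq> (0 :: 'a poly fract)"
  by (simp add: fX_def One_fract_def Zero_fract_def eq_fract one_pCons)

lemma mult_by_al: "mult_by al X_al"
proof -
  define c where "c = fconst al"
  have c: "c ^ 2 = c - 2" using fconst_al by (simp add: c_def)
  have c0: "c \<noteq> 0" using al_nonzero by (simp add: c_def)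
  have B: "fconst (ab ^ 2) = - 1 - c" using c by (simp add: c_def) Groebner_Basis.algebra
  have L: "fconst (3 * al - 1) = 3 * c - 1" by (simp add: c_def)
  have X: "(c ^ 2 * fX) * X_al = (fX + 1 + c) ^ 2"
  proof -
    have *: "fX - (- 1 - c) = fX + 1 + c" by simp
    show ?thesis unfolding X_al_def B * using c0 by (simp add: c_def[symmetric])
  qed
  have "fderiv ((c ^ 2 * fX) * X_al) = fderiv ((fX + 1 + c) ^ 2)" using X by simp
  hence "c ^ 2 * X_al + c ^ 2 * fX * fderiv X_al = 2 * (fX + 1 + c)"
    using fderiv_const[of al, folded c_def] fderiv_const[of "1::'a"] fderiv_const[of "2::'a"]
    by (simp add: power2_eq_square fderiv_mult fderiv_add algebra_simps)
  hence D: "c ^ 2 * fX ^ 2 * fderiv X_al = (fX + 1 + c) * (fX - 1 - c)"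
    using X by Groebner_Basis.algebra
  have 1: "(c ^ 2 * fX) * (X_al + 1) = (fX + 1) * (fX + (3 * c - 1))" using X c by Groebner_Basis.algebra
  have 2: "(c ^ 2 * fX) * (X_al + (3 * c - 1)) = (fX - 1 - c) ^ 2" using X c by Groebner_Basis.algebra
  have "(c ^ 4 * fX ^ 4) * (g fX * fderiv X_al ^ 2) = g fX * (c ^ 2 * fX ^ 2 * fderiv X_al) ^ 2"
    by Groebner_Basis.algebra
  also have "\<dots> = fX * ((fX + 1 + c) ^ 2) * ((fX + 1) * (fX + (3 * c - 1))) * ((fX - 1 - c) ^ 2)"
    unfolding D g_def L by Groebner_Basis.algebra
  also have "\<dots> = (c ^ 4 * fX ^ 4) * (c ^ 2 * g X_al)"
    unfolding g_def L X[symmetric] 1[symmetric] 2[symmetric] by Groebner_Basis.algebra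
  finally have ode: "g fX * fderiv X_al ^ 2 = fconst (al ^ 2) * g X_al"
    using c0 by (simp add: c_def)
  have "X_al / fX = (1 - fconst (ab ^ 2) * inverse fX) ^ 2 / fconst (al ^ 2)"
    unfolding X_al_def by (simp add: field_simps power2_eq_square)
  moreover have "lim_inf ((fconst 1 - fconst (ab ^ 2) * inverse fX) ^ 2 / fconst (al ^ 2))
     ((1 - ab ^ 2 * 0) ^ 2 / al ^ 2)"
    by (intro lim_inf_divide lim_inf_power lim_inf_diff lim_inf_mult lim_inf_const lim_inf_inverse_X)
       (use al_nonzero in auto)
  ultimately have "lim_inf (X_al / fX) (1 / al ^ 2)" by simp
  with ode al_nonzero show ?thesis by (simp add: mult_by_def)
qed

lemma mult_by_ab: "mult_by ab X_ab"
proof -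
  define c where "c = fconst al"
  have c: "c ^ 2 = c - 2" using fconst_al by (simp add: c_def)
  have B: "fconst (ab ^ 2) = - 1 - c" using c by (simp add: c_def) Groebner_Basis.algebra
  have c0: "- 1 - c \<noteq> 0" using ab_nonzero fconst_eq_0_iff[of "ab ^ 2"] unfolding B by simp
  have L: "fconst (3 * al - 1) = 3 * c - 1" by (simp add: c_def)
  have X: "((- 1 - c) * (fX + 1)) * X_ab = fX * (fX + (3 * c - 1))"
    unfolding X_ab_def B L using c0 fX_plus_1_nonzero by simp
  have "fderiv (((- 1 - c) * (fX + 1)) * X_ab) = fderiv (fX * (fX + (3 * c - 1)))" using X by simp
  hence "(- 1 - c) * X_ab + ((- 1 - c) * (fX + 1)) * fderiv X_ab = 2 * fX + (3 * c - 1)"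
    using fderiv_const[of al, folded c_def] fderiv_const[of "1::'a"] fderiv_const[of "3::'a"] fderiv_const[of "2::'a"]
    by (simp add: power2_eq_square fderiv_mult fderiv_add fderiv_diff fderiv_minus algebra_simps)
  hence D: "(- 1 - c) * (fX + 1) ^ 2 * fderiv X_ab = (fX - 1 + c) * (fX + 3 - c)"
    using X c by Groebner_Basis.algebra
  have 1: "((- 1 - c) * (fX + 1)) * (X_ab + 1) = (fX - 1 + c) ^ 2" using X c by Groebner_Basis.algebra
  have 2: "((- 1 - c) * (fX + 1)) * (X_ab + (3 * c - 1)) = (fX + 3 - c) ^ 2" using X c by Groebner_Basis.algebra
  have "((- 1 - c) ^ 2 * (fX + 1) ^ 4) * (g fX * fderiv X_ab ^ 2) = 
      g fX * ((- 1 - c) * (fX + 1) ^ 2 * fderiv X_ab) ^ 2"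
    by Groebner_Basis.algebra
  also have "\<dots> = (fX * (fX + (3 * c - 1))) * ((fX - 1 + c) ^ 2) * ((fX + 3 - c) ^ 2) * (fX + 1)"
    unfolding D g_def L by Groebner_Basis.algebra
  also have "\<dots> = ((- 1 - c) ^ 2 * (fX + 1) ^ 4) * ((- 1 - c) * g X_ab)"
    unfolding g_def L X[symmetric] 1[symmetric] 2[symmetric] by Groebner_Basis.algebra
  finally have ode: "g fX * fderiv X_ab ^ 2 = fconst (ab ^ 2) * g X_ab"
    unfolding B using c0 fX_plus_1_nonzero by simp
  have "X_ab / fX = (fconst 1 + fconst (3 * al - 1) * inverse fX) / (fconst (ab ^ 2) * (fconst 1 + inverse fX))"
    unfolding X_ab_def using fX_plus_1_nonzero by (simp add: field_simps power2_eq_square)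
  moreover have "lim_inf ((fconst 1 + fconst (3 * al - 1) * inverse fX) / (fconst (ab ^ 2) * (fconst 1 + inverse fX)))
     ((1 + (3 * al - 1) * 0) / (ab ^ 2 * (1 + 0)))"
    by (intro lim_inf_divide lim_inf_power lim_inf_add lim_inf_mult lim_inf_const lim_inf_inverse_X)
       (use ab_nonzero in auto)
  ultimately have "lim_inf (X_ab / fX) (1 / ab ^ 2)" by simp
  with ode ab_nonzero show ?thesis by (simp add: mult_by_def)
qed

lemma rdeg_fX: "rdeg fX = 1"
  unfolding fX_def by (subst rdeg_Fract) auto

lemma rdeg_X_al: "rdeg X_al = 2"
proof -
  have "X_al = Fract [:ab ^ 4, - 2 * ab ^ 2, 1:] [:0, al ^ 2:]"
    by (simp add: X_al_def fX_def fconst_def power2_eq_square algebra_simps eval_nat_numeral)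
  moreover have "coprime [:ab ^ 4, - 2 * ab ^ 2, 1:] [:0, al ^ 2:]"
    by (rule coprime_if_const_remainder[of _ _ "[:- 2 * ab ^ 2 / al ^ 2, 1 / al ^ 2:]" "ab ^ 4"])
       (use al_nonzero ab_nonzero in auto)
  ultimately show ?thesis using al_nonzero by (simp add: rdeg_Fract)
qed

lemma rdeg_X_ab: "rdeg X_ab = 2"
proof -
  have "X_ab = Fract [:0, 3 * al - 1, 1:] [:ab ^ 2, ab ^ 2:]"
    by (simp add: X_ab_def fX_def fconst_def One_fract_def one_pCons)
  moreover have "coprime [:0, 3 * al - 1, 1:] [:ab ^ 2, ab ^ 2:]"
  proof (rule coprime_if_const_remainder[of _ _ "[:(3 * al - 2) / ab ^ 2, 1 / ab ^ 2:]" "2 - 3 * al"])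
    show "[:0, 3 * al - 1, 1:] =
      [:ab ^ 2, ab ^ 2:] * [:(3 * al - 2) / ab ^ 2, 1 / ab ^ 2:] + [:2 - 3 * al:]"
      using ab_nonzero by simp
    show "2 - 3 * al \<noteq> 0" using lam_not_1 by auto
  qed
  ultimately show ?thesis using ab_nonzero by (simp add: rdeg_Fract)
qed

text \<open>The quadratic form is the norm of m + n al.\<close>
definition endo :: "int \<Rightarrow> int \<Rightarrow> bool" where
  "endo m n \<longleftrightarrow> (\<exists>X. mult_by (of_int m + of_int n * al) X \<and> int (rdeg X) = m ^ 2 + m * n + 2 * n ^ 2)"

lemma of_int_al_eq_0_iff: "of_int m + of_int n * al = 0 \<longleftrightarrow> m = 0 \<and> n = 0"
proof
  assume "of_int m + of_int n * al = 0"
  moreover have "of_int (m ^ 2 + m * n + 2 * n ^ 2) = (of_int m + of_int n * al) * (of_int m + of_int n * ab)"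
    using al by simp Groebner_Basis.algebra
  ultimately have "m ^ 2 + m * n + 2 * n ^ 2 = 0" by (simp del: of_int_add of_int_mult)
  hence "(2 * m + n) ^ 2 + 7 * n ^ 2 = 0" by Groebner_Basis.algebra
  hence "n = 0" "(2 * m + n) = 0"
    using zero_le_power2[of "2 * m + n"] zero_le_power2[of n] by (smt (verit) zero_eq_power2)+
  thus "m = 0 \<and> n = 0" by simp
qed auto

lemma of_int_al_eq_iff:
  "of_int m + of_int n * al = of_int k + of_int l * al \<longleftrightarrow> m = k \<and> n = l"
  using of_int_al_eq_0_iff[of "m - k" "n - l"] by (simp add: algebra_simps)

lemma of_int_al_eq_minus_iff:
  "of_int m + of_int n * al = - (of_int k + of_int l * al) \<longleftrightarrow> m = - k \<and> n = - l"
  using of_int_al_eq_iff[of m n "- k" "- l"] by simp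

lemma endo_minus: "endo (- m) (- n) \<longleftrightarrow> endo m n"
  using mult_by_minus[of "of_int m + of_int n * al"] by (simp add: endo_def algebra_simps)

lemma mult_by_chord_int:
  assumes "mult_by (of_int m + of_int n * al) X" "mult_by (of_int k + of_int l * al) Y"
    and "\<not> (m = k \<and> n = l)" "\<not> (m = - k \<and> n = - l)"
  shows "mult_by (of_int (m + k) + of_int (n + l) * al)
     (chord (of_int m + of_int n * al) (of_int k + of_int l * al) X Y)"
proof -
  have eq: "of_int (m + k) + of_int (n + l) * al = (of_int m + of_int n * al) + (of_int k + of_int l * al)"
    by (simp add: algebra_simps)
  show ?thesis unfolding eq
    by (rule mult_by_chord[OF assms(1,2)])
       (use assms(3,4) in \<open>simp_all only: of_int_al_eq_iff of_int_al_eq_minus_iff simp_thms\<close>)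
qed

lemma rdeg_parallelogram_int:
  assumes X: "mult_by (of_int m + of_int n * al) X" and Y: "mult_by (of_int k + of_int l * al) Y"
    and U: "mult_by (of_int (m + k) + of_int (n + l) * al) U"
    and V: "mult_by (of_int (m - k) + of_int (n - l) * al) V"
    and ne: "\<not> (m = k \<and> n = l)" "\<not> (m = - k \<and> n = - l)"
  shows "rdeg U + rdeg V = 2 * rdeg X + 2 * rdeg Y"
proof (rule rdeg_parallelogram[OF X Y])
  show "mult_by (of_int m + of_int n * al + (of_int k + of_int l * al)) U"
    using U by (simp add: algebra_simps)
  show "mult_by (of_int m + of_int n * al - (of_int k + of_int l * al)) V"
    using V by (simp add: algebra_simps)
qed (use ne in \<open>simp_all only: of_int_al_eq_iff of_int_al_eq_minus_iff simp_thms\<close>)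

text \<open>The norm form satisfies the same parallelogram law as the degree, so the degree at the sum
  follows from the degrees at the two summands and at their difference.\<close>
lemma endo_step:
  assumes "endo m n" "endo k l" "endo (m - k) (n - l)"
    and ne: "\<not> (m = k \<and> n = l)" "\<not> (m = - k \<and> n = - l)"
  shows "endo (m + k) (n + l)"
proof -
  obtain X where X: "mult_by (of_int m + of_int n * al) X" "int (rdeg X) = m ^ 2 + m * n + 2 * n ^ 2"
    using assms(1) by (auto simp: endo_def)
  obtain Y where Y: "mult_by (of_int k + of_int l * al) Y" "int (rdeg Y) = k ^ 2 + k * l + 2 * l ^ 2"
    using assms(2) by (auto simp: endo_def)
  obtain V where V: "mult_by (of_int (m - k) + of_int (n - l) * al) V"
    "int (rdeg V) = (m - k) ^ 2 + (m - k) * (n - l) + 2 * (n - l) ^ 2"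
    using assms(3) unfolding endo_def by blast
  note U = mult_by_chord_int[OF X(1) Y(1) ne]
  have "int (rdeg (chord (of_int m + of_int n * al) (of_int k + of_int l * al) X Y)) + int (rdeg V)
      = 2 * int (rdeg X) + 2 * int (rdeg Y)"
    using rdeg_parallelogram_int[OF X(1) Y(1) U V(1) ne] by linarith
  hence "int (rdeg (chord (of_int m + of_int n * al) (of_int k + of_int l * al) X Y)) =
      (m + k) ^ 2 + (m + k) * (n + l) + 2 * (n + l) ^ 2"
    unfolding X(2) Y(2) V(2) by (simp add: power2_eq_square algebra_simps)
  with U show ?thesis unfolding endo_def by blast
qed

lemma endo_1: "endo 1 0"
  using mult_by_1 rdeg_fX unfolding endo_def by (intro exI[of _ fX]) simp

lemma endo_al: "endo 0 1"
  using mult_by_al rdeg_X_al unfolding endo_def by (intro exI[of _ X_al]) simp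

lemma endo_ab: "endo 1 (- 1)"
  using mult_by_ab rdeg_X_ab unfolding endo_def by (intro exI[of _ X_ab]) simp

lemma endo_1_plus_al: "endo 1 1"
  using endo_step[OF endo_1 endo_al] endo_ab by simp

text \<open>The chord construction does not apply to two equal points, so multiplication by 2 is obtained
  as (1 + al) + (1 - al); its degree then follows from the parallelogram law for 2 and al, with sum 2 +
  al and difference 2 - al.\<close>
lemma endo_2: "endo 2 0"
proof -
  obtain X where X: "mult_by (of_int 1 + of_int 1 * al) X" using endo_1_plus_al unfolding endo_def by blast
  obtain Y where Y: "mult_by (of_int 1 + of_int (- 1) * al) Y" using endo_ab unfolding endo_def by blast
  from mult_by_chord_int[OF X Y] obtain Z where Z: "mult_by (of_int 2 + of_int 0 * al) Z" by auto
  have p: "endo 2 1" using endo_step[OF endo_1_plus_al endo_1] endo_al by simp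
  have m: "endo 2 (- 1)" using endo_step[OF endo_ab endo_1] endo_al endo_minus[of 0 1] by simp
  obtain U where U: "mult_by (of_int 2 + of_int 1 * al) U" "int (rdeg U) = 8"
    using p unfolding endo_def by auto
  obtain V where V: "mult_by (of_int 2 + of_int (- 1) * al) V" "int (rdeg V) = 4"
    using m unfolding endo_def by auto
  obtain A where A: "mult_by (of_int 0 + of_int 1 * al) A" "int (rdeg A) = 2"
    using endo_al unfolding endo_def by auto
  have "rdeg U + rdeg V = 2 * rdeg Z + 2 * rdeg A"
    by (rule rdeg_parallelogram_int[OF Z A(1)]) (use U V in simp_all)
  hence "int (rdeg Z) = 4" using U V A by linarith
  with Z show ?thesis unfolding endo_def by (intro exI[of _ Z]) simp
qed

text \<open>An induction over the lattice in which every step is a chord of two points that are neither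
  equal nor opposite. Staying at n = 0 or n = 1 until m is reached, and increasing n only for m \<noteq>
  0, keeps every step away from the degenerate chords.\<close>
lemma endo_all:
  assumes "m \<noteq> 0" shows "endo m n"
proof -
  have nat: "endo (int k + 1) 0 \<and> endo (int k + 2) 0" for k
  proof (induction k)
    case 0
    thus ?case using endo_1 endo_2 by simp
  next
    case (Suc k)
    have "endo ((int k + 2) + 1) (0 + 0)"
      by (rule endo_step) (use Suc endo_1 in \<open>auto simp: algebra_simps\<close>)
    with Suc show ?case by (simp add: algebra_simps)
  qed
  have base: "endo m 0" if "m > 0" for m
    using nat[of "nat (m - 1)"] that by simp
  have pos: "endo (int k) 1 \<and> endo (int k + 1) 1" for k
  proof (induction k)
    case 0
    thus ?case using endo_al endo_1_plus_al by simp
  next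
    case (Suc k)
    have "endo ((int k + 1) + 1) (1 + 0)"
      by (rule endo_step) (use Suc endo_1 in \<open>auto simp: algebra_simps\<close>)
    with Suc show ?case by (simp add: algebra_simps)
  qed
  have neg: "endo (- int k) 1 \<and> endo (- int k - 1) 1" for k
  proof (induction k)
    case 0
    thus ?case using endo_al endo_ab endo_minus[of 1 "- 1"] by simp
  next
    case (Suc k)
    have H: "endo ((- int k - 1) + (- 1)) (1 + 0)"
      by (rule endo_step) (use Suc endo_1 endo_minus[of 1 0] in \<open>auto simp: algebra_simps\<close>)
    have e: "- int (Suc k) = - int k - 1" "- int k - 1 - 1 = (- int k - 1) + (- 1)" by simp_all
    show ?case unfolding e using Suc H by (simp only: add_0_right simp_thms)
  qed
  have 1: "endo m 1" for m
    using pos[of "nat m"] neg[of "nat (- m)"] by (cases "m \<ge> 0") auto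
  have step: "endo m (int k) \<and> endo m (int k + 1)" if "m \<noteq> 0" for m k
  proof (induction k)
    case 0
    have "endo m 0" using base[of m] base[of "- m"] endo_minus[of m 0] that by (cases "m > 0") auto
    thus ?case using 1 by simp
  next
    case (Suc k)
    have "endo (m + 0) ((int k + 1) + 1)"
      by (rule endo_step) (use Suc endo_al that in \<open>auto simp: algebra_simps\<close>)
    with Suc show ?case by (simp add: algebra_simps)
  qed
  show ?thesis
  proof (cases "n \<ge> 0")
    case True
    thus ?thesis using step[OF assms, of "nat n"] by simp
  next
    case False
    thus ?thesis using step[of "- m" "nat (- n)"] assms endo_minus[of m n] by simp
  qed
qed

end

section \<open>Two-torsion and square classes\<close>

lemma eq_times_square:
  fixes a b w t :: "'a::field"
  assumes "a * b * w ^ 2 = t ^ 2" "b \<noteq> 0" "w \<noteq> 0"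
  shows "a = b * (t / (b * w)) ^ 2"
proof -
  have "b * (t / (b * w)) ^ 2 = b * t ^ 2 / (b * w) ^ 2" by (simp add: power_divide)
  also have "\<dots> = a" unfolding assms(1)[symmetric] using assms(2,3)
    by (simp add: power2_eq_square)
  finally show ?thesis by simp
qed

context cm_curve
begin

text \<open>The square class of X - e, for the 2-torsion abscissas e, describes how the endomorphism acts
  on the 2-torsion: an endomorphism congruent to 1 modulo 2 preserves the class of x - e, and one
  divisible by 2 sends it to the trivial class. The trivial class appears as g(x), a square on the
  curve.\<close>
definition odd_class :: "int \<Rightarrow> int \<Rightarrow> bool" where
  "odd_class m n \<longleftrightarrow> (\<exists>X. mult_by (of_int m + of_int n * al) X \<and>
     (\<forall>e\<in>{0, -1}. \<exists>l. X - e = (fX - e) * l ^ 2))"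

definition even_class :: "int \<Rightarrow> int \<Rightarrow> bool" where
  "even_class m n \<longleftrightarrow> (\<exists>X. mult_by (of_int m + of_int n * al) X \<and>
     (\<forall>e\<in>{0, -1}. \<exists>l. X - e = g fX * l ^ 2))"

lemma mult_by_not_const:
  assumes "mult_by \<beta> X" shows "X \<noteq> fconst c"
proof
  assume "X = fconst c"
  hence "lim_inf (X / fX) (c * 0)"
    unfolding divide_inverse by (simp only: lim_inf_mult lim_inf_const lim_inf_inverse_X)
  thus False using mult_byD(1,2)[OF assms] lim_inf_unique by fastforce
qed

lemma mult_by_neq_e: "mult_by \<beta> X \<Longrightarrow> e \<in> {0, -1} \<Longrightarrow> X \<noteq> e"
  using mult_by_not_const[of \<beta> X 0] mult_by_not_const[of \<beta> X "- 1"] by auto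

lemma g_e: "e \<in> {0, -1} \<Longrightarrow> g e = 0"
  by (auto simp: g_def)

lemma chord_square_class_int:
  assumes "mult_by (of_int m + of_int n * al) X" "mult_by (of_int k + of_int l * al) Y"
    and "\<not> (m = k \<and> n = l)" "\<not> (m = - k \<and> n = - l)" and "e \<in> {0, -1}"
  shows "\<exists>t. (chord (of_int m + of_int n * al) (of_int k + of_int l * al) X Y - e) * (X - e) * (Y - e)
     = g fX * t ^ 2"
  by (rule chord_square_class[OF assms(1,2) _ _ g_e[OF assms(5)]])
     (use assms(3,4) in \<open>simp_all only: of_int_al_eq_iff of_int_al_eq_minus_iff simp_thms\<close>)

lemma odd_class_minus: "odd_class (- m) (- n) \<longleftrightarrow> odd_class m n"
  using mult_by_minus[of "of_int m + of_int n * al"] by (simp add: odd_class_def algebra_simps)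

lemma odd_class_step:
  assumes "odd_class m n" "even_class k l"
    and ne: "\<not> (m = k \<and> n = l)" "\<not> (m = - k \<and> n = - l)"
  shows "odd_class (m + k) (n + l)"
proof -
  obtain X where X: "mult_by (of_int m + of_int n * al) X" "\<forall>e\<in>{0, -1}. \<exists>l. X - e = (fX - e) * l ^ 2"
    using assms(1) unfolding odd_class_def by blast
  obtain Y where Y: "mult_by (of_int k + of_int l * al) Y" "\<forall>e\<in>{0, -1}. \<exists>l. Y - e = g fX * l ^ 2"
    using assms(2) unfolding even_class_def by blast
  define Z where "Z = chord (of_int m + of_int n * al) (of_int k + of_int l * al) X Y"
  have Z: "mult_by (of_int (m + k) + of_int (n + l) * al) Z"
    unfolding Z_def by (rule mult_by_chord_int[OF X(1) Y(1) ne])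
  have "\<exists>w. Z - e = (fX - e) * w ^ 2" if e: "e \<in> {0, -1}" for e
  proof -
    obtain u where u: "X - e = (fX - e) * u ^ 2" using X e by blast
    obtain v where v: "Y - e = g fX * v ^ 2" using Y e by blast
    obtain t where t: "(Z - e) * (X - e) * (Y - e) = g fX * t ^ 2"
      using chord_square_class_int[OF X(1) Y(1) ne e] unfolding Z_def by blast
    have nz: "X - e \<noteq> 0" "Y - e \<noteq> 0" "fX - e \<noteq> 0"
      using mult_by_neq_e[OF X(1) e] mult_by_neq_e[OF Y(1) e] mult_by_neq_e[OF mult_by_1 e] by simp_all
    hence "u \<noteq> 0" "v \<noteq> 0" using u v by auto
    have "g fX * ((Z - e) * (fX - e) * (u * v) ^ 2) = g fX * t ^ 2"
      using t unfolding u v by (simp add: power2_eq_square mult_ac)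
    hence "(Z - e) * (fX - e) * (u * v) ^ 2 = t ^ 2" using g_fX_nonzero by simp
    hence "Z - e = (fX - e) * (t / ((fX - e) * (u * v))) ^ 2"
      by (rule eq_times_square) (use nz \<open>u \<noteq> 0\<close> \<open>v \<noteq> 0\<close> in auto)
    thus ?thesis by (rule exI)
  qed
  with Z have "mult_by (of_int (m + k) + of_int (n + l) * al) Z \<and>
     (\<forall>e\<in>{0, -1}. \<exists>w. Z - e = (fX - e) * w ^ 2)" by (intro conjI ballI) assumption
  thus ?thesis unfolding odd_class_def by (rule exI)
qed

text \<open>The double of a point is its sum with an auxiliary point plus its difference from it. In the
  product of the three square-class relations every class except that of the double occurs twice and
  cancels.\<close>
lemma even_class_sum_diff:
  assumes "mult_by (of_int a + of_int b * al) X" "mult_by (of_int c + of_int d * al) Y"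
    and ne: "\<not> (a = c \<and> b = d)" "\<not> (a = - c \<and> b = - d)"
    and ne2: "\<not> (c = 0 \<and> d = 0)" "\<not> (a = 0 \<and> b = 0)"
  shows "even_class (2 * a) (2 * b)"
proof -
  have Y': "mult_by (of_int (- c) + of_int (- d) * al) Y"
    using assms(2) mult_by_minus[of "of_int c + of_int d * al"] by simp
  have neQ: "\<not> (a = - c \<and> b = - d)" "\<not> (a = - (- c) \<and> b = - (- d))"
    using ne by auto
  have neZ: "\<not> (a + c = a + - c \<and> b + d = b + - d)"
    "\<not> (a + c = - (a + - c) \<and> b + d = - (b + - d))"
    using ne2 by auto
  define P Q where "P = chord (of_int a + of_int b * al) (of_int c + of_int d * al) X Y"
    and "Q = chord (of_int a + of_int b * al) (of_int (- c) + of_int (- d) * al) X Y"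
  have P: "mult_by (of_int (a + c) + of_int (b + d) * al) P"
    unfolding P_def by (rule mult_by_chord_int[OF assms(1,2) ne])
  have Q: "mult_by (of_int (a + - c) + of_int (b + - d) * al) Q"
    unfolding Q_def by (rule mult_by_chord_int[OF assms(1) Y' neQ])
  define Z where "Z = chord (of_int (a + c) + of_int (b + d) * al) (of_int (a + - c) + of_int (b + - d) * al) P Q"
  have Z: "mult_by (of_int (a + c + (a + - c)) + of_int (b + d + (b + - d)) * al) Z"
    unfolding Z_def by (rule mult_by_chord_int[OF P Q neZ])
  have "\<exists>w. Z - e = g fX * w ^ 2" if e: "e \<in> {0, -1}" for e
  proof -
    obtain t where t: "(P - e) * (X - e) * (Y - e) = g fX * t ^ 2"
      using chord_square_class_int[OF assms(1,2) ne e] unfolding P_def by blast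
    obtain u where u: "(Q - e) * (X - e) * (Y - e) = g fX * u ^ 2"
      using chord_square_class_int[OF assms(1) Y' neQ e] unfolding Q_def by blast
    obtain v where v: "(Z - e) * (P - e) * (Q - e) = g fX * v ^ 2"
      using chord_square_class_int[OF P Q neZ e] unfolding Z_def by blast
    have nz: "X - e \<noteq> 0" "Y - e \<noteq> 0" "P - e \<noteq> 0" "Q - e \<noteq> 0"
      using mult_by_neq_e[OF assms(1) e] mult_by_neq_e[OF assms(2) e] mult_by_neq_e[OF P e]
        mult_by_neq_e[OF Q e] by simp_all
    hence tu: "t \<noteq> 0" "u \<noteq> 0" using t u by auto
    have "g fX * ((Z - e) * g fX * (t * u) ^ 2) =
        (Z - e) * ((P - e) * (X - e) * (Y - e)) * ((Q - e) * (X - e) * (Y - e))"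
      unfolding t u by (simp add: power2_eq_square mult_ac)
    also have "\<dots> = ((Z - e) * (P - e) * (Q - e)) * ((X - e) * (Y - e)) ^ 2" by (simp add: power2_eq_square mult_ac)
    also have "\<dots> = g fX * (v * ((X - e) * (Y - e))) ^ 2" unfolding v by (simp add: power2_eq_square mult_ac)
    finally have "(Z - e) * g fX * (t * u) ^ 2 = (v * ((X - e) * (Y - e))) ^ 2"
      using g_fX_nonzero by simp
    hence "Z - e = g fX * (v * ((X - e) * (Y - e)) / (g fX * (t * u))) ^ 2"
      by (rule eq_times_square) (use tu g_fX_nonzero in auto)
    thus ?thesis by (rule exI)
  qed
  with Z have "mult_by (of_int (a + c + (a + - c)) + of_int (b + d + (b + - d)) * al) Z \<and>
     (\<forall>e\<in>{0, -1}. \<exists>w. Z - e = g fX * w ^ 2)" by (intro conjI ballI) assumption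
  hence "even_class (a + c + (a + - c)) (b + d + (b + - d))"
    unfolding even_class_def by (rule exI)
  moreover have "a + c + (a + - c) = 2 * a" "b + d + (b + - d) = 2 * b" by simp_all
  ultimately show ?thesis by (simp only:)
qed

lemma mult_by_int_1: "mult_by (of_int 1 + of_int 0 * al) fX"
  using mult_by_1 by (simp only: of_int_1 of_int_0 mult_zero_left add_0_right)

lemma mult_by_int_al: "mult_by (of_int 0 + of_int 1 * al) X_al"
  using mult_by_al by (simp only: of_int_1 of_int_0 mult_1_left add_0_left)

lemma even_class_2: "even_class 2 0"
proof -
  have "even_class (2 * 1) (2 * 0)"
    by (rule even_class_sum_diff[OF mult_by_int_1 mult_by_int_al]) simp_all
  thus ?thesis by simp
qed

lemma even_class_2al: "even_class 0 2"
proof -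
  have "even_class (2 * 0) (2 * 1)"
    by (rule even_class_sum_diff[OF mult_by_int_al mult_by_int_1]) simp_all
  thus ?thesis by simp
qed

text \<open>Every m + n al with m odd and n even is reached from 1 or -1 by adding multiples of 2 and of
  2 al.\<close>
lemma odd_class_all:
  assumes "odd m" "even n" shows "odd_class m n"
proof -
  have nat: "odd_class (2 * int k + 1) 0" for k
  proof (induction k)
    case 0
    have "\<exists>l. fX - e = (fX - e) * l ^ 2" for e :: "'a poly fract" by (rule exI[of _ 1]) simp
    with mult_by_1 have "odd_class 1 0" unfolding odd_class_def by (intro exI[of _ fX]) simp
    thus ?case by simp
  next
    case (Suc k)
    have "odd_class ((2 * int k + 1) + 2) (0 + 0)"
      by (rule odd_class_step[OF Suc even_class_2]) presburger+
    thus ?case by (simp add: algebra_simps)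
  qed
  have base: "odd_class m 0" if "odd m" for m
  proof (cases "m > 0")
    case True
    from that obtain j where "m = 2 * j + 1" by (rule oddE)
    with True have "m = 2 * int (nat j) + 1" by simp
    thus ?thesis using nat[of "nat j"] by (simp only:)
  next
    case False
    from that obtain j where "m = 2 * j + 1" by (rule oddE)
    with False have "- m = 2 * int (nat (- j - 1)) + 1" by simp
    hence "odd_class (- m) 0" using nat[of "nat (- j - 1)"] by (simp only:)
    thus ?thesis using odd_class_minus[of m 0] by (simp only: minus_zero)
  qed
  have step: "odd_class m (2 * int k)" if "odd m" for m k
  proof (induction k)
    case 0
    thus ?case using base[OF that] by simp
  next
    case (Suc k)
    have "odd_class (m + 0) (2 * int k + 2)"
      by (rule odd_class_step[OF Suc even_class_2al]) (use that in presburger)+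
    thus ?case by (simp add: algebra_simps)
  qed
  show ?thesis
  proof (cases "n \<ge> 0")
    case True
    from assms(2) obtain j where j: "n = 2 * j" by (rule evenE)
    with True have "n = 2 * int (nat j)" by simp
    thus ?thesis using step[OF assms(1), of "nat j"] by (simp only:)
  next
    case False
    from assms(2) obtain j where j: "n = 2 * j" by (rule evenE)
    with False have n: "- n = 2 * int (nat (- j))" by simp
    have "odd (- m)" using assms by simp
    hence "odd_class (- m) (- n)" unfolding n by (rule step)
    thus ?thesis using odd_class_minus[of m n] by (simp only:)
  qed
qed

end

section \<open>Multiplication polynomials\<close>

context legendre_curve
begin

definition fpoly :: "'a poly" where "fpoly = [:0, 1:] * [:1, 1:] * [:lam, 1:]"

lemma g_fX_eq: "g fX = to_fract fpoly"
proof -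
  have "fX = (to_fract [:0, 1:] :: 'a poly fract)" "fX + 1 = to_fract [:1, 1:]" "fX + fconst lam = to_fract [:lam, 1:]"
    by (simp_all add: fX_def to_fract_def fconst_def One_fract_def one_pCons eq_fract)
  note e = this
  show ?thesis unfolding g_def fpoly_def to_fract_mult by (simp only: e[symmetric])
qed

lemma mult_by_ode_poly:
  assumes X: "mult_by \<beta> (Fract N D)" and D: "D \<noteq> 0"
  shows "(pderiv N * D - N * pderiv D) ^ 2 * fpoly =
    smult (\<beta> ^ 2) (D * N * (N + D) * (N + smult lam D))"
proof -
  define \<tau> where "\<tau> = (to_fract :: 'a poly \<Rightarrow> _)"
  have D0: "\<tau> D \<noteq> 0" using D by (simp add: \<tau>_def)
  define W where "W = pderiv N * D - N * pderiv D"
  have dX: "fderiv (Fract N D) * \<tau> D ^ 2 = \<tau> W"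
  proof -
    have "fderiv (Fract N D) = \<tau> W / \<tau> (D ^ 2)"
      by (subst fderiv_Fract[OF D]) (simp only: Fract_conv_to_fract \<tau>_def W_def)
    thus ?thesis using D0 by (simp add: \<tau>_def power2_eq_square)
  qed
  define x where "x = Fract N D"
  have x: "x * \<tau> D = \<tau> N" using D0 by (simp add: x_def Fract_conv_to_fract \<tau>_def)
  have smult: "\<tau> (smult k p) = fconst k * \<tau> p" for k p
    by (simp add: \<tau>_def fconst_def to_fract_def)
  have "\<tau> (W ^ 2 * fpoly) = (fderiv x * \<tau> D ^ 2) ^ 2 * g fX"
    unfolding x_def dX g_fX_eq by (simp add: \<tau>_def power2_eq_square)
  also have "\<dots> = \<tau> D ^ 4 * (g fX * fderiv x ^ 2)" by Groebner_Basis.algebra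
  also have "\<dots> = \<tau> D ^ 4 * (fconst (\<beta> ^ 2) * g x)"
    using X by (simp add: mult_by_def x_def)
  also have "\<dots> = fconst (\<beta> ^ 2) * (\<tau> D * (x * \<tau> D) * (x * \<tau> D + \<tau> D) * (x * \<tau> D + fconst lam * \<tau> D))"
    unfolding g_def by Groebner_Basis.algebra
  also have "\<dots> = fconst (\<beta> ^ 2) * \<tau> (D * N * (N + D) * (N + smult lam D))"
    unfolding x by (simp add: \<tau>_def smult[unfolded \<tau>_def])
  also have "\<dots> = \<tau> (smult (\<beta> ^ 2) (D * N * (N + D) * (N + smult lam D)))"
    by (simp only: smult)
  finally show ?thesis unfolding \<tau>_def to_fract_eq_iff W_def .
qed

lemma square_class_poly:
  fixes N D :: "'a poly"
  assumes eq: "Fract N D - fconst e = (fX - fconst e) * l ^ 2" and D: "D \<noteq> 0"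
    and ne: "Fract N D \<noteq> fconst e"
  shows "\<exists>A B. A \<noteq> 0 \<and> B \<noteq> 0 \<and> [:- e, 1:] * A ^ 2 * D = B ^ 2 * (N - smult e D)"
proof -
  have l0: "l \<noteq> 0" using eq ne by auto
  then obtain A B where AB: "l = Fract A B" "B \<noteq> 0" "A \<noteq> 0"
    by (cases l rule: Fract_cases_nonzero) auto
  define \<tau> where "\<tau> = (to_fract :: 'a poly \<Rightarrow> _)"
  have nz: "\<tau> D \<noteq> 0" "\<tau> B \<noteq> 0" using D AB by (simp_all add: \<tau>_def)
  define x where "x = Fract N D"
  have x: "x * \<tau> D = \<tau> N" using nz by (simp add: x_def Fract_conv_to_fract \<tau>_def)
  have l: "l * \<tau> B = \<tau> A" using nz AB by (simp add: Fract_conv_to_fract \<tau>_def)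
  have smult: "\<tau> (smult k p) = fconst k * \<tau> p" for k p
    by (simp add: \<tau>_def fconst_def to_fract_def)
  have xe: "\<tau> [:- e, 1:] = fX - fconst e"
    by (simp add: \<tau>_def fX_def to_fract_def fconst_def)
  have "\<tau> ([:- e, 1:] * A ^ 2 * D) = (fX - fconst e) * (\<tau> A) ^ 2 * \<tau> D"
    unfolding xe[symmetric] by (simp add: \<tau>_def power2_eq_square del: mult_pCons_left)
  also have "\<dots> = ((fX - fconst e) * l ^ 2) * \<tau> B ^ 2 * \<tau> D" unfolding l[symmetric] by Groebner_Basis.algebra
  also have "\<dots> = (\<tau> N - fconst e * \<tau> D) * \<tau> B ^ 2"
    unfolding eq[symmetric] x[symmetric] x_def[symmetric] by Groebner_Basis.algebra
  also have "\<dots> = \<tau> (B ^ 2 * (N - smult e D))"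
    unfolding smult[symmetric] by (simp add: \<tau>_def power2_eq_square)
  finally have "[:- e, 1:] * A ^ 2 * D = B ^ 2 * (N - smult e D)"
    unfolding \<tau>_def to_fract_eq_iff .
  with AB show ?thesis by blast
qed

end

context cm_curve
begin

text \<open>For an odd endomorphism the numerator N and the denominator D of its action satisfy the
  cleared differential equation, have the norm as degree, and keep the square classes of x and x + 1.
  These facts are all that the reduction modulo a prime uses.\<close>
theorem multiplication_polynomials:
  assumes "odd m" "even n"
  obtains N D A0 B0 A1 B1 where
    "D \<noteq> 0" "degree N = Suc (degree D)" "int (degree N) = m ^ 2 + m * n + 2 * n ^ 2"
    "(pderiv N * D - N * pderiv D) ^ 2 * fpoly =
       smult ((of_int m + of_int n * al) ^ 2) (D * N * (N + D) * (N + smult (3 * al - 1) D))"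
    "A0 \<noteq> 0" "B0 \<noteq> 0" "[:0, 1:] * A0 ^ 2 * D = B0 ^ 2 * N"
    "A1 \<noteq> 0" "B1 \<noteq> 0" "[:1, 1:] * A1 ^ 2 * D = B1 ^ 2 * (N + D)"
proof -
  define \<beta> where "\<beta> = of_int m + of_int n * al"
  obtain X where X: "mult_by \<beta> X" and cls: "\<forall>e\<in>{0, -1}. \<exists>l. X - e = (fX - e) * l ^ 2"
    using odd_class_all[OF assms] unfolding odd_class_def \<beta>_def by blast
  have "m \<noteq> 0" using assms(1) by auto
  then obtain X' where X': "mult_by \<beta> X'" "int (rdeg X') = m ^ 2 + m * n + 2 * n ^ 2"
    using endo_all unfolding endo_def \<beta>_def by blast
  have "X' = X" by (rule mult_by_unique[OF X'(1) X])
  obtain N D where ND: "X = Fract N D" "D \<noteq> 0" "coprime N D" "rdeg X = degree N"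
    by (rule fract_coprime_rep)
  have X1: "mult_by \<beta> (Fract N D)" using X ND by simp
  obtain l where l: "X - 0 = (fX - 0) * l ^ 2" using cls by blast
  obtain k where k: "X - (-1) = (fX - (-1)) * k ^ 2" using cls by blast
  have l': "Fract N D - fconst 0 = (fX - fconst 0) * l ^ 2" using l ND by simp
  have k': "Fract N D - fconst (- 1) = (fX - fconst (- 1)) * k ^ 2" using k unfolding ND(1) by simp
  obtain A0 B0 where 0: "A0 \<noteq> 0" "B0 \<noteq> 0" "[:- 0, 1:] * A0 ^ 2 * D = B0 ^ 2 * (N - smult 0 D)"
    using square_class_poly[OF l' ND(2) mult_by_not_const[OF X1]] by blast
  obtain A1 B1 where 1: "A1 \<noteq> 0" "B1 \<noteq> 0" "[:- (-1), 1:] * A1 ^ 2 * D = B1 ^ 2 * (N - smult (-1) D)"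
    using square_class_poly[OF k' ND(2) mult_by_not_const[OF X1]] by blast
  show ?thesis
  proof (rule that[of D N A0 B0 A1 B1])
    show "degree N = Suc (degree D)" by (rule mult_by_degree(1)[OF X1 ND(2)])
    show "int (degree N) = m ^ 2 + m * n + 2 * n ^ 2"
      using X'(2) ND(4) \<open>X' = X\<close> by simp
    show "(pderiv N * D - N * pderiv D) ^ 2 * fpoly =
       smult ((of_int m + of_int n * al) ^ 2) (D * N * (N + D) * (N + smult (3 * al - 1) D))"
      using mult_by_ode_poly[OF X1 ND(2)] unfolding \<beta>_def .
    show "[:0, 1:] * A0 ^ 2 * D = B0 ^ 2 * N"
      using 0(3) by (simp only: minus_zero smult_0_left diff_0_right)
    show "[:1, 1:] * A1 ^ 2 * D = B1 ^ 2 * (N + D)"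
      using 1(3) by (simp only: minus_minus smult_minus_left smult_1_left diff_minus_eq_add)
  qed (use ND 0 1 in auto)
qed

end

section \<open>Polynomials modulo a prime of a discrete valuation ring\<close>

locale coefficient_ring =
  fixes V :: "'a::field_char_0 set"
  assumes V_1: "1 \<in> V" and V_add: "a \<in> V \<Longrightarrow> b \<in> V \<Longrightarrow> a + b \<in> V"
    and V_mult: "a \<in> V \<Longrightarrow> b \<in> V \<Longrightarrow> a * b \<in> V" and V_minus: "a \<in> V \<Longrightarrow> - a \<in> V"
begin

lemma V_0: "0 \<in> V" using V_add[OF V_1 V_minus[OF V_1]] by simp
lemma V_diff: "a \<in> V \<Longrightarrow> b \<in> V \<Longrightarrow> a - b \<in> V" using V_add[of a "- b"] V_minus by simp
lemma V_power: "a \<in> V \<Longrightarrow> a ^ n \<in> V" by (induction n) (auto intro: V_1 V_mult)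
lemma V_sum: "(\<And>i. i \<in> A \<Longrightarrow> f i \<in> V) \<Longrightarrow> sum f A \<in> V"
  by (induction A rule: infinite_finite_induct) (auto intro: V_0 V_add)
lemma V_of_nat: "of_nat n \<in> V" by (induction n) (auto intro: V_0 V_1 V_add)
lemma V_of_int: "of_int n \<in> V" by (cases n rule: int_cases2) (auto intro: V_of_nat V_minus)
lemma V_numeral: "numeral n \<in> V" using V_of_nat[of "numeral n"] by simp

definition PV :: "'a poly set" where "PV = {F. \<forall>i. coeff F i \<in> V}"

lemma PV_0: "0 \<in> PV" by (simp add: PV_def V_0)
lemma PV_add: "F \<in> PV \<Longrightarrow> G \<in> PV \<Longrightarrow> F + G \<in> PV" by (simp add: PV_def V_add)
lemma PV_diff: "F \<in> PV \<Longrightarrow> G \<in> PV \<Longrightarrow> F - G \<in> PV" by (simp add: PV_def V_diff)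
lemma PV_smult: "c \<in> V \<Longrightarrow> F \<in> PV \<Longrightarrow> smult c F \<in> PV" by (simp add: PV_def V_mult)
lemma PV_mult: "F \<in> PV \<Longrightarrow> G \<in> PV \<Longrightarrow> F * G \<in> PV"
  by (auto simp: PV_def coeff_mult intro!: V_sum V_mult)
lemma PV_pCons: "c \<in> V \<Longrightarrow> F \<in> PV \<Longrightarrow> pCons c F \<in> PV"
  by (auto simp: PV_def coeff_pCons split: nat.splits)
lemma PV_1: "1 \<in> PV" by (simp add: one_pCons PV_pCons V_1 PV_0)
lemma PV_power: "F \<in> PV \<Longrightarrow> F ^ n \<in> PV" by (induction n) (auto intro: PV_1 PV_mult)
lemma PV_of_nat: "of_nat n \<in> PV" by (induction n) (auto intro: PV_0 PV_1 PV_add)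
lemma PV_sum: "(\<And>i. i \<in> A \<Longrightarrow> f i \<in> PV) \<Longrightarrow> sum f A \<in> PV"
  by (auto simp: PV_def coeff_sum intro: V_sum)
lemma PV_pderiv: "F \<in> PV \<Longrightarrow> pderiv F \<in> PV"
  by (auto simp: PV_def coeff_pderiv simp flip: of_nat_Suc intro!: V_mult V_of_nat)
lemma PV_monom: "c \<in> V \<Longrightarrow> monom c n \<in> PV" by (auto simp: PV_def V_0)

end

text \<open>V is a discrete valuation ring with uniformizer pi, given inside its field of fractions. The
  Frobenius condition says that the residue field has p elements, and p is a product of pi and its
  conjugate pi'.\<close>
locale residue_ring_p = coefficient_ring V for V :: "'a::field_char_0 set" +
  fixes pi pi' :: 'a and p :: nat
  assumes pi_V: "pi \<in> V" and pi'_V: "pi' \<in> V" and p_eq: "of_nat p = pi * pi'"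
    and pi_not_unit: "inverse pi \<notin> V"
    and valuation: "a \<noteq> 0 \<Longrightarrow> \<exists>i j u. u \<in> V \<and> inverse u \<in> V \<and> a * pi ^ i = u * pi ^ j"
    and frobenius: "a \<in> V \<Longrightarrow> \<exists>b\<in>V. a ^ p - a = pi * b"
    and prime_p: "prime p" and odd_p: "odd p"
begin

definition M :: "'a set" where "M = {a. \<exists>b\<in>V. a = pi * b}"

lemma p_pos: "p > 0" using prime_p prime_gt_0_nat by blast

lemma pi_nonzero: "pi \<noteq> 0"
  using p_eq p_pos by auto

lemma M_subset_V: "a \<in> M \<Longrightarrow> a \<in> V" by (auto simp: M_def intro: V_mult pi_V)

lemma M_0: "0 \<in> M" using V_0 by (force simp: M_def)

lemma M_add: "a \<in> M \<Longrightarrow> b \<in> M \<Longrightarrow> a + b \<in> M"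
  by (auto simp: M_def intro: V_add simp flip: distrib_left)

lemma M_mult: "a \<in> M \<Longrightarrow> b \<in> V \<Longrightarrow> a * b \<in> M"
  by (auto simp: M_def mult.assoc intro: V_mult)

lemma M_mult': "b \<in> V \<Longrightarrow> a \<in> M \<Longrightarrow> b * a \<in> M"
  using M_mult[of a b] by (simp add: mult.commute)

lemma M_minus: "a \<in> M \<Longrightarrow> - a \<in> M" using M_mult[of a "- 1"] V_minus[OF V_1] by simp

lemma M_diff: "a \<in> M \<Longrightarrow> b \<in> M \<Longrightarrow> a - b \<in> M" using M_add[of a "- b"] M_minus by simp

lemma M_sum: "(\<And>i. i \<in> I \<Longrightarrow> f i \<in> M) \<Longrightarrow> sum f I \<in> M"
  by (induction I rule: infinite_finite_induct) (auto intro: M_0 M_add)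

lemma one_notin_M: "1 \<notin> M"
  using pi_not_unit pi_nonzero by (auto simp: M_def field_simps dest: sym)
     (metis divide_inverse mult_1 nonzero_eq_divide_eq mult.commute)

lemma p_in_M: "of_nat p \<in> M" using p_eq pi'_V by (auto simp: M_def)

lemma V_cases: assumes "a \<notin> V" shows "inverse a \<in> M"
proof -
  have "a \<noteq> 0" using assms V_0 by auto
  then obtain i j u where u: "u \<in> V" "inverse u \<in> V" and eq: "a * pi ^ i = u * pi ^ j"
    using valuation by blast
  have u0: "u \<noteq> 0" using eq \<open>a \<noteq> 0\<close> pi_nonzero by auto
  have "\<not> i \<le> j"
  proof
    assume "i \<le> j"
    hence "a * pi ^ i = (u * pi ^ (j - i)) * pi ^ i"
      using eq by (simp add: mult.assoc flip: power_add)
    hence "a = u * pi ^ (j - i)" using pi_nonzero by simp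
    thus False using assms u by (auto intro: V_mult V_power pi_V)
  qed
  then obtain t where t: "i = j + Suc t" using less_imp_Suc_add[of j i] by auto
  have "(a * pi ^ Suc t) * pi ^ j = u * pi ^ j" using eq t by (simp add: power_add mult_ac)
  hence "a * pi ^ Suc t = u" using pi_nonzero by simp
  hence "inverse a = pi * (pi ^ t * inverse u)"
    using \<open>a \<noteq> 0\<close> u0 pi_nonzero by (simp add: field_simps)
  thus ?thesis using u by (auto simp: M_def intro!: bexI[of _ "pi ^ t * inverse u"] V_mult V_power pi_V)
qed

lemma unit_inverse: assumes "a \<notin> M" shows "inverse a \<in> V"
proof -
  have a0: "a \<noteq> 0" using assms M_0 by auto
  show ?thesis
  proof (rule ccontr)
    assume "inverse a \<notin> V"
    hence "inverse (inverse a) \<in> M" by (rule V_cases)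
    thus False using assms by simp
  qed
qed

lemma unit_divide: "a \<in> V \<Longrightarrow> b \<notin> M \<Longrightarrow> a / b \<in> V"
  using unit_inverse V_mult by (simp add: divide_inverse)

lemma M_prime: assumes "a \<in> V" "b \<in> V" "a * b \<in> M" shows "a \<in> M \<or> b \<in> M"
proof (rule ccontr)
  assume *: "\<not> ?thesis"
  hence "inverse a * (a * b) \<in> M" using assms unit_inverse by (blast intro: M_mult')
  moreover have "a \<noteq> 0" using * M_0 by auto
  ultimately show False using * by (simp add: field_simps)
qed

lemma M_power: assumes "a \<in> V" "a ^ n \<in> M" shows "a \<in> M"
  using assms(2) by (induction n) (use one_notin_M M_prime V_power assms(1) in auto)

lemma of_int_in_M_iff: "of_int z \<in> M \<longleftrightarrow> int p dvd z"
proof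
  assume "int p dvd z"
  then obtain k where "z = int p * k" by (elim dvdE)
  hence "of_int z = of_nat p * (of_int k :: 'a)" by simp
  thus "of_int z \<in> M" using M_mult[OF p_in_M V_of_int] by simp
next
  assume z: "of_int z \<in> M"
  show "int p dvd z"
  proof (rule ccontr)
    assume "\<not> int p dvd z"
    hence "coprime (int p) z" using prime_p by (simp add: prime_imp_coprime)
    then obtain u v where "u * int p + v * z = 1" by (metis bezout_int coprime_iff_gcd_eq_1)
    hence "(of_int (u * int p + v * z) :: 'a) = 1" by simp
    hence "of_int u * of_nat p + of_int v * of_int z = (1 :: 'a)" by simp
    moreover have "of_int u * of_nat p + of_int v * of_int z \<in> M"
      by (intro M_add M_mult' V_of_int p_in_M z)
    ultimately show False using one_notin_M by simp
  qed
qed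

lemma of_nat_in_M_iff: "of_nat n \<in> M \<longleftrightarrow> p dvd n"
  using of_int_in_M_iff[of "int n"] by (simp add: int_dvd_int_iff)

definition PM :: "'a poly set" where "PM = {F. \<forall>i. coeff F i \<in> M}"

lemma PM_0: "0 \<in> PM" by (simp add: PM_def M_0)
lemma PM_add: "F \<in> PM \<Longrightarrow> G \<in> PM \<Longrightarrow> F + G \<in> PM" by (simp add: PM_def M_add)
lemma PM_diff: "F \<in> PM \<Longrightarrow> G \<in> PM \<Longrightarrow> F - G \<in> PM" by (simp add: PM_def M_diff)
lemma PM_smult: "c \<in> V \<Longrightarrow> F \<in> PM \<Longrightarrow> smult c F \<in> PM" by (simp add: PM_def M_mult')
lemma PM_smult': "c \<in> M \<Longrightarrow> F \<in> PV \<Longrightarrow> smult c F \<in> PM" by (simp add: PM_def PV_def M_mult)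
lemma PM_mult: "F \<in> PM \<Longrightarrow> G \<in> PV \<Longrightarrow> F * G \<in> PM"
  by (auto simp: PV_def PM_def coeff_mult intro!: M_sum M_mult)
lemma PM_mult': "F \<in> PV \<Longrightarrow> G \<in> PM \<Longrightarrow> F * G \<in> PM"
  using PM_mult[of G F] by (simp add: mult.commute)
lemma PM_E: assumes "F \<in> PM" obtains G where "G \<in> PV" "F = smult pi G"
proof
  show "F = smult pi (smult (inverse pi) F)" using pi_nonzero by simp
  show "smult (inverse pi) F \<in> PV"
    using assms pi_nonzero by (auto simp: PM_def PV_def M_def field_simps) 
      (metis (no_types, lifting) mult.commute nonzero_mult_div_cancel_left)
qed
lemma PM_smult_pi: "F \<in> PV \<Longrightarrow> smult pi F \<in> PM"
  by (rule PM_smult') (auto simp: M_def intro!: bexI[of _ 1] V_1)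

lemma PM_poly: "F \<in> PM \<Longrightarrow> x \<in> V \<Longrightarrow> poly F x \<in> M"
  by (auto simp: PM_def poly_altdef intro!: M_sum M_mult V_power)

text \<open>The lowest and the highest index of a coefficient that survives modulo pi. They add under
  multiplication because M is prime, and their parity detects whether a polynomial can be a square times
  another one.\<close>
definition is_lo :: "'a poly \<Rightarrow> nat \<Rightarrow> bool" where
  "is_lo F i \<longleftrightarrow> coeff F i \<notin> M \<and> (\<forall>j<i. coeff F j \<in> M)"
definition is_hi :: "'a poly \<Rightarrow> nat \<Rightarrow> bool" where
  "is_hi F i \<longleftrightarrow> coeff F i \<notin> M \<and> (\<forall>j>i. coeff F j \<in> M)"

lemma ex_lo: "F \<notin> PM \<Longrightarrow> \<exists>i. is_lo F i"
proof -
  assume "F \<notin> PM"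
  then obtain i where i: "coeff F i \<notin> M" by (auto simp: PM_def)
  thus ?thesis unfolding is_lo_def
    by (intro exI[of _ "LEAST i. coeff F i \<notin> M"]) (use LeastI[where P = "\<lambda>i. coeff F i \<notin> M", OF \<open>coeff F i \<notin> M\<close>] in \<open>auto dest: not_less_Least\<close>)
qed

lemma hi_le_degree: "is_hi F i \<Longrightarrow> i \<le> degree F"
  unfolding is_hi_def using M_0 by (metis le_degree)

lemma ex_hi: assumes "F \<notin> PM" shows "\<exists>i. is_hi F i"
proof -
  obtain i where i: "coeff F i \<notin> M" using assms by (auto simp: PM_def)
  have b: "\<forall>y. coeff F y \<notin> M \<longrightarrow> y \<le> degree F" using M_0 by (metis le_degree)
  have "coeff F (GREATEST i. coeff F i \<notin> M) \<notin> M" by (rule GreatestI_nat[where P = "\<lambda>i. coeff F i \<notin> M", OF i]) (use b in auto)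
  moreover have "coeff F j \<in> M" if "j > (GREATEST i. coeff F i \<notin> M)" for j
    using Greatest_le_nat[of "\<lambda>i. coeff F i \<notin> M" j "degree F"] b that by (metis leD)
  ultimately show ?thesis unfolding is_hi_def by blast
qed

lemma lo_unique: "is_lo F i \<Longrightarrow> is_lo F j \<Longrightarrow> i = j"
  unfolding is_lo_def by (metis linorder_neqE_nat)

lemma hi_unique: "is_hi F i \<Longrightarrow> is_hi F j \<Longrightarrow> i = j"
  unfolding is_hi_def by (metis linorder_neqE_nat)

lemma M_cong: assumes "a - b \<in> M" shows "a \<in> M \<longleftrightarrow> b \<in> M"
  using M_diff[OF _ assms, of a] M_add[OF _ assms, of b] by auto

lemma lo_cong: assumes "F - G \<in> PM" shows "is_lo F i \<longleftrightarrow> is_lo G i"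
proof -
  have "coeff F j \<in> M \<longleftrightarrow> coeff G j \<in> M" for j
    using assms by (intro M_cong) (auto simp: PM_def)
  thus ?thesis by (simp add: is_lo_def)
qed

lemma hi_cong: assumes "F - G \<in> PM" shows "is_hi F i \<longleftrightarrow> is_hi G i"
proof -
  have "coeff F j \<in> M \<longleftrightarrow> coeff G j \<in> M" for j
    using assms by (intro M_cong) (auto simp: PM_def)
  thus ?thesis by (simp add: is_hi_def)
qed

lemma is_lo_mult:
  assumes "F \<in> PV" "G \<in> PV" "is_lo F i" "is_lo G j" shows "is_lo (F * G) (i + j)"
proof -
  have M: "coeff F k * coeff G l \<in> M" if "k < i \<or> l < j" for k l
    using that assms by (auto simp: is_lo_def PV_def intro: M_mult M_mult')
  have "coeff (F * G) k \<in> M" if "k < i + j" for k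
    unfolding coeff_mult by (intro M_sum M) (use that in auto)
  moreover have "coeff (F * G) (i + j) \<notin> M"
  proof
    assume "coeff (F * G) (i + j) \<in> M"
    moreover have "coeff (F * G) (i + j) = coeff F i * coeff G j +
        (\<Sum>k\<in>{..i+j} - {i}. coeff F k * coeff G (i + j - k))"
      unfolding coeff_mult by (subst sum.remove[of _ i]) auto
    moreover have "(\<Sum>k\<in>{..i+j} - {i}. coeff F k * coeff G (i + j - k)) \<in> M"
      by (intro M_sum M) auto
    ultimately have "coeff F i * coeff G j \<in> M" using M_diff by fastforce
    thus False using assms M_prime by (auto simp: is_lo_def PV_def)
  qed
  ultimately show ?thesis by (simp add: is_lo_def)
qed

lemma is_hi_mult:
  assumes "F \<in> PV" "G \<in> PV" "is_hi F i" "is_hi G j" shows "is_hi (F * G) (i + j)"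
proof -
  have M: "coeff F k * coeff G l \<in> M" if "k > i \<or> l > j" for k l
    using that assms by (auto simp: is_hi_def PV_def intro: M_mult M_mult')
  have "coeff (F * G) k \<in> M" if "k > i + j" for k
    unfolding coeff_mult by (intro M_sum M) (use that in auto)
  moreover have "coeff (F * G) (i + j) \<notin> M"
  proof
    assume "coeff (F * G) (i + j) \<in> M"
    moreover have "coeff (F * G) (i + j) = coeff F i * coeff G j +
        (\<Sum>k\<in>{..i+j} - {i}. coeff F k * coeff G (i + j - k))"
      unfolding coeff_mult by (subst sum.remove[of _ i]) auto
    moreover have "(\<Sum>k\<in>{..i+j} - {i}. coeff F k * coeff G (i + j - k)) \<in> M"
      by (intro M_sum M) auto
    ultimately have "coeff F i * coeff G j \<in> M" using M_diff by fastforce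
    thus False using assms M_prime by (auto simp: is_hi_def PV_def)
  qed
  ultimately show ?thesis by (simp add: is_hi_def)
qed

lemma lo_notin_PM: "is_lo F i \<Longrightarrow> F \<notin> PM" by (auto simp: is_lo_def PM_def)

lemma PM_prime: "F \<in> PV \<Longrightarrow> G \<in> PV \<Longrightarrow> F * G \<in> PM \<Longrightarrow> F \<in> PM \<or> G \<in> PM"
  using is_lo_mult ex_lo lo_notin_PM by meson

lemma is_lo_smult: "c \<in> V \<Longrightarrow> c \<notin> M \<Longrightarrow> F \<in> PV \<Longrightarrow> is_lo (smult c F) i \<longleftrightarrow> is_lo F i"
  using M_prime[of c] M_mult'[of c] by (auto simp: is_lo_def PV_def)

lemma is_hi_smult: "c \<in> V \<Longrightarrow> c \<notin> M \<Longrightarrow> F \<in> PV \<Longrightarrow> is_hi (smult c F) i \<longleftrightarrow> is_hi F i"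
  using M_prime[of c] M_mult'[of c] by (auto simp: is_hi_def PV_def)

lemma smult_primitive_unit:
  assumes "smult c F = G" "F \<in> PV" "F \<notin> PM" "G \<in> PV" "G \<notin> PM"
  shows "c \<in> V" "c \<notin> M"
proof -
  obtain i where i: "coeff F i \<notin> M" using assms by (auto simp: PM_def)
  have "c * coeff F i = coeff G i" using assms(1) by auto
  moreover have "coeff F i \<noteq> 0" using i M_0 by auto
  ultimately have "c = coeff G i / coeff F i" by (simp add: field_simps)
  thus "c \<in> V" using unit_divide[OF _ i] assms(4) by (auto simp: PV_def)
  show "c \<notin> M" using PM_smult'[of c F] assms by auto
qed

text \<open>Clear denominators by a power of pi and divide by the largest power of pi that all elements
  have in common; it exists because the nonzero element a0 has finite valuation.\<close>
lemma ex_primitive_scale: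
  assumes A: "finite A" and a0: "a0 \<in> A" "a0 \<noteq> 0"
  shows "\<exists>c. c \<noteq> 0 \<and> (\<forall>a\<in>A. c * a \<in> V) \<and> \<not> (\<forall>a\<in>A. c * a \<in> M)"
proof -
  have "\<exists>k. \<forall>a\<in>A. pi ^ k * a \<in> V" using A
  proof (induction A rule: finite_induct)
    case (insert x A)
    then obtain k where k: "\<forall>a\<in>A. pi ^ k * a \<in> V" by blast
    have "\<exists>l. pi ^ l * x \<in> V"
    proof (cases "x = 0")
      case False
      then obtain i j u where "u \<in> V" "x * pi ^ i = u * pi ^ j" using valuation by blast
      thus ?thesis by (intro exI[of _ i]) (auto simp: mult.commute intro: V_mult V_power pi_V)
    qed (auto simp: V_0)
    then obtain l where l: "pi ^ l * x \<in> V" by blast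
    have "pi ^ (k + l) * a \<in> V" if "a \<in> insert x A" for a
    proof -
      have "pi ^ (k + l) * a = pi ^ l * (pi ^ k * a)" "pi ^ (k + l) * a = pi ^ k * (pi ^ l * a)"
        by (simp_all add: power_add mult_ac)
      thus ?thesis using that k l by (metis V_mult V_power insertE pi_V)
    qed
    thus ?case by blast
  qed auto
  then obtain k where k: "\<forall>a\<in>A. pi ^ k * a \<in> V" by blast
  define P where "P t \<longleftrightarrow> (\<forall>a\<in>A. \<exists>b\<in>V. pi ^ k * a = pi ^ t * b)" for t
  obtain i j u where u: "u \<in> V" "inverse u \<in> V" and eq: "a0 * pi ^ i = u * pi ^ j"
    using valuation a0 by blast
  have u0: "u \<noteq> 0" using eq a0 pi_nonzero by auto
  have bound: "t \<le> k + j" if "P t" for t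
  proof (rule ccontr)
    assume "\<not> t \<le> k + j"
    then obtain r where r: "t = k + j + Suc r" using less_imp_Suc_add[of "k + j" t] by auto
    obtain b where b: "b \<in> V" "pi ^ k * a0 = pi ^ t * b" using \<open>P t\<close> a0 by (auto simp: P_def)
    have "pi ^ k * (u * pi ^ j) = pi ^ t * b * pi ^ i" using b eq by (metis mult.assoc)
    hence "pi ^ (k + j) * u = pi ^ (k + j) * (pi * (pi ^ r * b * pi ^ i))"
      unfolding r by (simp add: power_add mult_ac)
    hence "u = pi * (pi ^ r * b * pi ^ i)" using pi_nonzero by simp
    moreover have "pi ^ r * b * pi ^ i \<in> V" using b by (intro V_mult V_power pi_V)
    ultimately have "u \<in> M" unfolding M_def by blast
    hence "u * inverse u \<in> M" using u by (intro M_mult)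
    thus False using one_notin_M u0 by simp
  qed
  have "P 0" using k by (auto simp: P_def)
  define t where "t = (GREATEST t. P t)"
  have Pt: "P t" unfolding t_def using \<open>P 0\<close> bound by (rule GreatestI_nat)
  have nPt: "\<not> P (Suc t)"
  proof
    assume "P (Suc t)"
    hence "Suc t \<le> t" unfolding t_def using bound by (rule Greatest_le_nat)
    thus False by simp
  qed
  define c where "c = pi ^ k / pi ^ t"
  have c: "pi ^ t * (c * a) = pi ^ k * a" for a using pi_nonzero by (simp add: c_def)
  show ?thesis
  proof (intro exI[of _ c] conjI ballI)
    show "c \<noteq> 0" using pi_nonzero by (simp add: c_def)
  next
    fix a assume "a \<in> A"
    then obtain b where "b \<in> V" "pi ^ k * a = pi ^ t * b" using Pt by (auto simp: P_def)
    with c[of a] show "c * a \<in> V" using pi_nonzero by simp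
  next
    show "\<not> (\<forall>a\<in>A. c * a \<in> M)"
    proof
    assume *: "\<forall>a\<in>A. c * a \<in> M"
    have "P (Suc t)" unfolding P_def
    proof
      fix a assume "a \<in> A"
      then obtain b where "b \<in> V" "c * a = pi * b" using * by (auto simp: M_def)
      hence "pi ^ k * a = pi ^ Suc t * b" using c[of a] by (simp add: mult_ac)
      thus "\<exists>b\<in>V. pi ^ k * a = pi ^ Suc t * b" using \<open>b \<in> V\<close> by blast
    qed
    with nPt show False ..
    qed
  qed
qed

lemma ex_primitive_pair:
  assumes "D \<noteq> 0"
  shows "\<exists>c. c \<noteq> 0 \<and> smult c N \<in> PV \<and> smult c D \<in> PV \<and> \<not> (smult c N \<in> PM \<and> smult c D \<in> PM)"
proof -
  let ?A = "coeff N ` {..degree N} \<union> coeff D ` {..degree D}"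
  have "\<exists>c. c \<noteq> 0 \<and> (\<forall>a\<in>?A. c * a \<in> V) \<and> \<not> (\<forall>a\<in>?A. c * a \<in> M)"
    by (rule ex_primitive_scale[of _ "lead_coeff D"]) (use assms in auto)
  then obtain c where c: "c \<noteq> 0" "\<forall>a\<in>?A. c * a \<in> V" "\<not> (\<forall>a\<in>?A. c * a \<in> M)" by blast
  have "c * coeff F i \<in> V" if "F = N \<or> F = D" for F i
    using c(2) that V_0 by (cases "i \<le> degree F") (auto simp: coeff_eq_0)
  with c show ?thesis
    by (intro exI[of _ c]) (auto simp: PV_def PM_def)
qed

lemma ex_primitive:
  assumes "D \<noteq> 0"
  shows "\<exists>c. c \<noteq> 0 \<and> smult c D \<in> PV \<and> smult c D \<notin> PM"
  using ex_primitive_pair[OF assms, of D] by blast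

end

section \<open>The reduction of multiplication by a prime\<close>

context residue_ring_p
begin

lemma freshman:
  assumes "a \<in> V"
  shows "[:a, 1:] ^ p - (monom 1 p + [:a:]) \<in> PM"
  unfolding PM_def
proof (intro CollectI allI)
  fix i
  have c: "coeff ([:a, 1:] ^ p) i = of_nat (p choose i) * a ^ (p - i)"
    by (cases "i \<le> p") (simp_all add: coeff_linear_poly_power coeff_eq_0 degree_linear_power)
  consider "i = 0" | "i = p" | "0 < i" "i < p" | "i > p" by linarith
  thus "coeff ([:a, 1:] ^ p - (monom 1 p + [:a:])) i \<in> M"
  proof cases
    case 1
    obtain b where "b \<in> V" "a ^ p - a = pi * b" using frobenius[OF assms] by blast
    hence "a ^ p - a \<in> M" by (auto simp: M_def)
    thus ?thesis using 1 c p_pos by simp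
  next
    case 2
    thus ?thesis using c p_pos M_0 by (simp add: coeff_pCons split: nat.splits)
  next
    case 3
    hence "p dvd (p choose i)" using prime_p by (intro dvd_choose_prime) auto
    hence "of_nat (p choose i) \<in> M" by (simp only: of_nat_in_M_iff)
    hence "of_nat (p choose i) * a ^ (p - i) \<in> M" using assms by (intro M_mult V_power)
    moreover have "coeff (monom 1 p + [:a:]) i = 0" using 3 by (simp add: coeff_pCons split: nat.splits)
    ultimately show ?thesis using c by simp
  next
    case 4
    thus ?thesis using c M_0 by (simp add: coeff_pCons binomial_eq_0 split: nat.splits)
  qed
qed

text \<open>If N/D has derivative 0 modulo pi, the leading terms of x N' D and N x D' cancel, and this
  leaves the factor n - m.\<close>
lemma wronskian_hi:
  assumes "N \<in> PV" "D \<in> PV" "is_hi N n" "is_hi D m" "pderiv N * D - N * pderiv D \<in> PM"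
  shows "int p dvd int n - int m"
proof (cases "n + m = 0")
  case False
  define T where "T F = pCons 0 (pderiv F)" for F :: "'a poly"
  have cT: "coeff (T F) i = of_nat i * coeff F i" for F i
    by (cases i) (auto simp: T_def coeff_pderiv)
  have TV: "T F \<in> PV" if "F \<in> PV" for F
    unfolding T_def using that by (intro PV_pCons V_0 PV_pderiv)
  have "pCons 0 (pderiv N * D - N * pderiv D) \<in> PM"
    using assms(5) by (auto simp: PM_def coeff_pCons M_0 split: nat.splits)
  also have "pCons 0 (pderiv N * D - N * pderiv D) = T N * D - N * T D"
    by (simp add: T_def)
  finally have PM: "coeff (T N * D - N * T D) (n + m) \<in> M" by (simp add: PM_def)
  have "coeff (F * G) (n + m) - coeff F n * coeff G m \<in> M"
    if "F \<in> PV" "G \<in> PV" "\<forall>j>n. coeff F j \<in> M" "\<forall>j>m. coeff G j \<in> M" for F G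
  proof -
    have *: "coeff F k * coeff G l \<in> M" if "k > n \<or> l > m" for k l
      using that \<open>F \<in> PV\<close> \<open>G \<in> PV\<close> \<open>\<forall>j>n. coeff F j \<in> M\<close> \<open>\<forall>j>m. coeff G j \<in> M\<close>
      by (auto simp: PV_def intro: M_mult M_mult')
    have "(\<Sum>k\<in>{..n+m} - {n}. coeff F k * coeff G (n + m - k)) \<in> M"
    proof (intro M_sum)
      fix k assume "k \<in> {..n + m} - {n}"
      hence "k > n \<or> n + m - k > m" by auto
      thus "coeff F k * coeff G (n + m - k) \<in> M" by (rule *)
    qed
    moreover have "coeff (F * G) (n + m) = coeff F n * coeff G m +
        (\<Sum>k\<in>{..n+m} - {n}. coeff F k * coeff G (n + m - k))"
      unfolding coeff_mult by (subst sum.remove[of _ n]) auto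
    ultimately show ?thesis by simp
  qed note key = this
  have k1: "coeff (T N * D) (n + m) - coeff (T N) n * coeff D m \<in> M"
    by (rule key) (use assms TV in \<open>auto simp: is_hi_def cT intro: M_mult' V_of_nat\<close>)
  have k2: "coeff (N * T D) (n + m) - coeff N n * coeff (T D) m \<in> M"
    by (rule key) (use assms TV in \<open>auto simp: is_hi_def cT intro: M_mult' V_of_nat\<close>)
  have "coeff (T N * D - N * T D) (n + m) -
     ((coeff (T N * D) (n + m) - coeff (T N) n * coeff D m)
      - (coeff (N * T D) (n + m) - coeff N n * coeff (T D) m)) \<in> M"
    by (rule M_diff[OF PM M_diff[OF k1 k2]])
  hence "of_int (int n - int m) * (coeff N n * coeff D m) \<in> M"
    by (simp add: cT algebra_simps)
  moreover have "coeff N n * coeff D m \<notin> M" "coeff N n * coeff D m \<in> V"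
    using assms M_prime by (auto simp: is_hi_def PV_def intro: V_mult)
  ultimately have "of_int (int n - int m) \<in> M" using M_prime[OF V_of_int] by blast
  thus ?thesis by (simp only: of_int_in_M_iff)
qed auto

lemma is_lo_X: "is_lo [:0, 1:] 1" and is_lo_X1: "is_lo [:1, 1:] 0"
  and is_hi_X1: "is_hi [:1, 1:] 1" and is_hi_X: "is_hi [:0, 1:] 1"
  using one_notin_M M_0 by (auto simp: is_lo_def is_hi_def coeff_pCons split: nat.splits)

lemma PV_X: "[:0, 1:] \<in> PV" "[:1, 1:] \<in> PV"
  by (auto intro!: PV_pCons V_0 V_1 PV_0)

text \<open>Rescaling A and B to primitive polynomials turns the constant in the square-class relation
  into a unit, so that the relation can be reduced modulo pi.\<close>
lemma square_class_primitive:
  assumes "L \<in> PV" "D \<in> PV" "N \<in> PV" "is_lo L l" "D \<notin> PM" "N \<notin> PM"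
    and "A \<noteq> 0" "B \<noteq> 0" "L * A ^ 2 * D = smult d (B ^ 2 * N)" "d \<noteq> 0"
  obtains A' B' c where "A' \<in> PV" "A' \<notin> PM" "B' \<in> PV" "B' \<notin> PM" "c \<in> V" "c \<notin> M"
    "L * A' ^ 2 * D = smult c (B' ^ 2 * N)"
proof -
  obtain a where a: "a \<noteq> 0" "smult a A \<in> PV" "smult a A \<notin> PM" using ex_primitive[OF assms(7)] by blast
  obtain b where b: "b \<noteq> 0" "smult b B \<in> PV" "smult b B \<notin> PM" using ex_primitive[OF assms(8)] by blast
  define A' B' c where "A' = smult a A" and "B' = smult b B" and "c = a ^ 2 * d / b ^ 2"
  have eq: "smult c (B' ^ 2 * N) = L * A' ^ 2 * D"
  proof -
    have "L * A' ^ 2 * D = smult (a ^ 2) (L * A ^ 2 * D)" by (simp add: A'_def smult_power mult_ac)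
    also have "\<dots> = smult c (B' ^ 2 * N)"
      unfolding assms(9) using b(1) by (simp add: B'_def c_def smult_power)
    finally show ?thesis by simp
  qed
  have np: "F * G \<notin> PM" if "F \<in> PV" "F \<notin> PM" "G \<in> PV" "G \<notin> PM" for F G
    using PM_prime[OF that(1,3)] that by blast
  have A': "A' \<in> PV" "A' \<notin> PM" and B': "B' \<in> PV" "B' \<notin> PM"
    using a b by (simp_all add: A'_def B'_def)
  have L: "L \<notin> PM" using assms(4) lo_notin_PM by blast
  have AA: "A' ^ 2 \<in> PV" "A' ^ 2 \<notin> PM" and BB: "B' ^ 2 \<in> PV" "B' ^ 2 \<notin> PM"
    unfolding power2_eq_square by (rule PV_mult np A' B')+
  have "L * A' ^ 2 * D \<notin> PM" "L * A' ^ 2 * D \<in> PV"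
    using assms(1,2,5) AA L by (intro np PV_mult; blast)+
  moreover have "B' ^ 2 * N \<notin> PM" "B' ^ 2 * N \<in> PV"
    using assms(3,6) BB by (intro np PV_mult; blast)+
  ultimately have c: "c \<in> V" "c \<notin> M"
    using smult_primitive_unit[OF eq] by blast+
  show ?thesis by (rule that[of A' B' c]) (use A' B' c eq in simp_all)
qed

text \<open>Modulo pi the fraction N/D has derivative 0, so it is a function of x^p, and the degrees
  leave only (k x^p + n0)/d or a constant. The square classes exclude the degenerate cases by parity: a
  vanishing D or a constant quotient would give two relations in which an index is both even and odd, and
  a nonzero constant term n0 contradicts that x divides N to odd order up to squares.\<close>
lemma inseparable_reduction:
  assumes N: "N \<in> PV" and D: "D \<in> PV" and prim: "\<not> (N \<in> PM \<and> D \<in> PM)"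
    and deg: "degree N \<le> p" "degree D < p"
    and wr: "pderiv N * D - N * pderiv D \<in> PM"
    and cls: "A0 \<noteq> 0" "B0 \<noteq> 0" "[:0, 1:] * A0 ^ 2 * D = B0 ^ 2 * N"
      "A1 \<noteq> 0" "B1 \<noteq> 0" "[:1, 1:] * A1 ^ 2 * D = B1 ^ 2 * (N + D)"
  obtains d k where "d \<in> V" "d \<notin> M" "D - [:d:] \<in> PM" "k \<in> V" "k \<notin> M" "N - monom k p \<in> PM"
proof -
  have cls0: "[:0, 1:] * A0 ^ 2 * D = smult 1 (B0 ^ 2 * N)"
    and cls1: "[:1, 1:] * A1 ^ 2 * D = smult 1 (B1 ^ 2 * (N + D))" using cls by simp_all
  have sq_lo: "is_lo (F ^ 2) (2 * i)" if "F \<in> PV" "is_lo F i" for F i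
    using is_lo_mult[OF that(1,1) that(2,2)] by (simp add: power2_eq_square mult_2)
  have sq_hi: "is_hi (F ^ 2) (2 * i)" if "F \<in> PV" "is_hi F i" for F i
    using is_hi_mult[OF that(1,1) that(2,2)] by (simp add: power2_eq_square mult_2)
  have ND: "N + D \<in> PV" using N D by (rule PV_add)
  have D_prim: "D \<notin> PM"
  proof
    assume "D \<in> PM"
    hence NP: "N \<notin> PM" using prim by blast
    have D0: "D \<noteq> 0" using cls(1,2,3) NP PM_0 by auto
    have cong: "(N + D) - N \<in> PM" using \<open>D \<in> PM\<close> by simp
    have NDP: "N + D \<notin> PM" using PM_diff[OF _ \<open>D \<in> PM\<close>, of "N + D"] NP by auto
    obtain c where c: "c \<noteq> 0" "smult c D \<in> PV" "smult c D \<notin> PM" using ex_primitive[OF D0] by blast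
    define E where "E = smult c D"
    have E: "E \<in> PV" "E \<notin> PM" using c by (simp_all add: E_def)
    have e0: "[:0, 1:] * A0 ^ 2 * E = smult c (B0 ^ 2 * N)"
      using arg_cong[OF cls0, of "smult c"] by (simp only: E_def mult_smult_right smult_smult mult_1_right)
    have e1: "[:1, 1:] * A1 ^ 2 * E = smult c (B1 ^ 2 * (N + D))"
      using arg_cong[OF cls1, of "smult c"] by (simp only: E_def mult_smult_right smult_smult mult_1_right)
    obtain A B k where 0: "A \<in> PV" "A \<notin> PM" "B \<in> PV" "B \<notin> PM" "k \<in> V" "k \<notin> M"
      "[:0, 1:] * A ^ 2 * E = smult k (B ^ 2 * N)"
      by (rule square_class_primitive[OF PV_X(1) E(1) N is_lo_X E(2) NP cls(1,2) e0 c(1)])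
    obtain A' B' k' where 1: "A' \<in> PV" "A' \<notin> PM" "B' \<in> PV" "B' \<notin> PM" "k' \<in> V" "k' \<notin> M"
      "[:1, 1:] * A' ^ 2 * E = smult k' (B' ^ 2 * (N + D))"
      by (rule square_class_primitive[OF PV_X(2) E(1) ND is_lo_X1 E(2) NDP cls(4,5) e1 c(1)])
    obtain a b n e where lo: "is_lo A a" "is_lo B b" "is_lo N n" "is_lo E e"
      using ex_lo 0 NP E by metis
    obtain a' b' where lo': "is_lo A' a'" "is_lo B' b'" using ex_lo 1 by metis
    have lN: "is_lo (N + D) n" using lo(3) lo_cong[OF cong] by simp
    have "is_lo ([:0, 1:] * A ^ 2 * E) (1 + 2 * a + e)"
      by (intro is_lo_mult is_lo_X sq_lo PV_mult PV_power PV_X lo 0 E)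
    moreover have "is_lo (smult k (B ^ 2 * N)) (2 * b + n)"
      using 0 N lo by (subst is_lo_smult) (auto intro!: is_lo_mult sq_lo PV_mult PV_power)
    ultimately have 2: "1 + 2 * a + e = 2 * b + n" using 0(7) lo_unique by simp
    have "is_lo ([:1, 1:] * A' ^ 2 * E) (0 + 2 * a' + e)"
      by (intro is_lo_mult is_lo_X1 sq_lo PV_mult PV_power PV_X lo lo' 1 E)
    moreover have "is_lo (smult k' (B' ^ 2 * (N + D))) (2 * b' + n)"
      using 1 ND lN lo' by (subst is_lo_smult) (auto intro!: is_lo_mult sq_lo PV_mult PV_power)
    ultimately have "0 + 2 * a' + e = 2 * b' + n" using 1(7) lo_unique by simp
    with 2 show False by presburger
  qed
  have not_prop: "N - smult k D \<notin> PM" if k: "k \<in> V" for k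
  proof
    assume pr: "N - smult k D \<in> PM"
    have main: "False" if "s \<notin> M" "s \<in> V" "is_lo L l" "is_hi L 1" "L \<in> PV" "A \<noteq> 0" "B \<noteq> 0"
      "L * A ^ 2 * D = smult 1 (B ^ 2 * N1)" "N1 - smult s D \<in> PM" "N1 \<in> PV" for s L l A B N1
    proof -
      note t = that
      obtain m where m: "is_hi D m" using ex_hi D_prim by blast
      have N1: "is_hi N1 m" using hi_cong[OF t(9)] m t(1,2) D by (simp add: is_hi_smult)
      hence N1P: "N1 \<notin> PM" by (auto simp: is_hi_def PM_def)
      obtain A' B' c where 0: "A' \<in> PV" "A' \<notin> PM" "B' \<in> PV" "B' \<notin> PM" "c \<in> V" "c \<notin> M"
        "L * A' ^ 2 * D = smult c (B' ^ 2 * N1)"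
        by (rule square_class_primitive[OF t(5) D t(10,3) D_prim N1P t(6,7,8)]) auto
      obtain a b where hi: "is_hi A' a" "is_hi B' b" using ex_hi 0 by metis
      have "is_hi (L * A' ^ 2 * D) (1 + 2 * a + m)"
        by (intro is_hi_mult t(4) sq_hi PV_mult PV_power t(5) hi m 0 D)
      moreover have "is_hi (smult c (B' ^ 2 * N1)) (2 * b + m)"
        using 0 t(10) hi N1 by (subst is_hi_smult) (auto intro!: is_hi_mult sq_hi PV_mult PV_power)
      ultimately have "1 + 2 * a + m = 2 * b + m" using 0(7) hi_unique by simp
      thus False by presburger
    qed
    show False
    proof (cases "k \<in> M")
      case False
      show False by (rule main[OF False k is_lo_X is_hi_X PV_X(1) cls(1,2) cls0 pr N])
    next
      case True
      have "k + 1 \<notin> M" using M_diff[OF _ True, of "k + 1"] one_notin_M by auto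
      moreover have "(N + D) - smult (k + 1) D \<in> PM" using pr by (simp add: smult_add_left)
      ultimately show False
        using main[OF _ V_add[OF k V_1] is_lo_X1 is_hi_X1 PV_X(2) cls(4,5) cls1 _ ND] by blast
    qed
  qed
  have NP: "N \<notin> PM" using not_prop[OF V_0] by simp
  obtain n m where n: "is_hi N n" and m: "is_hi D m" using ex_hi NP D_prim by metis
  have nm: "n \<le> p" "m < p" using hi_le_degree[OF n] hi_le_degree[OF m] deg by linarith+
  have "n \<noteq> m"
  proof
    assume "n = m"
    define k where "k = coeff N n / coeff D m"
    have k: "k \<in> V" using m N by (auto simp: k_def is_hi_def PV_def intro: unit_divide)
    have Dm0: "coeff D m \<noteq> 0" using m M_0 by (auto simp: is_hi_def)
    define N1 where "N1 = N - smult k D"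
    have N1: "N1 \<in> PV" "N1 \<notin> PM" using N D k not_prop[OF k] by (auto simp: N1_def intro: PV_diff PV_smult)
    obtain n1 where n1: "is_hi N1 n1" using ex_hi N1 by blast
    have "coeff N1 i \<in> M" if "i \<ge> n" for i
    proof (cases "i = n")
      case True
      thus ?thesis using Dm0 \<open>n = m\<close> M_0 by (simp add: N1_def k_def)
    next
      case False
      with that have "i > n" by simp
      thus ?thesis using n m k \<open>n = m\<close> by (auto simp: N1_def is_hi_def intro: M_diff M_mult')
    qed
    hence "n1 < n" using n1 unfolding is_hi_def by (metis not_le)
    have "pderiv N1 * D - N1 * pderiv D = pderiv N * D - N * pderiv D"
      by (simp add: N1_def pderiv_diff pderiv_smult algebra_simps)
    hence "int p dvd int n1 - int m" using wronskian_hi[OF N1(1) D n1 m] wr by simp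
    hence "int p dvd int m - int n1" by (simp add: dvd_diff_commute)
    thus False using \<open>n1 < n\<close> \<open>n = m\<close> nm zdvd_not_zless[of "int m - int n1" "int p"] by simp
  qed
  moreover have dvd: "int p dvd int n - int m" by (rule wronskian_hi[OF N D n m wr])
  moreover have "\<not> n < m"
  proof
    assume "n < m"
    hence "\<not> int p dvd int m - int n" using nm by (intro zdvd_not_zless) auto
    thus False using dvd by (simp add: dvd_diff_commute)
  qed
  ultimately have "int p \<le> int n - int m" by (intro zdvd_imp_le) auto
  hence np: "n = p \<and> m = 0" using nm by linarith
  define d where "d = coeff D 0"
  have d: "d \<in> V" "d \<notin> M" using m np D by (auto simp: d_def is_hi_def PV_def)
  have Dd: "D - [:d:] \<in> PM"
    using m np by (auto simp: PM_def d_def is_hi_def coeff_pCons M_0 split: nat.splits)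
  have N0: "coeff N 0 \<in> M"
  proof (rule ccontr)
    assume "coeff N 0 \<notin> M"
    hence lN: "is_lo N 0" by (simp add: is_lo_def)
    have lD: "is_lo D 0" using d by (simp add: is_lo_def d_def)
    obtain A B k where 0: "A \<in> PV" "A \<notin> PM" "B \<in> PV" "B \<notin> PM" "k \<in> V" "k \<notin> M"
      "[:0, 1:] * A ^ 2 * D = smult k (B ^ 2 * N)"
      by (rule square_class_primitive[OF PV_X(1) D N is_lo_X D_prim NP cls(1,2) cls0]) auto
    obtain a b where lo: "is_lo A a" "is_lo B b" using ex_lo 0 by metis
    have "is_lo ([:0, 1:] * A ^ 2 * D) (1 + 2 * a + 0)"
      by (intro is_lo_mult is_lo_X sq_lo PV_mult PV_power PV_X lo lD 0 D)
    moreover have "is_lo (smult k (B ^ 2 * N)) (2 * b + 0)"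
      using 0 N lo lN by (subst is_lo_smult) (auto intro!: is_lo_mult[where j = 0, simplified] sq_lo PV_mult PV_power)
    ultimately have "1 + 2 * a + 0 = 2 * b + 0" using 0(7) lo_unique by simp
    thus False by presburger
  qed
  have "pderiv N \<in> PM"
  proof -
    obtain E where E: "E \<in> PV" "D - [:d:] = smult pi E" using PM_E[OF Dd] by blast
    have D': "D = [:d:] + smult pi E" using E(2) by (simp add: algebra_simps)
    have "pderiv D = smult pi (pderiv E)" unfolding D' by (simp add: pderiv_add pderiv_smult pderiv_pCons)
    hence "smult d (pderiv N) = (pderiv N * D - N * pderiv D) -
        smult pi (pderiv N * E - N * pderiv E)"
      unfolding D' by (simp add: algebra_simps smult_diff_right)
    also have "\<dots> \<in> PM"
      by (intro PM_diff wr PM_smult_pi PV_diff PV_mult PV_pderiv N E)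
    finally have dN: "smult d (pderiv N) \<in> PM" .
    have "coeff (pderiv N) i \<in> M" for i
      using dN d M_prime[of d "coeff (pderiv N) i"] PV_pderiv[OF N] by (auto simp: PM_def PV_def)
    thus ?thesis by (simp add: PM_def)
  qed
  define k where "k = coeff N p"
  have "N - monom k p \<in> PM" unfolding PM_def
  proof (intro CollectI allI)
    fix i
    consider "i = 0" | "i = p" | "0 < i" "i < p" | "i > p" by linarith
    thus "coeff (N - monom k p) i \<in> M"
    proof cases
      case 1
      thus ?thesis using N0 p_pos by simp
    next
      case 2
      thus ?thesis using M_0 by (simp add: k_def)
    next
      case 3
      have "coeff (pderiv N) (i - 1) \<in> M" using \<open>pderiv N \<in> PM\<close> by (simp add: PM_def)
      hence "of_nat i * coeff N i \<in> M" using 3 by (simp add: coeff_pderiv flip: of_nat_Suc)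
      moreover have "of_nat i \<notin> M" using 3 by (auto simp: of_nat_in_M_iff dest: dvd_imp_le)
      ultimately show ?thesis using 3 M_prime[OF V_of_nat] N by (auto simp: PV_def)
    next
      case 4
      thus ?thesis using n np by (simp add: is_hi_def)
    qed
  qed
  moreover have "k \<in> V" "k \<notin> M" using N n np by (simp_all add: k_def PV_def is_hi_def)
  ultimately show ?thesis using that d Dd by blast
qed

text \<open>By Gauss's lemma a polynomial whose square becomes integral after multiplication by a
  primitive F is itself integral.\<close>
lemma PV_square_root:
  assumes "W ^ 2 * F \<in> PV" "F \<in> PV" "F \<notin> PM" shows "W \<in> PV"
proof (cases "W = 0")
  case False
  obtain c where c: "c \<noteq> 0" "smult c W \<in> PV" "smult c W \<notin> PM" using ex_primitive[OF False] by blast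
  have "(smult c W) ^ 2 * F \<notin> PM"
    using PM_prime[of "smult c W" "smult c W"] PM_prime[of "(smult c W) ^ 2" F] c assms
    unfolding power2_eq_square by (blast intro: PV_mult)
  moreover have "(smult c W) ^ 2 * F = smult (c ^ 2) (W ^ 2 * F)" by (simp add: smult_power)
  ultimately have "c \<notin> M" using PM_smult'[OF _ assms(1), of "c ^ 2"] M_mult[of c c] M_subset_V[of c]
    by (auto simp: power2_eq_square)
  hence "smult (inverse c) (smult c W) \<in> PV" using c(2) by (rule PV_smult[OF unit_inverse])
  thus ?thesis using c by simp
qed (simp add: PV_0)

lemma coeff_pderiv_in_M: assumes "G \<in> PV" shows "coeff (pderiv G) (p - 1) \<in> M"
proof -
  have "coeff (pderiv G) (p - 1) = of_nat p * coeff G p"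
    using p_pos by (simp add: coeff_pderiv flip: of_nat_Suc)
  thus ?thesis using assms M_mult[OF p_in_M] by (simp add: PV_def)
qed

text \<open>Normalize D = 1 modulo pi, and let W be the Wronskian of N and D divided by pi. The
  differential equation becomes W^2 F = F(x^p) = F^p modulo pi, so W is F^((p-1)/2) up to sign. On the
  other hand the derivative of x^p is p x^(p-1) = pi pi' x^(p-1), so the coefficient of x^(p-1) in W is
  pi'.\<close>
theorem hasse_invariant_mod_pi:
  fixes lam :: 'a and N D :: "'a poly"
  defines "F \<equiv> [:0, 1:] * [:1, 1:] * [:lam, 1:]"
  assumes lam: "lam \<in> V" "lam \<notin> M" "lam + 1 \<notin> M" "lam - 1 \<notin> M"
    and D: "D \<noteq> 0" and deg: "degree N = p" "degree D < p"
    and ode: "(pderiv N * D - N * pderiv D) ^ 2 * F = smult (pi ^ 2) (D * N * (N + D) * (N + smult lam D))"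
    and cls: "A0 \<noteq> 0" "B0 \<noteq> 0" "[:0, 1:] * A0 ^ 2 * D = B0 ^ 2 * N"
      "A1 \<noteq> 0" "B1 \<noteq> 0" "[:1, 1:] * A1 ^ 2 * D = B1 ^ 2 * (N + D)"
  shows "pi' - coeff (F ^ ((p - 1) div 2)) (p - 1) \<in> M \<or> pi' + coeff (F ^ ((p - 1) div 2)) (p - 1) \<in> M"
proof -
  obtain c where c: "c \<noteq> 0" "smult c N \<in> PV" "smult c D \<in> PV" "\<not> (smult c N \<in> PM \<and> smult c D \<in> PM)"
    using ex_primitive_pair[OF D, of N] by blast
  have F: "F \<in> PV" unfolding F_def by (intro PV_mult PV_pCons V_0 V_1 PV_0 lam)
  have F_lo: "is_lo F 1"
  proof -
    have "is_lo [:lam, 1:] 0" using lam by (simp add: is_lo_def)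
    hence "is_lo F (1 + 0 + 0)" unfolding F_def
      by (intro is_lo_mult is_lo_X is_lo_X1 PV_mult PV_pCons V_0 V_1 PV_0 lam)
    thus ?thesis by simp
  qed
  hence FP: "F \<notin> PM" by (rule lo_notin_PM)
  define ww where "ww N D = pderiv N * D - N * pderiv D" for N D :: "'a poly"
  define rhs where "rhs N D = D * N * (N + D) * (N + smult lam D)" for N D :: "'a poly"
  have rhs_PV: "rhs N D \<in> PV" if "N \<in> PV" "D \<in> PV" for N D
    unfolding rhs_def by (intro PV_mult PV_add PV_smult that lam)
  define scal where "scal k N D \<longleftrightarrow> ww (smult k N) (smult k D) = smult (k ^ 2) (ww N D) \<and>
      rhs (smult k N) (smult k D) = smult (k ^ 4) (rhs N D)" for k :: 'a and N D
  have scal: "scal k N D" for k N D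
  proof -
    have "smult k N + smult k D = smult k (N + D)"
      "smult k N + smult lam (smult k D) = smult k (N + smult lam D)"
      by (simp_all add: smult_add_right mult.commute)
    hence "rhs (smult k N) (smult k D) = smult k D * smult k N * smult k (N + D) * smult k (N + smult lam D)"
      by (simp only: rhs_def)
    also have "\<dots> = smult (k ^ 4) (rhs N D)" by (simp add: rhs_def power4_eq_xxxx mult_ac)
    finally show ?thesis
      by (simp add: scal_def ww_def pderiv_smult smult_diff_right power2_eq_square)
  qed
  have ode_scaled: "(smult (inverse pi) (ww (smult k N) (smult k D))) ^ 2 * F = rhs (smult k N) (smult k D)" for k
  proof -
    have "(ww N D) ^ 2 * F = smult (pi ^ 2) (rhs N D)" using ode by (simp add: ww_def rhs_def)
    moreover have "(smult (inverse pi) (ww (smult k N) (smult k D))) ^ 2 * F =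
        smult (inverse pi ^ 2 * k ^ 4) ((ww N D) ^ 2 * F)"
      using scal[of k N D] by (simp add: scal_def smult_power power_mult_distrib mult_ac flip: power_mult)
    moreover have "inverse pi ^ 2 * k ^ 4 * pi ^ 2 = k ^ 4" using pi_nonzero by (simp add: field_simps)
    ultimately show ?thesis using scal[of k N D] by (simp add: scal_def)
  qed
  define W1 where "W1 = smult (inverse pi) (ww (smult c N) (smult c D))"
  have "W1 ^ 2 * F \<in> PV" unfolding W1_def ode_scaled by (intro rhs_PV c)
  hence "W1 \<in> PV" using F FP by (rule PV_square_root)
  hence "smult pi W1 \<in> PM" by (rule PM_smult_pi)
  hence wr: "pderiv (smult c N) * smult c D - smult c N * pderiv (smult c D) \<in> PM"
    using pi_nonzero by (simp add: W1_def ww_def)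
  have cls0: "[:0, 1:] * A0 ^ 2 * smult c D = B0 ^ 2 * smult c N"
    using arg_cong[OF cls(3), of "smult c"] by (simp only: mult_smult_right)
  have cls1: "[:1, 1:] * A1 ^ 2 * smult c D = B1 ^ 2 * (smult c N + smult c D)"
    using arg_cong[OF cls(6), of "smult c"] by (simp only: mult_smult_right smult_add_right[symmetric])
  obtain d k where dk: "d \<in> V" "d \<notin> M" "smult c D - [:d:] \<in> PM" "k \<in> V" "k \<notin> M" "smult c N - monom k p \<in> PM"
    by (rule inseparable_reduction[OF c(2,3,4) _ _ wr cls(1,2) cls0 cls(4,5) cls1]) (use c deg in auto)
  have d0: "d \<noteq> 0" and dinv: "inverse d \<in> V" using dk M_0 unit_inverse by auto
  define n e \<kappa> where "n = smult (c / d) N" and "e = smult (c / d) D" and "\<kappa> = k / d"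
  have \<kappa>: "\<kappa> \<in> V" unfolding \<kappa>_def using dk by (intro unit_divide)
  have "smult (inverse d) (smult c D - [:d:]) \<in> PM" "smult (inverse d) (smult c N - monom k p) \<in> PM"
    using dk dinv by (auto intro: PM_smult)
  hence e1: "e - 1 \<in> PM" and n1: "n - monom \<kappa> p \<in> PM"
    using d0 by (simp_all add: e_def n_def \<kappa>_def smult_diff_right smult_monom field_simps one_pCons)
  obtain K where K: "K \<in> PV" "e - 1 = smult pi K" using PM_E[OF e1] by blast
  obtain G where G: "G \<in> PV" "n - monom \<kappa> p = smult pi G" using PM_E[OF n1] by blast
  have e: "e = 1 + smult pi K" and n: "n = monom \<kappa> p + smult pi G" using K G by (simp_all add: algebra_simps)
  have eV: "e \<in> PV" unfolding e by (intro PV_add PV_1 PV_smult pi_V K)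
  have nV: "n \<in> PV" unfolding n by (intro PV_add PV_monom PV_smult pi_V G \<kappa>)
  define W where "W = smult (inverse pi) (ww n e)"
  have WF: "W ^ 2 * F = rhs n e" unfolding W_def n_def e_def by (rule ode_scaled)
  have "W ^ 2 * F \<in> PV" unfolding WF by (intro rhs_PV nV eV)
  hence WV: "W \<in> PV" using F FP by (rule PV_square_root)
  \<comment> \<open>Apart from the monomial contributed by the derivative of x^p, everything in W is divisible by pi,
     a derivative, or a multiple of x^p, and none of these reaches the coefficient of x^(p-1).\<close>
  have "ww n e = smult pi (smult (\<kappa> * pi') (monom 1 (p - 1)) + pderiv G
      + smult pi (smult (\<kappa> * pi') (monom 1 (p - 1)) * K + pderiv G * K - G * pderiv K)
      - monom \<kappa> p * pderiv K)"
  proof -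
    have pn: "pderiv n = smult pi (smult (\<kappa> * pi') (monom 1 (p - 1)) + pderiv G)"
    proof -
      have "pderiv (monom \<kappa> p) = smult (of_nat p * \<kappa>) (monom 1 (p - 1))"
        by (simp add: pderiv_monom smult_monom)
      also have "of_nat p * \<kappa> = pi * (\<kappa> * pi')" by (simp add: p_eq mult_ac)
      finally show ?thesis by (simp add: n pderiv_add pderiv_smult smult_add_right)
    qed
    have pe: "pderiv e = smult pi (pderiv K)" by (simp add: e pderiv_add pderiv_smult)
    show ?thesis unfolding ww_def pn pe
      unfolding n e by (simp add: algebra_simps smult_add_right smult_diff_right)
  qed
  hence W: "W = smult (\<kappa> * pi') (monom 1 (p - 1)) + pderiv G
      + smult pi (smult (\<kappa> * pi') (monom 1 (p - 1)) * K + pderiv G * K - G * pderiv K)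
      - monom \<kappa> p * pderiv K"
    using pi_nonzero by (simp add: W_def)
  have c1: "coeff (smult pi (smult (\<kappa> * pi') (monom 1 (p - 1)) * K + pderiv G * K - G * pderiv K)) (p - 1) \<in> M"
  proof -
    have "smult pi (smult (\<kappa> * pi') (monom 1 (p - 1)) * K + pderiv G * K - G * pderiv K) \<in> PM"
      by (intro PM_smult_pi PV_diff PV_add PV_mult PV_smult PV_monom V_mult V_1 PV_pderiv \<kappa> pi'_V K G)
    thus ?thesis by (simp add: PM_def)
  qed
  have c2: "coeff (monom \<kappa> p * pderiv K) (p - 1) = 0"
    using p_pos by (simp add: coeff_monom_mult)
  have "coeff W (p - 1) - \<kappa> * pi' \<in> M"
    unfolding W using M_add[OF coeff_pderiv_in_M[OF G(1)] c1] c2 by (simp add: coeff_monom)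
  note Wc = this
  \<comment> \<open>Modulo pi the right-hand side is f(kappa x^p); the roots of f in the residue field are its
     own Frobenius images, so kappa permutes them, and this forces kappa = 1.\<close>
  define R where "R = monom \<kappa> p * (monom \<kappa> p + 1) * (monom \<kappa> p + [:lam:])"
  have RV: "monom \<kappa> p \<in> PV" "monom \<kappa> p + 1 \<in> PV" "monom \<kappa> p + [:lam:] \<in> PV"
    by (intro PV_add PV_monom PV_1 PV_pCons PV_0 lam \<kappa>)+
  have mult_cong: "a * b - a' * b' \<in> PM" if "a - a' \<in> PM" "b - b' \<in> PM" "a \<in> PV" "b' \<in> PV" for a a' b b'
  proof -
    have "a * b - a' * b' = a * (b - b') + (a - a') * b'" by (simp add: algebra_simps)
    thus ?thesis using that by (auto intro: PM_add PM_mult PM_mult')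
  qed
  have "n + e - (monom \<kappa> p + 1) \<in> PM" "n + smult lam e - (monom \<kappa> p + [:lam:]) \<in> PM"
  proof -
    have eq: "n + e - (monom \<kappa> p + 1) = (n - monom \<kappa> p) + (e - 1)" by simp
    show "n + e - (monom \<kappa> p + 1) \<in> PM" unfolding eq by (rule PM_add[OF n1 e1])
    have eq: "n + smult lam e - (monom \<kappa> p + [:lam:]) = (n - monom \<kappa> p) + smult lam (e - 1)"
      by (simp add: smult_diff_right)
    show "n + smult lam e - (monom \<kappa> p + [:lam:]) \<in> PM"
      unfolding eq by (rule PM_add[OF n1 PM_smult[OF lam(1) e1]])
  qed
  hence "e * n * (n + e) * (n + smult lam e) - 1 * monom \<kappa> p * (monom \<kappa> p + 1) * (monom \<kappa> p + [:lam:]) \<in> PM"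
    using e1 n1 by (intro mult_cong PV_mult RV eV nV PV_add PV_1)
  hence WR: "W ^ 2 * F - R \<in> PM" unfolding WF R_def rhs_def by simp
  have frob_M: "a ^ p - a \<in> M" if "a \<in> V" for a using frobenius[OF that] by (auto simp: M_def)
  have root: "(\<kappa> * x) * (\<kappa> * x + 1) * (\<kappa> * x + lam) \<in> M" if x: "x \<in> V" "poly F x = 0" for x
  proof -
    have "poly (W ^ 2 * F - R) x \<in> M" by (rule PM_poly[OF WR x(1)])
    hence "poly R x \<in> M" using x(2) M_minus by fastforce
    moreover have "poly R x = (\<kappa> * x ^ p) * (\<kappa> * x ^ p + 1) * (\<kappa> * x ^ p + lam)"
      by (simp add: R_def poly_monom)
    moreover have "(\<kappa> * x ^ p) * (\<kappa> * x ^ p + 1) * (\<kappa> * x ^ p + lam) -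
       (\<kappa> * x) * (\<kappa> * x + 1) * (\<kappa> * x + lam) = (x ^ p - x) *
         (\<kappa> * (\<kappa> * x ^ p + 1) * (\<kappa> * x ^ p + lam) + \<kappa> * x * \<kappa> * (\<kappa> * x ^ p + lam) + \<kappa> * x * (\<kappa> * x + 1) * \<kappa>)"
      by (simp add: algebra_simps)
    moreover have "\<dots> \<in> M"
      by (intro M_mult frob_M x V_mult V_add V_power V_1 \<kappa> lam)
    ultimately show ?thesis using M_cong by metis
  qed
  have \<kappa>1: "\<kappa> - 1 \<in> M"
  proof -
    have \<kappa>M: "\<kappa> \<notin> M"
    proof
      assume "\<kappa> \<in> M"
      hence "\<kappa> * d \<in> M" using dk(1) by (rule M_mult)
      thus False using dk d0 by (simp add: \<kappa>_def)
    qed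
    have V: "1 - \<kappa> \<in> V" "lam - \<kappa> \<in> V" "1 - \<kappa> * lam \<in> V" "\<kappa> * lam \<in> V"
      by (intro V_diff V_mult V_1 lam \<kappa>)+
    have "(\<kappa> * (- 1)) * (\<kappa> * (- 1) + 1) * (\<kappa> * (- 1) + lam) \<in> M"
      by (rule root) (simp_all add: F_def V_minus V_1)
    hence "- ((\<kappa> * (- 1)) * (\<kappa> * (- 1) + 1) * (\<kappa> * (- 1) + lam)) \<in> M" by (rule M_minus)
    also have "- ((\<kappa> * (- 1)) * (\<kappa> * (- 1) + 1) * (\<kappa> * (- 1) + lam)) = \<kappa> * ((1 - \<kappa>) * (lam - \<kappa>))"
      by (simp add: algebra_simps)
    finally have 1: "1 - \<kappa> \<in> M \<or> lam - \<kappa> \<in> M"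
      using M_prime[OF \<kappa> V_mult[OF V(1,2)]] M_prime[OF V(1,2)] \<kappa>M by blast
    have "(\<kappa> * (- lam)) * (\<kappa> * (- lam) + 1) * (\<kappa> * (- lam) + lam) \<in> M"
      by (rule root) (simp_all add: F_def V_minus lam)
    hence "- ((\<kappa> * (- lam)) * (\<kappa> * (- lam) + 1) * (\<kappa> * (- lam) + lam)) \<in> M" by (rule M_minus)
    also have "- ((\<kappa> * (- lam)) * (\<kappa> * (- lam) + 1) * (\<kappa> * (- lam) + lam)) =
        (\<kappa> * lam) * ((1 - \<kappa> * lam) * (lam * (1 - \<kappa>)))"
      by (simp add: algebra_simps)
    finally have 2: "1 - \<kappa> * lam \<in> M \<or> 1 - \<kappa> \<in> M"
      using M_prime[OF V(4) V_mult[OF V(3) V_mult[OF lam(1) V(1)]]] M_prime[OF V(3) V_mult[OF lam(1) V(1)]]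
        M_prime[OF lam(1) V(1)] M_prime[OF \<kappa> lam(1)] \<kappa>M lam(2) by blast
    have "1 - \<kappa> \<in> M"
    proof (rule ccontr)
      assume "1 - \<kappa> \<notin> M"
      with 1 2 have "1 - \<kappa> * lam \<in> M" "lam - \<kappa> \<in> M" by auto
      hence "lam * (lam - \<kappa>) - (1 - \<kappa> * lam) \<in> M" using M_diff[OF M_mult'[OF lam(1)]] by blast
      also have "lam * (lam - \<kappa>) - (1 - \<kappa> * lam) = (lam + 1) * (lam - 1)"
        by (simp add: algebra_simps)
      finally have "(lam + 1) * (lam - 1) \<in> M" .
      thus False using M_prime[OF V_add[OF lam(1) V_1] V_diff[OF lam(1) V_1]] lam by blast
    qed
    from M_minus[OF this] show ?thesis by simp
  qed
  define h where "h = (p - 1) div 2"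
  have ph: "p = Suc (2 * h)" using odd_p by (auto elim!: oddE simp: h_def)
  define x where "x = (monom 1 p :: 'a poly)"
  have xV: "x \<in> PV" unfolding x_def by (intro PV_monom V_1)
  have x\<kappa>: "monom \<kappa> p - x \<in> PM" using \<kappa>1 by (auto simp: PM_def x_def M_0)
  have Rx: "R - x * (x + 1) * (x + [:lam:]) \<in> PM"
    unfolding R_def using x\<kappa> by (intro mult_cong PV_mult RV PV_add xV PV_1 PV_pCons PV_0 lam) simp_all
  have fr: "[:0, 1:] ^ p - x \<in> PM" "[:1, 1:] ^ p - (x + 1) \<in> PM" "[:lam, 1:] ^ p - (x + [:lam:]) \<in> PM"
    using freshman[OF V_0] freshman[OF V_1] freshman[OF lam(1)] by (simp_all add: x_def one_pCons)
  have "F ^ p = [:0, 1:] ^ p * [:1, 1:] ^ p * [:lam, 1:] ^ p"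
    unfolding F_def by (simp only: power_mult_distrib)
  hence "F ^ p - x * (x + 1) * (x + [:lam:]) \<in> PM"
    by (simp only:) (intro mult_cong fr PV_mult PV_power PV_X PV_pCons PV_0 PV_1 V_1 lam PV_add xV)
  from PM_diff[OF PM_add[OF WR Rx] this] have "W ^ 2 * F - F ^ p \<in> PM" by simp
  moreover have "W ^ 2 * F - F ^ p = F * ((W - F ^ h) * (W + F ^ h))"
  proof -
    have "F ^ p = F * (F ^ h) ^ 2" unfolding ph by (simp add: power_even_eq)
    thus ?thesis by (simp add: algebra_simps power2_eq_square)
  qed
  ultimately have "F * ((W - F ^ h) * (W + F ^ h)) \<in> PM" by simp
  hence "(W - F ^ h) * (W + F ^ h) \<in> PM"
    using PM_prime[OF F PV_mult[OF PV_diff PV_add]] FP WV PV_power[OF F] by blast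
  hence "W - F ^ h \<in> PM \<or> W + F ^ h \<in> PM"
    using PM_prime[OF PV_diff PV_add] WV PV_power[OF F] by blast
  hence *: "coeff W (p - 1) - coeff (F ^ h) (p - 1) \<in> M \<or> coeff W (p - 1) + coeff (F ^ h) (p - 1) \<in> M"
    by (auto simp: PM_def)
  have "pi' * (\<kappa> - 1) \<in> M" using pi'_V \<kappa>1 by (rule M_mult')
  from M_add[OF Wc this] have W1: "coeff W (p - 1) - pi' \<in> M" by (simp add: algebra_simps)
  from * show ?thesis
  proof
    assume "coeff W (p - 1) - coeff (F ^ h) (p - 1) \<in> M"
    from M_diff[OF this W1] show ?thesis by (simp add: h_def)
  next
    assume "coeff W (p - 1) + coeff (F ^ h) (p - 1) \<in> M"
    from M_diff[OF this W1] show ?thesis by (simp add: h_def add.commute)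
  qed
qed

end

section \<open>The form x^2 + 7 y^2\<close>

text \<open>If p divided y, then y = 0 would make p a square and y \<noteq> 0 would make the norm larger
  than p.\<close>
lemma norm_y_not_dvd:
  fixes x y :: int
  assumes p: "prime p" and p_norm: "int p = x ^ 2 + 7 * y ^ 2" shows "\<not> int p dvd y"
proof
  assume y: "int p dvd y"
  have p1: "p > 1" using p prime_gt_1_nat by blast
  have "y \<noteq> 0"
  proof
    assume "y = 0"
    hence "int p = x ^ 2" using p_norm by simp
    hence "is_square p" by (metis is_nth_power_def int_ops(1) nat_int of_nat_power zero_le_power2 power2_abs zabs_def nat_power_eq abs_ge_zero)
    thus False using p by (metis is_nth_power_def prime_power_iff one_neq_zero numeral_eq_one_iff semiring_norm(85))
  qed
  hence "int p \<le> \<bar>y\<bar>" using dvd_imp_le_int[OF _ y] by simp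
  hence "int p ^ 2 \<le> y ^ 2" using abs_le_square_iff[of "int p" y] by simp
  moreover have "x ^ 2 \<ge> 0" by simp
  ultimately have "7 * int p ^ 2 \<le> int p" unfolding p_norm[symmetric] using p_norm by linarith
  moreover have "int p ^ 2 \<ge> int p" using p1 by (simp add: power2_eq_square)
  ultimately show False using p1 by linarith
qed

lemma square_mod_7: fixes u :: int shows "u ^ 2 mod 7 \<in> {0, 1, 2, 4}"
proof -
  have "u mod 7 \<in> {0, 1, 2, 3, 4, 5, 6}" using pos_mod_bound[of 7 u] pos_mod_sign[of 7 u] by auto
  moreover have "u ^ 2 mod 7 = (u mod 7) ^ 2 mod 7" by (simp add: power_mod)
  ultimately show ?thesis by auto
qed

text \<open>By quadratic reciprocity the symbol of -7 modulo p is the symbol of p modulo 7; the two signs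
  (-1)^h cancel because 7 is 3 modulo 4.\<close>
lemma Legendre_minus_7:
  assumes p: "prime p" "p > 7"
  shows "p mod 7 \<in> {1, 2, 4} \<Longrightarrow> Legendre (- 7) (int p) = 1 \<and> [(- 7) ^ ((p - 1) div 2) = 1] (mod int p)"
    and "p mod 7 \<in> {3, 5, 6} \<Longrightarrow> Legendre (- 7) (int p) = -1 \<and> [(- 7) ^ ((p - 1) div 2) = -1] (mod int p)"
proof -
  define h where "h = (p - 1) div 2"
  have p7: "Legendre (int p) 7 = (if p mod 7 \<in> {1, 2, 4} then 1 else - 1)" if "p mod 7 \<in> {1, 2, 4} \<union> {3, 5, 6}"
  proof -
    have "prime (7 :: nat)" by simp
    hence e: "[Legendre (int p) (int 7) = int p ^ ((7 - 1) div 2)] (mod int 7)" by (intro euler_criterion) simp_all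
    have L: "Legendre (int p) 7 \<in> {- 1, 0, 1}" by (simp add: Legendre_def)
    have "int p ^ 3 mod 7 = (int p mod 7) ^ 3 mod 7" by (simp add: power_mod)
    moreover have "int p mod 7 = int (p mod 7)" by (simp add: zmod_int)
    ultimately have "Legendre (int p) 7 mod 7 = int (p mod 7) ^ 3 mod 7" using e by (simp add: cong_def)
    thus ?thesis using that L by auto
  qed
  have "prime (7 :: nat)" by simp
  hence rec: "Legendre (int p) 7 * Legendre 7 (int p) = (- 1) ^ (h * 3)"
    using Quadratic_Reciprocity[of p 7] p by (simp add: h_def)
  have e7: "[Legendre 7 (int p) = 7 ^ h] (mod int p)"
    unfolding h_def by (intro euler_criterion) (use p in auto)
  have em: "[Legendre (- 7) (int p) = (- 7) ^ h] (mod int p)"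
    unfolding h_def by (intro euler_criterion) (use p in auto)
  have m: "(- 7 :: int) ^ h = (- 1) ^ h * 7 ^ h" using power_mult_distrib[of "- 1 :: int" 7 h] by simp
  have sgn: "[(- 7) ^ h = e] (mod int p)" if e: "Legendre (int p) 7 = e" "e * e = 1" for e
  proof -
    have "Legendre 7 (int p) = e * (e * Legendre 7 (int p))" using e(2) by (simp add: mult.assoc[symmetric])
    also have "e * Legendre 7 (int p) = (- 1) ^ h" using rec e(1) by (simp add: power_mult mult.commute[of h])
    finally have "(- 1) ^ h * Legendre 7 (int p) = e" by (simp add: mult.left_commute flip: power_add)
    moreover have "[(- 7) ^ h = (- 1) ^ h * Legendre 7 (int p)] (mod int p)"
      unfolding m by (rule cong_scalar_left[OF cong_sym[OF e7]])
    ultimately show ?thesis by simp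
  qed
  have L: "Legendre (- 7) (int p) = e" if e: "[(- 7) ^ h = e] (mod int p)" "e = 1 \<or> e = - 1" for e
  proof -
    have "[Legendre (- 7) (int p) = e] (mod int p)" using em e(1) by (rule cong_trans)
    hence d: "int p dvd Legendre (- 7) (int p) - e" by (simp add: cong_iff_dvd_diff)
    have "\<bar>Legendre (- 7) (int p) - e\<bar> \<le> 2" using e(2) by (auto simp: Legendre_def)
    hence "Legendre (- 7) (int p) - e = 0" using dvd_imp_le_int[OF _ d] p(2) by fastforce
    thus ?thesis by simp
  qed
  show "p mod 7 \<in> {1, 2, 4} \<Longrightarrow> Legendre (- 7) (int p) = 1 \<and> [(- 7) ^ ((p - 1) div 2) = 1] (mod int p)"
    using p7 sgn[of 1] L[of 1] by (auto simp: h_def)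
  show "p mod 7 \<in> {3, 5, 6} \<Longrightarrow> Legendre (- 7) (int p) = -1 \<and> [(- 7) ^ ((p - 1) div 2) = -1] (mod int p)"
    using p7 sgn[of "- 1"] L[of "- 1"] by (auto simp: h_def)
qed

text \<open>Among the more than p pairs with both entries at most the integer part of the square root of
  p, two have the same value of a + r b modulo p; take their difference.\<close>
lemma thue:
  fixes r :: int and p :: nat
  assumes "prime p"
  shows "\<exists>u v :: int. (u \<noteq> 0 \<or> v \<noteq> 0) \<and> int p dvd u + r * v \<and> u ^ 2 < int p \<and> v ^ 2 < int p"
proof -
  define m where "m = floor_sqrt p"
  have m1: "m ^ 2 \<le> p" "p < (Suc m) ^ 2" by (simp_all add: m_def Suc_floor_sqrt_power2_gt)
  have "m ^ 2 \<noteq> p"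
  proof
    assume "m ^ 2 = p"
    hence "prime (m ^ 2)" using assms by simp
    thus False by (simp add: prime_power_iff)
  qed
  hence m2: "int m ^ 2 < int p" using m1(1) by (metis le_neq_implies_less of_nat_less_iff of_nat_power)
  define f where "f = (\<lambda>(a, b). (int a + r * int b) mod int p)"
  have p0: "p > 0" using assms prime_gt_0_nat by blast
  have "f ` ({..m} \<times> {..m}) \<subseteq> {0..<int p}" using p0 by (auto simp: f_def)
  hence "card (f ` ({..m} \<times> {..m})) \<le> p" using card_mono[of "{0..<int p}"] by fastforce
  also have "p < card ({..m} \<times> {..m})" using m1(2) by (simp add: card_cartesian_product power2_eq_square)
  finally have "\<not> inj_on f ({..m} \<times> {..m})" using pigeonhole by blast
  then obtain a b a' b' where ab: "a \<le> m" "b \<le> m" "a' \<le> m" "b' \<le> m" "(a, b) \<noteq> (a', b')" "f (a, b) = f (a', b')"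
    by (auto simp: inj_on_def)
  define u v where "u = int a - int a'" and "v = int b - int b'"
  have "int p dvd (int a + r * int b) - (int a' + r * int b')"
    using ab(6) by (simp add: f_def mod_eq_dvd_iff)
  also have "(int a + r * int b) - (int a' + r * int b') = u + r * v" by (simp add: u_def v_def algebra_simps)
  finally have "int p dvd u + r * v" .
  moreover have "u \<noteq> 0 \<or> v \<noteq> 0" using ab(5) by (auto simp: u_def v_def)
  moreover have "w ^ 2 < int p" if "\<bar>w\<bar> \<le> int m" for w :: int
    using le_less_trans[OF _ m2, of "w ^ 2"] that abs_le_square_iff[of w "int m"] by simp
  moreover have "\<bar>u\<bar> \<le> int m" "\<bar>v\<bar> \<le> int m" using ab(1-4) by (auto simp: u_def v_def)
  ultimately show ?thesis by blast
qed

text \<open>Thue's lemma with r^2 = -7 gives u^2 + 7 v^2 = k p with 0 < k < 8. Residues modulo 7 exclude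
  k = 3, 5, 6, residues modulo 8 exclude k = 2 and make u and v even for k = 4, and for k = 7 the roles
  of u and v can be exchanged.\<close>
theorem norm_form_representation:
  assumes p: "prime p" "p > 7" and p7: "p mod 7 \<in> {1, 2, 4}"
  shows "\<exists>x y :: int. int p = x ^ 2 + 7 * y ^ 2"
proof -
  have "Legendre (- 7) (int p) = 1" using Legendre_minus_7(1)[OF p p7] by simp
  hence "QuadRes (int p) (- 7)" by (auto simp: Legendre_def split: if_splits)
  then obtain r where "[r ^ 2 = - 7] (mod int p)" by (auto simp: QuadRes_def)
  hence r: "int p dvd r ^ 2 + 7" by (simp add: cong_iff_dvd_diff)
  obtain u v :: int where uv: "u \<noteq> 0 \<or> v \<noteq> 0" "int p dvd u + r * v" "u ^ 2 < int p" "v ^ 2 < int p"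
    using thue[OF p(1), of r] by blast
  have "u ^ 2 + 7 * v ^ 2 = (u + r * v) * (u - r * v) + v ^ 2 * (r ^ 2 + 7)"
    by (simp add: algebra_simps power2_eq_square)
  also have "int p dvd \<dots>" using r uv(2) by simp
  finally obtain k where k: "u ^ 2 + 7 * v ^ 2 = int p * k" by (elim dvdE)
  have "u ^ 2 + 7 * v ^ 2 > 0" using uv(1) by (cases "u = 0") (auto intro: add_pos_nonneg)
  hence k0: "k > 0" using k p by (simp add: zero_less_mult_iff)
  have "int p * k < int p * 8" using k uv(3,4) by linarith
  hence k8: "k < 8" using p by simp
  have square: "u ^ 2 mod 7 = (int (p mod 7) * k) mod 7"
  proof -
    have "u ^ 2 mod 7 = (u ^ 2 + 7 * v ^ 2) mod 7" by simp
    also have "\<dots> = (int (p mod 7) * k) mod 7" unfolding k by (simp add: zmod_int mod_mult_left_eq)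
    finally show ?thesis .
  qed
  have "k \<notin> {3, 5, 6}" using square square_mod_7[of u] p7 by auto
  hence kcases: "k = 1 \<or> k = 2 \<or> k = 4 \<or> k = 7" using k0 k8 by auto
  have oddp: "odd (int p)" using prime_odd_nat[OF p(1)] p(2) by simp
  have odd8: "\<exists>i. w ^ 2 = 8 * i + 1" if "odd w" for w :: int
  proof -
    obtain i where i: "w = 2 * i + 1" using \<open>odd w\<close> by (elim oddE)
    have "even (i * (i + 1))" by simp
    then obtain j where "i * (i + 1) = 2 * j" by (elim evenE)
    hence "w ^ 2 = 8 * j + 1" unfolding i by (simp add: power2_eq_square algebra_simps)
    thus ?thesis by blast
  qed
  have par: "even u \<and> even v" if k2: "k = 2 \<or> k = 4"
  proof -
    have "even (u ^ 2 + 7 * v ^ 2)" unfolding k using k2 by auto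
    hence "even u \<longleftrightarrow> even v" by simp
    moreover have False if "odd u" "odd v"
    proof -
      obtain i j where ij: "u ^ 2 = 8 * i + 1" "v ^ 2 = 8 * j + 1" using odd8 \<open>odd u\<close> \<open>odd v\<close> by meson
      have "int p * k = 8 * (i + 7 * j + 1)" unfolding k[symmetric] ij by simp
      hence "int p = 4 * (i + 7 * j + 1) \<or> int p = 2 * (i + 7 * j + 1)" using k2 by auto
      hence "even (int p)" by (elim disjE) (simp_all only: even_mult_iff, simp_all)
      thus False using oddp by blast
    qed
    ultimately show ?thesis by blast
  qed
  show ?thesis
    using kcases
  proof (elim disjE)
    assume "k = 1"
    thus ?thesis using k by (metis mult_1_right)
  next
    assume k2: "k = 2"
    then obtain i j where "u = 2 * i" "v = 2 * j" using par by (metis evenE)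
    hence "int p = 2 * (i ^ 2 + 7 * j ^ 2)" using k k2 by (simp add: power2_eq_square)
    thus ?thesis using oddp by simp
  next
    assume k4: "k = 4"
    then obtain i j where "u = 2 * i" "v = 2 * j" using par by (metis evenE)
    hence "int p = i ^ 2 + 7 * j ^ 2" using k k4 by (simp add: power2_eq_square)
    thus ?thesis by blast
  next
    assume k7: "k = 7"
    have "u ^ 2 = 7 * (int p - v ^ 2)" using k k7 by simp
    hence "7 dvd u ^ 2" by simp
    moreover have "prime (7 :: int)" by simp
    ultimately have "7 dvd u" using prime_dvd_power by blast
    then obtain w where w: "u = 7 * w" by (elim dvdE)
    hence "int p = v ^ 2 + 7 * w ^ 2" using k k7 by (simp add: power2_eq_square)
    thus ?thesis by blast
  qed
qed

section \<open>Split primes\<close>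

definition alpha :: quad where "alpha = Quad (1/2) (1/2)"

lemma alpha_square: "alpha ^ 2 = alpha - 2"
  by (simp add: quad_eq_iff alpha_def power2_eq_square)

interpretation cm: cm_curve alpha
  by standard (rule alpha_square)

text \<open>The elements of Z[s]. This order has index 2 in the ring of integers, which does no harm at
  an odd prime.\<close>
definition zs :: "int \<Rightarrow> int \<Rightarrow> quad" where "zs m n = Quad (of_int m) (of_int n)"

lemma zs_simps:
  "zs m n + zs k l = zs (m + k) (n + l)" "zs m n - zs k l = zs (m - k) (n - l)"
  "- zs m n = zs (- m) (- n)" "zs m n * zs k l = zs (m * k - 7 * n * l) (m * l + n * k)"
  "of_int m = zs m 0" "of_nat j = zs (int j) 0" "1 = zs 1 0" "0 = zs 0 0"
  "zs m n = zs k l \<longleftrightarrow> m = k \<and> n = l"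
  by (simp_all add: zs_def quad_eq_iff)

lemma zs_power: "\<exists>k l. zs m n ^ j = zs k l"
proof (induction j)
  case 0
  show ?case by (intro exI[of _ 1] exI[of _ 0]) (simp add: zs_simps(7)[symmetric])
next
  case (Suc j)
  then obtain k l where "zs m n ^ j = zs k l" by blast
  thus ?case by (simp add: zs_simps(4)) blast
qed

lemma zs_alpha: "zs m n = of_int (m - n) + of_int (2 * n) * alpha"
  by (simp add: zs_def quad_eq_iff alpha_def)

lemma quad_as_zs_fraction: "\<exists>m n N. N > 0 \<and> a * of_int N = zs m n"
proof -
  obtain u v where uv: "qre a = of_int u / of_int v" "v > 0" by (metis Rat_cases Fract_of_int_quotient)
  obtain w t where wt: "qim a = of_int w / of_int t" "t > 0" by (metis Rat_cases Fract_of_int_quotient)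
  have "a * of_int (v * t) = zs (u * t) (w * v)"
    using uv wt by (simp add: quad_eq_iff zs_def)
  moreover have "v * t > 0" using uv wt by simp
  ultimately show ?thesis by blast
qed

text \<open>Reduction modulo pi = x + ys is the map that sends s to r, so pi itself goes to 0.\<close>
locale split_prime =
  fixes p :: nat and x y r :: int
  assumes p: "prime p" "p > 7" and p_norm: "int p = x ^ 2 + 7 * y ^ 2" and r: "int p dvd x + y * r"
begin

text \<open>The reduction map on Z[s], with values in the integers; on the rest of the field its values
  are meaningless.\<close>
definition ph :: "quad \<Rightarrow> int" where "ph u = \<lfloor>qre u\<rfloor> + \<lfloor>qim u\<rfloor> * r"

lemma ph_zs [simp]: "ph (zs m n) = m + n * r"
  by (simp add: ph_def zs_def)

lemma prime_int: "prime (int p)" using p by simp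

lemma y_not_dvd: "\<not> int p dvd y"
  by (rule norm_y_not_dvd[OF p(1) p_norm])

lemma r_square: "int p dvd r ^ 2 + 7"
proof -
  have "y ^ 2 * (r ^ 2 + 7) = (x + y * r) * (y * r - x) + int p" unfolding p_norm by (simp add: algebra_simps power2_eq_square)
  also have "int p dvd \<dots>" using r by simp
  finally have "int p dvd y ^ 2 * (r ^ 2 + 7)" .
  thus ?thesis using y_not_dvd prime_int by (simp add: prime_dvd_mult_iff prime_dvd_power_iff)
qed

lemma ph_mult: "[ph (zs m n * zs k l) = ph (zs m n) * ph (zs k l)] (mod int p)"
proof -
  have "ph (zs m n * zs k l) - ph (zs m n) * ph (zs k l) = - (n * l) * (r ^ 2 + 7)"
    by (simp add: zs_simps algebra_simps power2_eq_square)
  thus ?thesis using r_square by (simp add: cong_iff_dvd_diff)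
qed

lemma ph_power: "[ph (zs m n ^ j) = ph (zs m n) ^ j] (mod int p)"
proof (induction j)
  case 0 show ?case by (simp add: ph_def)
next
  case (Suc j)
  obtain k l where kl: "zs m n ^ j = zs k l" using zs_power by blast
  have "[ph (zs m n ^ Suc j) = ph (zs m n) * ph (zs m n ^ j)] (mod int p)"
    unfolding power_Suc kl by (rule ph_mult)
  also have "[ph (zs m n) * ph (zs m n ^ j) = ph (zs m n) * ph (zs m n) ^ j] (mod int p)"
    by (rule cong_scalar_left[OF Suc.IH])
  finally show ?case by simp
qed

lemma ph_mult_dvd: "int p dvd ph (zs m n * zs k l) \<longleftrightarrow> int p dvd ph (zs m n) \<or> int p dvd ph (zs k l)"
  using ph_mult[of m n k l] prime_int by (metis cong_dvd_iff prime_dvd_mult_iff)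

text \<open>The localization of Z[s] at pi.\<close>
definition V :: "quad set" where
  "V = {a. \<exists>m n k l. \<not> int p dvd ph (zs k l) \<and> a * zs k l = zs m n}"

lemma V_I: "a * zs k l = zs m n \<Longrightarrow> \<not> int p dvd ph (zs k l) \<Longrightarrow> a \<in> V"
  by (auto simp: V_def)

lemma zs_V: "zs m n \<in> V"
  by (rule V_I[of _ 1 0 m n]) (use p in \<open>auto simp: zs_simps\<close>)

lemma zs_nonzero: "\<not> int p dvd ph (zs k l) \<Longrightarrow> zs k l \<noteq> 0"
  by (auto simp: zs_simps)

lemma pi_divides:
  assumes "int p dvd ph (zs m n)"
  shows "\<exists>m' n'. zs m n = zs x y * zs m' n'"
proof -
  have "m * y - n * x = y * (m + n * r) - n * (x + y * r)" by (simp add: algebra_simps power2_eq_square)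
  also have "int p dvd \<dots>" using assms r by (simp add: dvd_diff dvd_mult)
  finally have 1: "int p dvd m * y - n * x" .
  have "y * (m * x + 7 * n * y) = x * (m * y - n * x) + n * int p" unfolding p_norm by (simp add: algebra_simps power2_eq_square)
  also have "int p dvd \<dots>" using 1 by simp
  finally have 2: "int p dvd m * x + 7 * n * y" using y_not_dvd prime_int by (simp add: prime_dvd_mult_iff)
  obtain n' where n': "m * y - n * x = int p * n'" using 1 by (elim dvdE)
  obtain m' where m': "m * x + 7 * n * y = int p * m'" using 2 by (elim dvdE)
  have "int p * (x * m' + 7 * y * n') = x * (m * x + 7 * n * y) + 7 * y * (m * y - n * x)"
    unfolding m' n' by (simp add: algebra_simps power2_eq_square)
  also have "\<dots> = int p * m" unfolding p_norm by (simp add: algebra_simps power2_eq_square)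
  finally have a: "m = x * m' - 7 * y * (- n')" using p by simp
  have "int p * (y * m' - x * n') = y * (m * x + 7 * n * y) - x * (m * y - n * x)"
    unfolding m' n' by (simp add: algebra_simps power2_eq_square)
  also have "\<dots> = int p * n" unfolding p_norm by (simp add: algebra_simps power2_eq_square)
  finally have b: "n = x * (- n') + y * m'" using p by simp
  show ?thesis using a b by (intro exI[of _ m'] exI[of _ "- n'"]) (simp add: zs_simps)
qed

text \<open>Divide by pi as long as the reduction vanishes; each division lowers the norm by the factor
  p.\<close>
lemma zs_pi_decomposition:
  "zs m n \<noteq> 0 \<Longrightarrow> \<exists>j k l. zs m n = zs x y ^ j * zs k l \<and> \<not> int p dvd ph (zs k l)"
proof (induction "nat (m ^ 2 + 7 * n ^ 2)" arbitrary: m n rule: less_induct)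
  case less
  show ?case
  proof (cases "int p dvd ph (zs m n)")
    case False
    thus ?thesis by (intro exI[of _ 0] exI[of _ m] exI[of _ n]) simp
  next
    case True
    then obtain m' n' where eq: "zs m n = zs x y * zs m' n'" using pi_divides by blast
    hence ne: "zs m' n' \<noteq> 0" using less.prems by auto
    have "m = x * m' - 7 * y * n'" "n = x * n' + y * m'" using eq by (simp_all add: zs_simps)
    note e = this
    have "m ^ 2 + 7 * n ^ 2 = int p * (m' ^ 2 + 7 * n' ^ 2)"
      unfolding p_norm e by (simp add: algebra_simps power2_eq_square)
    moreover have "m' ^ 2 + 7 * n' ^ 2 > 0"
      using ne by (cases "m' = 0") (auto simp: zs_simps add_pos_nonneg)
    ultimately have "m' ^ 2 + 7 * n' ^ 2 < m ^ 2 + 7 * n ^ 2" using p by simp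
    hence "nat (m' ^ 2 + 7 * n' ^ 2) < nat (m ^ 2 + 7 * n ^ 2)"
      using \<open>m' ^ 2 + 7 * n' ^ 2 > 0\<close> by simp
    from less.hyps[OF this ne] obtain j k l where
      jkl: "zs m' n' = zs x y ^ j * zs k l" "\<not> int p dvd ph (zs k l)" by blast
    show ?thesis using jkl eq by (intro exI[of _ "Suc j"] exI[of _ k] exI[of _ l]) simp
  qed
qed

sublocale residue_ring_p V "zs x y" "zs x (- y)" p
proof
  show "1 \<in> V" using zs_V[of 1 0] by (simp add: zs_simps)
  show "zs x y \<in> V" "zs x (- y) \<in> V" by (rule zs_V)+
  show "prime p" "odd p" using p prime_odd_nat[of p] by auto
  show "of_nat p = zs x y * zs x (- y)"
    using p_norm by (simp add: zs_simps power2_eq_square)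
next
  fix a b assume "a \<in> V" "b \<in> V"
  then obtain m n k l m' n' k' l' where 1: "\<not> int p dvd ph (zs k l)" "a * zs k l = zs m n"
    and 2: "\<not> int p dvd ph (zs k' l')" "b * zs k' l' = zs m' n'" by (auto simp: V_def)
  have ph: "\<not> int p dvd ph (zs k l * zs k' l')" using 1 2 ph_mult_dvd by simp
  obtain k2 l2 where kl: "zs k l * zs k' l' = zs k2 l2" by (simp add: zs_simps)
  have "(a + b) * zs k2 l2 = (a * zs k l) * zs k' l' + (b * zs k' l') * zs k l"
    unfolding kl[symmetric] by (simp add: algebra_simps)
  then obtain m2 n2 where "(a + b) * zs k2 l2 = zs m2 n2" unfolding 1 2 by (simp add: zs_simps)
  thus "a + b \<in> V" using ph unfolding kl by (rule V_I)
  have "(a * b) * zs k2 l2 = (a * zs k l) * (b * zs k' l')"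
    unfolding kl[symmetric] by (simp add: algebra_simps)
  then obtain m2 n2 where "(a * b) * zs k2 l2 = zs m2 n2" unfolding 1 2 by (simp add: zs_simps)
  thus "a * b \<in> V" using ph unfolding kl by (rule V_I)
next
  fix a assume "a \<in> V"
  then obtain m n k l where 1: "\<not> int p dvd ph (zs k l)" "a * zs k l = zs m n" by (auto simp: V_def)
  have "(- a) * zs k l = zs (- m) (- n)" using 1(2) by (simp flip: zs_simps(3))
  thus "- a \<in> V" using 1(1) by (rule V_I)
next
  show "inverse (zs x y) \<notin> V"
  proof
    assume "inverse (zs x y) \<in> V"
    then obtain m n k l where 1: "\<not> int p dvd ph (zs k l)" "inverse (zs x y) * zs k l = zs m n"
      by (auto simp: V_def)
    have "zs x y \<noteq> 0" using y_not_dvd by (auto simp: zs_simps)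
    hence "zs k l = zs x y * zs m n" using 1(2) by (simp add: field_simps)
    hence "int p dvd ph (zs k l)" using ph_mult_dvd[of x y m n] r by simp
    thus False using 1 by simp
  qed
next
  fix a :: quad assume a: "a \<noteq> 0"
  obtain m n N where N: "N > 0" "a * of_int N = zs m n" using quad_as_zs_fraction by blast
  have "a * of_int N \<noteq> 0" using a N(1) by simp
  hence "zs m n \<noteq> 0" "zs N 0 \<noteq> 0" using N by (simp_all add: zs_simps)
  then obtain j k l i k' l' where 1: "zs m n = zs x y ^ j * zs k l" "\<not> int p dvd ph (zs k l)"
    and 2: "zs N 0 = zs x y ^ i * zs k' l'" "\<not> int p dvd ph (zs k' l')"
    using zs_pi_decomposition by meson
  note nz = zs_nonzero[OF 1(2)] zs_nonzero[OF 2(2)]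
  define u where "u = zs k l / zs k' l'"
  have "u \<in> V" using 2(2) nz by (intro V_I[of _ k' l' k l]) (auto simp: u_def)
  moreover have "inverse u \<in> V" using 1(2) nz by (intro V_I[of _ k l k' l']) (auto simp: u_def)
  moreover have "a * zs x y ^ i = u * zs x y ^ j"
    using N(2) 1(1) 2(1) nz by (simp add: u_def zs_simps(5) field_simps)
  ultimately show "\<exists>i j u. u \<in> V \<and> inverse u \<in> V \<and> a * zs x y ^ i = u * zs x y ^ j" by blast
next
  fix a assume "a \<in> V"
  then obtain m n k l where 1: "\<not> int p dvd ph (zs k l)" "a * zs k l = zs m n" by (auto simp: V_def)
  have nz: "zs k l \<noteq> 0" using 1(1) by (rule zs_nonzero)
  obtain m1 n1 where mn: "zs m n ^ p = zs m1 n1" using zs_power by blast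
  obtain k1 l1 where kl: "zs k l ^ p = zs k1 l1" using zs_power by blast
  have fermat: "[ph (zs i j ^ p) = ph (zs i j)] (mod int p)" for i j
  proof -
    have "[ph (zs i j) ^ p = ph (zs i j)] (mod int p)"
    proof (cases "int p dvd ph (zs i j)")
      case True
      moreover have "int p dvd ph (zs i j) ^ p" using True p by (simp add: dvd_power_same dvd_trans dvd_power)
      ultimately show ?thesis by (simp add: cong_iff_dvd_diff dvd_diff)
    next
      case False
      have "[ph (zs i j) ^ (p - 1) = 1] (mod int p)"
      proof -
        define a where "a = nat (ph (zs i j) mod int p)"
        have a: "int a = ph (zs i j) mod int p" using p by (simp add: a_def)
        have c: "[int a = ph (zs i j)] (mod int p)" unfolding a by (simp add: cong_def)
        hence "\<not> p dvd a" using False cong_dvd_iff[OF c] by (metis cong_dvd_iff cong_sym dvd_0_right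
            cong_0_iff cong_trans int_dvd_int_iff)
        hence "[a ^ (p - 1) = 1] (mod p)" using p by (intro fermat_theorem)
        hence "[int a ^ (p - 1) = 1] (mod int p)" by (metis cong_int_iff of_nat_1 of_nat_power)
        moreover have "[int a ^ (p - 1) = ph (zs i j) ^ (p - 1)] (mod int p)" using c by (rule cong_pow)
        ultimately show ?thesis using cong_sym cong_trans by blast
      qed
      hence "[ph (zs i j) * ph (zs i j) ^ (p - 1) = ph (zs i j) * 1] (mod int p)" by (rule cong_scalar_left)
      thus ?thesis using p by (simp flip: power_Suc)
    qed
    thus ?thesis using ph_power cong_trans by blast
  qed
  have "[ph (zs m1 n1 * zs k l) = ph (zs m1 n1) * ph (zs k l)] (mod int p)" by (rule ph_mult)
  moreover have "[ph (zs m1 n1) * ph (zs k l) = ph (zs m n) * ph (zs k l)] (mod int p)"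
    using fermat[of m n] unfolding mn by (rule cong_scalar_right)
  moreover have "[ph (zs m n * zs k1 l1) = ph (zs m n) * ph (zs k1 l1)] (mod int p)" by (rule ph_mult)
  moreover have "[ph (zs m n) * ph (zs k1 l1) = ph (zs m n) * ph (zs k l)] (mod int p)"
    using fermat[of k l] unfolding kl by (rule cong_scalar_left)
  ultimately have "[ph (zs m1 n1 * zs k l) = ph (zs m n * zs k1 l1)] (mod int p)"
    by (meson cong_sym cong_trans)
  hence "int p dvd ph (zs m1 n1 * zs k l) - ph (zs m n * zs k1 l1)"
    by (simp add: cong_iff_dvd_diff)
  also have "ph (zs m1 n1 * zs k l) - ph (zs m n * zs k1 l1) = ph (zs m1 n1 * zs k l - zs m n * zs k1 l1)"
    by (simp add: zs_simps algebra_simps)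
  finally have d: "int p dvd ph (zs m1 n1 * zs k l - zs m n * zs k1 l1)" .
  obtain i0 j0 where ij0: "zs m1 n1 * zs k l - zs m n * zs k1 l1 = zs i0 j0" by (simp add: zs_simps)
  obtain i j where ij: "zs m1 n1 * zs k l - zs m n * zs k1 l1 = zs x y * zs i j"
    using pi_divides[OF d[unfolded ij0]] unfolding ij0 by blast
  have e: "a = zs m n / zs k l" using 1(2) nz by (simp add: field_simps)
  define b where "b = zs i j / (zs k l ^ p * zs k l)"
  have "a ^ p - a = (zs m n ^ p * zs k l - zs m n * zs k l ^ p) / (zs k l ^ p * zs k l)"
    using nz by (simp add: e power_divide field_simps)
  also have "\<dots> = zs x y * b" unfolding mn kl ij b_def by simp
  finally have eq: "a ^ p - a = zs x y * b" .
  obtain k2 l2 where kl2: "zs k l ^ p * zs k l = zs k2 l2" unfolding kl by (simp add: zs_simps)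
  have "\<not> int p dvd ph (zs k2 l2)"
    using fermat[of k l] 1(1) unfolding kl2[symmetric] kl by (simp add: ph_mult_dvd cong_dvd_iff)
  hence "b \<in> V" using zs_nonzero by (intro V_I[of _ k2 l2 i j]) (auto simp: b_def kl2)
  with eq show "\<exists>b\<in>V. a ^ p - a = zs x y * b" by blast
qed

lemma alpha_V: "alpha \<in> V"
  by (rule V_I[of _ 2 0 1 1])
     (use p in \<open>auto simp: zs_def alpha_def quad_eq_iff ph_def dest: zdvd_imp_le\<close>)

lemma two_notin_M: "(2 :: quad) \<notin> M" and three_notin_M: "(3 :: quad) \<notin> M"
  using of_nat_in_M_iff[of 2] of_nat_in_M_iff[of 3] p by (auto dest: dvd_imp_le)

lemma sixteen_notin_M: "(16 :: quad) \<notin> M"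
  using M_power[of 2 4] two_notin_M V_of_nat[of 2] by auto

lemma alpha_notin_M: "alpha \<notin> M"
proof
  assume "alpha \<in> M"
  hence "alpha * (1 - alpha) \<in> M" by (intro M_mult V_diff V_1 alpha_V)
  also have "alpha * (1 - alpha) = 2" using alpha_square by Groebner_Basis.algebra
  finally show False using two_notin_M by simp
qed

text \<open>The element x + ys is (x - y) + 2y alpha, an odd endomorphism of degree p because x and y
  have different parity. As A is modulo pi the conjugate of pi up to sign, A^2 agrees modulo pi with the
  square of the trace 2x.\<close>
theorem hasse_invariant_split:
  "coeff (cm.fpoly ^ ((p - 1) div 2)) (p - 1) ^ 2 - of_int (4 * x ^ 2) \<in> M"
proof -
  define lam where "lam = 3 * alpha - 1"
  define A where "A = coeff (cm.fpoly ^ ((p - 1) div 2)) (p - 1)"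
  have three: "(3 :: quad) \<in> V" using V_of_nat[of 3] by simp
  have lam_V: "lam \<in> V" unfolding lam_def by (intro V_diff V_mult V_1 alpha_V three)
  have eq16: "lam * (1 - lam) = 16" unfolding lam_def using alpha_square by Groebner_Basis.algebra
  have lam_M: "lam \<notin> M" and lam_M': "lam - 1 \<notin> M"
  proof -
    show "lam \<notin> M" using M_mult[of lam "1 - lam"] eq16 sixteen_notin_M lam_V by (auto intro: V_diff V_1)
    have "- lam * (lam - 1) = 16" using eq16 by (simp add: algebra_simps)
    thus "lam - 1 \<notin> M" using M_mult'[OF V_minus[OF lam_V], of "lam - 1"] sixteen_notin_M by auto
  qed
  have lam_M'': "lam + 1 \<notin> M"
  proof
    assume "lam + 1 \<in> M"
    hence "3 * alpha \<in> M" by (simp add: lam_def)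
    thus False using M_prime[OF three alpha_V] three_notin_M alpha_notin_M by blast
  qed
  have "odd (int p)" using odd_p by simp
  hence "odd (x ^ 2 + 7 * y ^ 2)" unfolding p_norm[symmetric] .
  hence odd_xy: "odd (x - y)" by simp
  have even: "even (2 * y)" by simp
  obtain N D A0 B0 A1 B1 where ND:
    "D \<noteq> 0" "degree N = Suc (degree D)"
    "int (degree N) = (x - y) ^ 2 + (x - y) * (2 * y) + 2 * (2 * y) ^ 2"
    "(pderiv N * D - N * pderiv D) ^ 2 * cm.fpoly =
       smult ((of_int (x - y) + of_int (2 * y) * alpha) ^ 2) (D * N * (N + D) * (N + smult (3 * alpha - 1) D))"
    and cls: "A0 \<noteq> 0" "B0 \<noteq> 0" "[:0, 1:] * A0 ^ 2 * D = B0 ^ 2 * N"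
    "A1 \<noteq> 0" "B1 \<noteq> 0" "[:1, 1:] * A1 ^ 2 * D = B1 ^ 2 * (N + D)"
    by (rule cm.multiplication_polynomials[OF odd_xy even])
  have "int (degree N) = int p" unfolding ND(3) p_norm by (simp add: algebra_simps power2_eq_square)
  hence deg: "degree N = p" "degree D < p" using ND(2) by simp_all
  have ode: "(pderiv N * D - N * pderiv D) ^ 2 * ([:0, 1:] * [:1, 1:] * [:lam, 1:]) =
      smult (zs x y ^ 2) (D * N * (N + D) * (N + smult lam D))"
    using ND(4) unfolding cm.fpoly_def lam_def zs_alpha .
  have "zs x (- y) - A \<in> M \<or> zs x (- y) + A \<in> M"
    using hasse_invariant_mod_pi[OF lam_V lam_M lam_M'' lam_M' ND(1) deg ode cls]
    unfolding A_def cm.fpoly_def lam_def .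
  moreover have AV: "A \<in> V"
  proof -
    have "cm.fpoly = [:0, 1:] * [:1, 1:] * [:lam, 1:]" by (simp only: cm.fpoly_def lam_def)
    hence "cm.fpoly ^ ((p - 1) div 2) \<in> PV"
      by (simp only:) (intro PV_power PV_mult PV_pCons V_0 V_1 PV_0 lam_V)
    thus ?thesis by (simp add: A_def PV_def)
  qed
  ultimately have "(zs x (- y) - A) * (zs x (- y) + A) \<in> M"
    using M_mult M_mult' V_diff[OF pi'_V AV] V_add[OF pi'_V AV] by blast
  moreover have "zs x y * (zs x y + 2 * zs x (- y)) \<in> M"
    using V_of_nat[of 2] by (auto simp: M_def intro!: bexI[of _ "zs x y + 2 * zs x (- y)"] V_add V_mult pi_V pi'_V)
  ultimately have "- (zs x (- y) - A) * (zs x (- y) + A) - zs x y * (zs x y + 2 * zs x (- y)) \<in> M"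
    using M_minus M_diff by (metis minus_mult_left)
  also have "- (zs x (- y) - A) * (zs x (- y) + A) - zs x y * (zs x y + 2 * zs x (- y))
      = A ^ 2 - (zs x y + zs x (- y)) ^ 2"
    by (simp add: algebra_simps power2_eq_square)
  also have "zs x y + zs x (- y) = of_int (2 * x)" by (simp add: zs_def quad_eq_iff)
  finally show ?thesis by (simp add: A_def power2_eq_square)
qed

end

section \<open>Reduction when -7 is a non-residue\<close>

text \<open>The ring R and the ideal J are subsets of an ambient ring, so that the statement covers both
  elements of V and polynomials over V.\<close>
lemma freshman_dream_ideal:
  fixes a b :: "'b::comm_ring_1" and R J :: "'b set"
  assumes "prime p" and R: "\<And>n. of_nat n \<in> R" "\<And>x y. x \<in> R \<Longrightarrow> y \<in> R \<Longrightarrow> x * y \<in> R"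
    and J: "\<And>x. x \<in> R \<Longrightarrow> of_nat p * x \<in> J" "0 \<in> J" "\<And>x y. x \<in> J \<Longrightarrow> y \<in> J \<Longrightarrow> x + y \<in> J"
    and ab: "a \<in> R" "b \<in> R"
  shows "(a + b) ^ p - a ^ p - b ^ p \<in> J"
proof -
  have p: "p > 0" using assms(1) prime_gt_0_nat by blast
  have pow: "x ^ n \<in> R" if "x \<in> R" for x n
    by (induction n) (use that R(1)[of 1] R(2) in auto)
  have "(a + b) ^ p = (\<Sum>k\<le>p. of_nat (p choose k) * a ^ k * b ^ (p - k))"
    by (rule binomial_ring)
  also have "{..p} = insert 0 (insert p {0<..<p})" using p by auto
  finally have eq: "(a + b) ^ p - a ^ p - b ^ p = (\<Sum>k\<in>{0<..<p}. of_nat (p choose k) * a ^ k * b ^ (p - k))"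
    using p by simp
  have "of_nat (p choose k) * a ^ k * b ^ (p - k) \<in> J" if "k \<in> {0<..<p}" for k
  proof -
    have "p dvd (p choose k)" using that assms(1) by (intro dvd_choose_prime) auto
    then obtain m where "p choose k = p * m" by (elim dvdE)
    hence "of_nat (p choose k) * a ^ k * b ^ (p - k) = of_nat p * (of_nat m * a ^ k * b ^ (p - k))"
      by (simp add: mult.assoc)
    also have "\<dots> \<in> J" by (intro J R pow ab)
    finally show ?thesis .
  qed
  hence "(\<Sum>k\<in>S. of_nat (p choose k) * a ^ k * b ^ (p - k)) \<in> J" if "S \<subseteq> {0<..<p}" for S
    using that by (induction S rule: infinite_finite_induct) (auto intro: J)
  thus ?thesis unfolding eq by blast
qed

text \<open>d^j F(n/d), the numerator of F(n/d) over the common denominator d^j.\<close>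
definition homogenize :: "nat \<Rightarrow> 'a::comm_ring_1 poly \<Rightarrow> 'a poly \<Rightarrow> 'a poly \<Rightarrow> 'a poly" where
  "homogenize j n d F = (\<Sum>k\<le>j. smult (coeff F k) (n ^ k * d ^ (j - k)))"

lemma homogenize_linear:
  assumes "degree F \<le> j"
  shows "homogenize (Suc j) n d ([:c, 1:] * F) = (n + smult c d) * homogenize j n d F"
proof -
  have "homogenize (Suc j) n d (pCons 0 F) = n * homogenize j n d F"
    unfolding homogenize_def by (subst sum.atMost_Suc_shift) (simp add: sum_distrib_left mult_ac)
  moreover have "homogenize (Suc j) n d (smult c F) = smult c d * homogenize j n d F"
  proof -
    have "coeff F (Suc j) = 0" using assms by (simp add: coeff_eq_0)
    hence "homogenize (Suc j) n d (smult c F) = (\<Sum>k\<le>j. smult (c * coeff F k) (n ^ k * d ^ (Suc j - k)))"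
      by (simp add: homogenize_def)
    also have "\<dots> = smult c d * homogenize j n d F"
      unfolding homogenize_def sum_distrib_left by (rule sum.cong) (auto simp: Suc_diff_le mult_ac)
    finally show ?thesis .
  qed
  moreover have "homogenize (Suc j) n d ([:c, 1:] * F) =
      homogenize (Suc j) n d (smult c F) + homogenize (Suc j) n d (pCons 0 F)"
    by (simp add: homogenize_def smult_add_left sum.distrib)
  ultimately show ?thesis by (simp add: algebra_simps)
qed

lemma smult_rearrange:
  fixes a b u v x :: "'a::comm_ring_1 poly"
  shows "a ^ 2 * (u * v) * b ^ 2 * smult (k ^ 2) x = (smult k (a * b)) ^ 2 * (x * (u * v))"
  by (simp add: power2_eq_square mult_ac)

text \<open>A ring V with an ideal I containing p, in which the integers prime to p are units. Two kinds
  of ideal occur: pV, for the rational sums and for inert primes, and the maximal ideal generated by pi,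
  for split primes.\<close>
locale residue_structure = coefficient_ring V for V :: "'a::field_char_0 set" +
  fixes I :: "'a set" and p :: nat
  assumes I_0: "0 \<in> I" and I_add: "a \<in> I \<Longrightarrow> b \<in> I \<Longrightarrow> a + b \<in> I"
    and I_mult: "a \<in> I \<Longrightarrow> b \<in> V \<Longrightarrow> a * b \<in> I"
    and p_in_I: "of_nat p \<in> I"
    and inverse_V: "\<not> int p dvd n \<Longrightarrow> inverse (of_int n) \<in> V"
    and prime_p: "prime p" and p_gt_7: "p > 7"
begin

lemma I_mult': "b \<in> V \<Longrightarrow> a \<in> I \<Longrightarrow> b * a \<in> I" using I_mult[of a b] by (simp add: mult.commute)
lemma I_minus: "a \<in> I \<Longrightarrow> - a \<in> I" using I_mult[of a "- 1"] V_minus[OF V_1] by simp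
lemma I_diff: "a \<in> I \<Longrightarrow> b \<in> I \<Longrightarrow> a - b \<in> I" using I_add[of a "- b"] I_minus by simp
lemma I_sum: "(\<And>i. i \<in> A \<Longrightarrow> f i \<in> I) \<Longrightarrow> sum f A \<in> I"
  by (induction A rule: infinite_finite_induct) (auto intro: I_0 I_add)
lemma I_cancel_int:
  assumes "\<not> int p dvd n" "of_int n * a \<in> I" shows "a \<in> I"
proof -
  have "n \<noteq> 0" using assms by auto
  hence eq: "inverse (of_int n) * (of_int n * a) = a" by (simp add: mult.assoc[symmetric])
  show ?thesis using I_mult'[OF inverse_V[OF assms(1)] assms(2)] unfolding eq .
qed
lemma I_of_int: "int p dvd n \<Longrightarrow> of_int n \<in> I"
  using I_mult[OF p_in_I V_of_int] by (auto elim!: dvdE)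

lemma freshman_V: "a \<in> V \<Longrightarrow> b \<in> V \<Longrightarrow> (a + b) ^ p - a ^ p - b ^ p \<in> I"
  by (rule freshman_dream_ideal[OF prime_p, of V])
     (auto intro: V_of_nat V_mult I_mult I_add I_0 p_in_I)

definition PI :: "'a poly set" where "PI = {F. \<forall>i. coeff F i \<in> I}"

lemma PI_mult: "F \<in> PI \<Longrightarrow> G \<in> PV \<Longrightarrow> F * G \<in> PI"
  by (auto simp: PV_def PI_def coeff_mult intro!: I_sum I_mult)
lemma freshman_PV:
  assumes "F \<in> PV" "G \<in> PV" shows "(F + G) ^ p - F ^ p - G ^ p \<in> PI"
proof (rule freshman_dream_ideal[OF prime_p _ _ _ _ _ assms])
  show "of_nat n \<in> PV" for n by (rule PV_of_nat)
  show "x * y \<in> PV" if "x \<in> PV" "y \<in> PV" for x y using that by (rule PV_mult)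
  show "0 \<in> PI" by (simp add: PI_def I_0)
  show "x + y \<in> PI" if "x \<in> PI" "y \<in> PI" for x y using that by (simp add: PI_def I_add)
  show "of_nat p * x \<in> PI" if "x \<in> PV" for x
    using that by (auto simp: PI_def PV_def of_nat_poly intro: I_mult p_in_I)
qed

end

locale cm_residue = residue_structure V I p + cm_curve al
  for V I :: "'a::{field_char_0, field_gcd} set" and p :: nat and al :: 'a +
  assumes al_V: "al \<in> V"
begin

definition h :: nat where "h = (p - 1) div 2"

lemma p_eq_h: "p = Suc (2 * h)"
proof -
  have "odd p" using prime_odd_nat[OF prime_p] p_gt_7 by simp
  thus ?thesis by (auto elim!: oddE simp: h_def)
qed

definition hasse :: 'a where "hasse = coeff (fpoly ^ h) (2 * h)"

lemma hasse_V: "hasse \<in> V"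
proof -
  have "fpoly ^ h \<in> PV" unfolding fpoly_def
    by (intro PV_power PV_mult PV_pCons PV_0 V_0 V_1 V_diff V_mult V_numeral al_V)
  thus ?thesis by (simp add: hasse_def PV_def)
qed

text \<open>Let n/d be the action of multiplication by al, with n(n + d)(n + lam d) d = (al q)^2 f. The
  power h of this identity, multiplied by al q, gives (al q)^p f^h on the right and a sum over k of terms
  n^k d^(2p-2-k) q on the left, weighted by the coefficients of f^h. Since q is x n' - n, the coefficient
  of x^(3p-1) in the k-th term is divisible by p unless k = p - 1. Hence both sides reduce to a power of
  al times the Hasse invariant: al^(2p-1) on the left, al^p on the right.\<close>
lemma hasse_frobenius: "hasse * (al ^ p - al) \<in> I"
proof -
  define H where "H = h"
  have ph: "p = Suc (2 * H)" unfolding H_def by (rule p_eq_h)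
  define lam B where "lam = 3 * al - 1" and "B = - 1 - al"
  have B2: "B ^ 2 = lam" unfolding B_def lam_def using al by Groebner_Basis.algebra
  define n d q where "n = [:lam, - 2 * B, 1:]" and "d = [:0, al ^ 2:]" and "q = [:- lam, 0, 1:]"
  define f where "f = fpoly"
  have f: "f = [:0, 1:] * ([:1, 1:] * [:lam, 1:])" by (simp add: f_def fpoly_def lam_def)
  have degf: "degree (f ^ k) \<le> 3 * k" for k
  proof -
    have "degree f \<le> 3" unfolding f by simp
    thus ?thesis using degree_power_le[of f k] by (meson le_trans mult_le_mono1)
  qed
  have hom: "homogenize (3 * k) n d (f ^ k) = (n * (n + d) * (n + smult lam d)) ^ k" for k
  proof (induction k)
    case 0
    show ?case by (simp add: homogenize_def)
  next
    case (Suc k)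
    let ?F = "f ^ k"
    have 1: "degree ([:lam, 1:] * ?F) \<le> Suc (3 * k)" 
      using degree_mult_le[of "[:lam, 1:]" ?F] degf[of k] by simp
    have 2: "degree ([:1, 1:] * ([:lam, 1:] * ?F)) \<le> Suc (Suc (3 * k))"
      using degree_mult_le[of "[:1, 1:]" "[:lam, 1:] * ?F"] 1 by simp
    have "homogenize (3 * Suc k) n d (f ^ Suc k) =
        homogenize (Suc (Suc (Suc (3 * k)))) n d ([:0, 1:] * ([:1, 1:] * ([:lam, 1:] * ?F)))"
      unfolding power_Suc f by (simp only: mult.assoc) (simp add: numeral_eq_Suc)
    also have "\<dots> = (n + smult 0 d) * ((n + smult 1 d) * ((n + smult lam d) * homogenize (3 * k) n d ?F))"
      by (simp only: homogenize_linear[OF 2] homogenize_linear[OF 1] homogenize_linear[OF degf])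
    finally show ?case unfolding Suc.IH by (simp add: mult_ac)
  qed
  have ident: "n * (n + d) * (n + smult lam d) * d = (smult al q) ^ 2 * f"
  proof -
    have e: "n + d = [:1, 1:] * [:lam, 1:]" "n + smult lam d = [:lam, 2 * B, 1:]"
      "n = [:- B, 1:] ^ 2" "q = [:- B, 1:] * [:B, 1:]" "[:lam, 2 * B, 1:] = [:B, 1:] ^ 2"
    proof -
      show "n + d = [:1, 1:] * [:lam, 1:]"
        unfolding n_def d_def using al by (simp add: B_def lam_def)
      have "lam * al ^ 2 = 4 * B" unfolding lam_def B_def using al by Groebner_Basis.algebra
      thus "n + smult lam d = [:lam, 2 * B, 1:]" by (simp add: n_def d_def)
    qed (simp_all add: n_def q_def power2_eq_square B2[symmetric])
    have d: "d = smult (al ^ 2) [:0, 1:]" by (simp add: d_def)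
    show ?thesis unfolding e(1,2,5) unfolding e(3,4) f d
      by (rule smult_rearrange)
  qed
  have key: "(\<Sum>k\<le>3*H. smult (coeff (f ^ H) k) (n ^ k * d ^ (4 * H - k) * smult al q)) = (smult al q) ^ p * f ^ H"
  proof -
    have "(\<Sum>k\<le>3*H. smult (coeff (f ^ H) k) (n ^ k * d ^ (4 * H - k) * smult al q)) =
        homogenize (3 * H) n d (f ^ H) * d ^ H * smult al q"
      unfolding homogenize_def sum_distrib_right
    proof (rule sum.cong)
      fix k assume "k \<in> {..3 * H}"
      hence "4 * H - k = (3 * H - k) + H" by simp
      thus "smult (coeff (f ^ H) k) (n ^ k * d ^ (4 * H - k) * smult al q) =
         smult (coeff (f ^ H) k) (n ^ k * d ^ (3 * H - k)) * d ^ H * smult al q"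
        by (simp add: power_add mult_ac)
    qed simp
    also have "\<dots> = (n * (n + d) * (n + smult lam d) * d) ^ H * smult al q"
      unfolding hom by (simp add: power_mult_distrib mult_ac)
    also have "\<dots> = (smult al q) ^ p * f ^ H"
      unfolding ident ph by (simp add: power_mult_distrib mult_ac flip: power_mult)
    finally show ?thesis .
  qed
  have lamV: "lam \<in> V" and BV: "B \<in> V" unfolding lam_def B_def
    by (intro V_diff V_mult V_numeral al_V V_1 V_minus)+
  have fV: "f ^ k \<in> PV" for k unfolding f
    by (intro PV_power PV_mult PV_pCons PV_0 V_0 V_1 lamV)
  have nV: "n ^ k \<in> PV" for k unfolding n_def
    by (intro PV_power PV_pCons PV_0 V_1 lamV V_mult V_minus V_numeral BV)
  have coeffV: "coeff (f ^ H) k \<in> V" for k using fV by (simp add: PV_def)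
  have summand: "coeff (n ^ k * d ^ (4 * H - k) * smult al q) (3 * p - 1) =
      (al ^ 2) ^ (4 * H - k) * al * coeff (n ^ k * q) (p + 1 + k)" if k: "k \<le> 3 * H" for k
  proof -
    have "d ^ (4 * H - k) = monom ((al ^ 2) ^ (4 * H - k)) (4 * H - k)"
    proof -
      have "d = monom (al ^ 2) 1" by (simp add: d_def monom_Suc monom_0)
      thus ?thesis by (simp add: monom_power)
    qed
    hence eq: "n ^ k * d ^ (4 * H - k) * smult al q =
        monom ((al ^ 2) ^ (4 * H - k)) (4 * H - k) * smult al (n ^ k * q)" by (simp add: mult_ac)
    have idx: "3 * p - 1 = (4 * H - k) + (p + 1 + k)" using k ph by simp
    show ?thesis unfolding eq idx coeff_monom_mult coeff_smult by (simp add: mult.assoc)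
  qed
  have small: "coeff (n ^ k * q) (p + 1 + k) \<in> I" if k: "k \<le> 3 * H" "k \<noteq> 2 * H" for k
  proof -
    define j where "j = p + 1 + k"
    have "pCons 0 (pderiv n) - n = q" by (simp add: n_def q_def pderiv_pCons)
    hence "of_nat (Suc k) * (n ^ k * q) = of_nat (Suc k) * n ^ k * pCons 0 (pderiv n) - of_nat (Suc k) * n ^ Suc k"
      by (simp add: algebra_simps)
    also have "of_nat (Suc k) * n ^ k * pCons 0 (pderiv n) = pCons 0 (pderiv (n ^ Suc k))"
      by (simp add: pderiv_power_Suc of_nat_poly mult_ac del: power_Suc)
    finally have "coeff (of_nat (Suc k) * (n ^ k * q)) j = coeff (pCons 0 (pderiv (n ^ Suc k)) - of_nat (Suc k) * n ^ Suc k) j"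
      by simp
    hence "of_nat (Suc k) * coeff (n ^ k * q) j = of_nat j * coeff (n ^ Suc k) j - of_nat (Suc k) * coeff (n ^ Suc k) j"
      by (simp add: of_nat_poly j_def coeff_pderiv del: power_Suc)
    also have "\<dots> = of_nat p * coeff (n ^ Suc k) j" by (simp add: j_def algebra_simps)
    also have "\<dots> \<in> I" using nV[of "Suc k"] by (intro I_mult p_in_I) (simp add: PV_def)
    finally have "of_int (int (Suc k)) * coeff (n ^ k * q) j \<in> I" by simp
    moreover have "\<not> int p dvd int (Suc k)"
    proof
      assume "int p dvd int (Suc k)"
      hence "p dvd Suc k" by (simp only: int_dvd_int_iff)
      then obtain c where c: "Suc k = p * c" by (elim dvdE)
      have "Suc k < p * 2" using k ph p_gt_7 by simp
      hence "c = 1" using c p_gt_7 by (cases "c = 0") (auto simp del: mult_Suc_right)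
      thus False using c k ph by simp
    qed
    ultimately show ?thesis unfolding j_def using I_cancel_int by blast
  qed
  have lead: "coeff (n ^ (2 * H) * q) (p + 1 + 2 * H) = 1"
  proof -
    have "lead_coeff n = 1" "degree n = 2" by (simp_all add: n_def)
    hence "degree (n ^ (2 * H)) = 4 * H" "lead_coeff (n ^ (2 * H)) = 1"
      by (simp_all only: degree_power_eq lead_coeff_power power_one) (subst degree_power_eq; auto)
    moreover have "degree q = 2" "lead_coeff q = 1" by (simp_all add: q_def)
    moreover have "p + 1 + 2 * H = 4 * H + 2" using ph by simp
    ultimately show ?thesis using coeff_mult_degree_sum[of "n ^ (2 * H)" q] by simp
  qed
  have "coeff ((smult al q) ^ p * f ^ H) (3 * p - 1) =
      (\<Sum>k\<le>3*H. coeff (f ^ H) k * ((al ^ 2) ^ (4 * H - k) * al * coeff (n ^ k * q) (p + 1 + k)))"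
    unfolding key[symmetric] coeff_sum coeff_smult by (rule sum.cong) (simp_all only: summand atMost_iff)
  also have "\<dots> = coeff (f ^ H) (2 * H) * ((al ^ 2) ^ (4 * H - 2 * H) * al * 1) +
     (\<Sum>k\<in>{..3*H} - {2*H}. coeff (f ^ H) k * ((al ^ 2) ^ (4 * H - k) * al * coeff (n ^ k * q) (p + 1 + k)))"
  proof -
    have "2 * H \<in> {..3 * H}" by simp
    from sum.remove[OF finite_atMost this] show ?thesis unfolding lead[symmetric] .
  qed
  finally have eq: "coeff ((smult al q) ^ p * f ^ H) (3 * p - 1) =
    coeff (f ^ H) (2 * H) * ((al ^ 2) ^ (4 * H - 2 * H) * al * 1) +
     (\<Sum>k\<in>{..3*H} - {2*H}. coeff (f ^ H) k * ((al ^ 2) ^ (4 * H - k) * al * coeff (n ^ k * q) (p + 1 + k)))" .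
  have "(\<Sum>k\<in>{..3*H} - {2*H}. coeff (f ^ H) k * ((al ^ 2) ^ (4 * H - k) * al * coeff (n ^ k * q) (p + 1 + k))) \<in> I"
    by (intro I_sum I_mult' coeffV V_mult V_power al_V small) auto
  moreover have "coeff (f ^ H) (2 * H) * ((al ^ 2) ^ (4 * H - 2 * H) * al * 1) = hasse * al ^ (4 * H + 1)"
    by (simp add: hasse_def f_def H_def flip: power_mult)
  ultimately have L: "coeff ((smult al q) ^ p * f ^ H) (3 * p - 1) - hasse * al ^ (4 * H + 1) \<in> I"
    unfolding eq by (simp only: add_diff_cancel_left')
  have R: "coeff ((smult al q) ^ p * f ^ H) (3 * p - 1) - hasse * al ^ p \<in> I"
  proof -
    define x2 c where "x2 = (monom 1 2 :: 'a poly)" and "c = [:- lam:]"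
    have q: "q = x2 + c" by (simp add: q_def x2_def c_def monom_altdef numeral_2_eq_2)
    have "x2 \<in> PV" "c \<in> PV"
      using V_0 V_1 V_minus[OF lamV] by (auto simp: PV_def x2_def c_def coeff_pCons split: nat.splits)
    hence "(x2 + c) ^ p - x2 ^ p - c ^ p \<in> PI" by (rule freshman_PV)
    hence "((x2 + c) ^ p - x2 ^ p - c ^ p) * f ^ H \<in> PI" by (rule PI_mult[OF _ fV])
    hence 1: "coeff (((x2 + c) ^ p - x2 ^ p - c ^ p) * f ^ H) (3 * p - 1) \<in> I" by (simp add: PI_def)
    have "x2 ^ p = monom 1 (2 * p)" by (simp add: x2_def monom_power mult.commute)
    moreover have "3 * p - 1 - 2 * p = 2 * H" "2 * p \<le> 3 * p - 1" using ph by simp_all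
    ultimately have 2: "coeff (x2 ^ p * f ^ H) (3 * p - 1) = hasse"
      by (simp add: coeff_monom_mult hasse_def f_def H_def)
    have "c ^ p = [:(- lam) ^ p:]" by (simp add: c_def poly_const_pow)
    moreover have "coeff (f ^ H) (3 * p - 1) = 0"
      by (rule coeff_eq_0) (use degf[of H] ph in simp)
    ultimately have 3: "coeff (c ^ p * f ^ H) (3 * p - 1) = 0" by simp
    have "coeff (q ^ p * f ^ H) (3 * p - 1) - hasse \<in> I"
      using 1 2 3 unfolding q by (simp add: algebra_simps)
    hence "al ^ p * (coeff (q ^ p * f ^ H) (3 * p - 1) - hasse) \<in> I"
      by (intro I_mult' V_power al_V)
    thus ?thesis by (simp add: smult_power algebra_simps)
  qed
  have "hasse * al ^ (4 * H + 1) - hasse * al ^ p \<in> I" using I_diff[OF R L] by simp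
  hence "ab ^ (2 * H) * (hasse * al ^ (4 * H + 1) - hasse * al ^ p) \<in> I"
    by (intro I_mult' V_power V_diff V_1 al_V)
  also have "ab ^ (2 * H) * (hasse * al ^ (4 * H + 1) - hasse * al ^ p) =
      of_int (2 ^ (2 * H)) * (hasse * (al ^ p - al))"
  proof -
    have "ab * al = 2" using al by Groebner_Basis.algebra
    hence m: "ab ^ (2 * H) * al ^ (2 * H) = 2 ^ (2 * H)" by (simp flip: power_mult_distrib)
    have e1: "al ^ (4 * H + 1) = al ^ (2 * H) * al ^ p" unfolding ph by (simp flip: power_add)
    have e2: "al ^ p = al ^ (2 * H) * al" unfolding ph by simp
    have "ab ^ (2 * H) * (hasse * al ^ (4 * H + 1) - hasse * al ^ p) =
       (ab ^ (2 * H) * al ^ (2 * H)) * (hasse * (al ^ p - al))"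
      unfolding e1 by (subst (2) e2) (simp add: algebra_simps)
    thus ?thesis unfolding m by simp
  qed
  finally show ?thesis
  proof (rule I_cancel_int[rotated])
    show "\<not> int p dvd 2 ^ (2 * H)"
    proof
      assume "int p dvd 2 ^ (2 * H)"
      hence "int p dvd 2" using prime_p prime_dvd_power by (metis prime_nat_int_transfer)
      thus False using p_gt_7 zdvd_imp_le by fastforce
    qed
  qed
qed

end

section \<open>Clausen's identity\<close>

text \<open>The coefficients of the two hypergeometric series, F with parameters 1/4, 3/4; 1 and G with
  parameters 1/4, 1/2, 3/4; 1, 1, in the variables 64x and 256x.\<close>
definition clausen_f :: "nat \<Rightarrow> nat" where "clausen_f k = ((4 * k) choose (2 * k)) * ((2 * k) choose k)"
definition clausen_g :: "nat \<Rightarrow> nat" where "clausen_g k = ((4 * k) choose (2 * k)) * ((2 * k) choose k) ^ 2"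

lemma central_binomial_Suc: "Suc n * ((2 * Suc n) choose Suc n) = 2 * (2 * n + 1) * ((2 * n) choose n)"
proof -
  have 1: "Suc n * (Suc (Suc (2 * n)) choose Suc n) = Suc (Suc (2 * n)) * (Suc (2 * n) choose n)"
    by (rule Suc_times_binomial)
  have 2: "Suc n * (Suc (2 * n) choose n) = Suc (2 * n) * ((2 * n) choose n)"
  proof -
    have "Suc (2 * n) choose n = Suc (2 * n) choose Suc n"
      using binomial_symmetric[of n "Suc (2 * n)"] by (simp add: Suc_diff_le)
    thus ?thesis using Suc_times_binomial[of n "2 * n"] by simp
  qed
  have "Suc n * (Suc n * ((2 * Suc n) choose Suc n)) = Suc n * (2 * (2 * n + 1) * ((2 * n) choose n))"
  proof -
    have e: "2 * Suc n = Suc (Suc (2 * n))" by simp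
    have "Suc n * (Suc n * ((2 * Suc n) choose Suc n)) = Suc (Suc (2 * n)) * (Suc n * (Suc (2 * n) choose n))"
      unfolding e 1 by (simp only: mult.left_commute)
    also have "\<dots> = Suc (Suc (2 * n)) * (Suc (2 * n) * ((2 * n) choose n))" by (simp only: 2)
    also have "\<dots> = Suc n * (2 * (2 * n + 1) * ((2 * n) choose n))" by (simp add: algebra_simps)
    finally show ?thesis .
  qed
  thus ?thesis by (simp only: mult_cancel1) simp
qed

lemma clausen_f_Suc: "(n + 1) ^ 2 * clausen_f (Suc n) = 4 * (4 * n + 1) * (4 * n + 3) * clausen_f n"
  and clausen_g_Suc: "(n + 1) ^ 3 * clausen_g (Suc n) = 8 * (4 * n + 1) * (2 * n + 1) * (4 * n + 3) * clausen_g n"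
proof -
  define a b c d e where "a = (2 * n) choose n" and "b = (2 * Suc n) choose Suc n"
    and "c = (4 * n) choose (2 * n)" and "d = (2 * Suc (2 * n)) choose Suc (2 * n)"
    and "e = (4 * Suc n) choose (2 * Suc n)"
  have 1: "(n + 1) * b = 2 * (2 * n + 1) * a" using central_binomial_Suc[of n] by (simp add: a_def b_def)
  have 2: "(2 * n + 1) * d = 2 * (4 * n + 1) * c"
    using central_binomial_Suc[of "2 * n"] by (simp add: c_def d_def)
  have 3: "(2 * n + 2) * e = 2 * (4 * n + 3) * d"
  proof -
    have e': "e = ((2 * Suc (Suc (2 * n))) choose Suc (Suc (2 * n)))"
      unfolding e_def by (rule arg_cong2[where f = binomial]) simp_all
    have "Suc (Suc (2 * n)) * e = 2 * (2 * Suc (2 * n) + 1) * d"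
      unfolding e' d_def by (rule central_binomial_Suc)
    moreover have "Suc (Suc (2 * n)) = 2 * n + 2" "2 * Suc (2 * n) + 1 = 4 * n + 3" by simp_all
    ultimately show ?thesis by (simp only:)
  qed
  have "(2 * n + 1) * ((n + 1) * e) = (4 * n + 3) * ((2 * n + 1) * d)"
    using 3 by (simp add: algebra_simps)
  also have "\<dots> = (4 * n + 3) * (2 * (4 * n + 1) * c)" by (simp only: 2)
  finally have 4: "(2 * n + 1) * ((n + 1) * e) = (4 * n + 3) * (2 * (4 * n + 1) * c)" .
  have f: "clausen_f (Suc n) = e * b" "clausen_f n = c * a" "clausen_g (Suc n) = e * b ^ 2" "clausen_g n = c * a ^ 2"
    by (simp_all only: clausen_f_def clausen_g_def a_def b_def c_def e_def)
  have "(n + 1) ^ 2 * (e * b) = ((n + 1) * e) * ((n + 1) * b)" by (simp only: power2_eq_square mult_ac)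
  also have "\<dots> = ((n + 1) * e) * (2 * (2 * n + 1) * a)" by (simp only: 1)
  also have "\<dots> = 2 * a * ((2 * n + 1) * ((n + 1) * e))" by (simp only: mult_ac)
  also have "\<dots> = 4 * (4 * n + 1) * (4 * n + 3) * (c * a)" unfolding 4 by Groebner_Basis.algebra
  finally show "(n + 1) ^ 2 * clausen_f (Suc n) = 4 * (4 * n + 1) * (4 * n + 3) * clausen_f n" by (simp only: f)
  have "(n + 1) ^ 3 * (e * b ^ 2) = ((n + 1) * e) * ((n + 1) * b) ^ 2"
    by (simp only: power2_eq_square power3_eq_cube mult_ac)
  also have "\<dots> = ((n + 1) * e) * (2 * (2 * n + 1) * a) ^ 2" by (simp only: 1)
  also have "\<dots> = 4 * (2 * n + 1) * a ^ 2 * ((2 * n + 1) * ((n + 1) * e))"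
    by Groebner_Basis.algebra
  also have "\<dots> = 8 * (4 * n + 1) * (2 * n + 1) * (4 * n + 3) * (c * a ^ 2)" unfolding 4 by Groebner_Basis.algebra
  finally show "(n + 1) ^ 3 * clausen_g (Suc n) = 8 * (4 * n + 1) * (2 * n + 1) * (4 * n + 3) * clausen_g n"
    by (simp only: f)
qed

text \<open>The argument x - 64x^2 of the second series in Clausen's identity.\<close>
definition cP :: "'a::field_char_0 fps" where "cP = fps_X - fps_const 64 * fps_X ^ 2"

lemma cP_nth_0: "cP $ 0 = 0" by (simp add: cP_def)

lemma cP_deriv: "fps_deriv cP = 1 - fps_const 128 * fps_X"
  by (simp add: cP_def fps_deriv_power power2_eq_square algebra_simps)

lemma cP_deriv_square: "fps_deriv cP ^ 2 = 1 - fps_const 256 * cP"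
  unfolding cP_deriv cP_def
  by (simp add: power2_eq_square algebra_simps numeral_fps_const flip: fps_const_mult)

lemma cP_mult_nth: "(cP * A) $ Suc n = A $ n - 64 * (if n = 0 then 0 else A $ (n - 1))"
proof -
  have "cP * A = fps_X * A - fps_const 64 * (fps_X * (fps_X * A))"
    by (simp add: cP_def algebra_simps power2_eq_square)
  thus ?thesis by simp
qed

lemma cP_theta_nth: "(cP * fps_deriv A) $ n = of_nat n * A $ n - 64 * of_nat (n - 1) * A $ (n - 1)"
proof (cases n)
  case (Suc m)
  show ?thesis unfolding Suc cP_mult_nth by (cases m) simp_all
qed (simp add: cP_nth_0)

lemma cP_theta_deriv_nth: "fps_deriv (cP * fps_deriv A) $ n =
    of_nat (n + 1) * (of_nat (n + 1) * A $ (n + 1) - 64 * of_nat n * A $ n)"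
  unfolding fps_deriv_nth cP_theta_nth by simp

text \<open>With \<theta> = P d/dx this is the equation \<theta>^3 H = 48 P \<theta> H + 24 \<theta>(P)
  H, divided by P. It is the symmetric square of the equation \<theta>^2 F = 12 P F.\<close>
definition clausen_ode :: "'a::field_char_0 fps \<Rightarrow> bool" where
  "clausen_ode H \<longleftrightarrow> fps_deriv (cP * fps_deriv (cP * fps_deriv H)) =
     fps_const 48 * (cP * fps_deriv H) + fps_const 24 * (fps_deriv cP * H)"

text \<open>The indicial equation at 0 is n^3 = 0, so a solution is determined by its constant
  term.\<close>
lemma clausen_ode_unique:
  fixes A B :: "'a::field_char_0 fps"
  assumes "clausen_ode A" "clausen_ode B" "A $ 0 = B $ 0" shows "A = B"
proof -
  define H where "H = A - B"
  have ode: "clausen_ode H"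
    using assms(1,2) by (simp add: clausen_ode_def H_def algebra_simps)
  have "H $ n = 0" for n
  proof (induction n rule: less_induct)
    case (less n)
    show ?case
    proof (cases n)
      case 0
      thus ?thesis using assms(3) by (simp add: H_def)
    next
      case (Suc m)
      define K where "K = cP * fps_deriv H"
      have z: "H $ i = 0" if "i \<le> m" for i using less Suc that by simp
      have K1: "K $ Suc m = of_nat (m + 1) * H $ Suc m"
        using z by (simp add: K_def cP_theta_nth)
      have K0: "K $ i = 0" if "i \<le> m" for i
        using z that by (simp add: K_def cP_theta_nth)
      have k1: "fps_deriv (cP * fps_deriv K) $ m = of_nat (m + 1) * (of_nat (m + 1) * K $ Suc m)"
        using K0 unfolding cP_theta_deriv_nth by simp
      have k2: "(fps_const 48 * K + fps_const 24 * (fps_deriv cP * H)) $ m = 0"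
        using K0 z by (simp add: fps_mult_nth)
      have "fps_deriv (cP * fps_deriv K) = fps_const 48 * K + fps_const 24 * (fps_deriv cP * H)"
        using ode unfolding clausen_ode_def K_def[symmetric] .
      hence "of_nat (m + 1) * (of_nat (m + 1) * (of_nat (m + 1) * H $ Suc m)) = (0 :: 'a)"
        using k1 k2 unfolding K1 by (simp only:)
      hence "of_nat (m + 1) = (0 :: 'a) \<or> H $ Suc m = 0" by (simp only: mult_eq_0_iff) blast
      moreover have "of_nat (m + 1) \<noteq> (0 :: 'a)" by (simp only: of_nat_eq_0_iff)
      ultimately show ?thesis using Suc by simp
    qed
  qed
  hence "H = 0" by (simp add: fps_eq_iff)
  thus ?thesis by (simp add: H_def)
qed

definition cF :: "'a::field_char_0 fps" where "cF = Abs_fps (\<lambda>k. of_nat (clausen_f k))"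
definition cG :: "'a::field_char_0 fps" where "cG = Abs_fps (\<lambda>k. of_nat (clausen_g k))"

lemma cF_ode: "fps_deriv (cP * fps_deriv cF) = fps_const 12 * (cF :: 'a::field_char_0 fps)"
proof (rule fps_ext)
  fix n
  have rec: "of_nat ((n + 1) ^ 2 * clausen_f (Suc n)) = (of_nat (4 * (4 * n + 1) * (4 * n + 3) * clausen_f n) :: 'a)"
    by (simp only: clausen_f_Suc)
  have "fps_deriv (cP * fps_deriv (cF :: 'a fps)) $ n =
      of_nat (n + 1) * (of_nat (n + 1) * of_nat (clausen_f (Suc n)) - 64 * of_nat n * of_nat (clausen_f n))"
    unfolding cP_theta_deriv_nth by (simp add: cF_def)
  also have "\<dots> = of_nat ((n + 1) ^ 2 * clausen_f (Suc n)) - 64 * of_nat n * of_nat (n + 1) * of_nat (clausen_f n)"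
    by (simp add: algebra_simps power2_eq_square)
  also have "\<dots> = (fps_const 12 * (cF :: 'a fps)) $ n" unfolding rec by (simp add: cF_def algebra_simps)
  finally show "fps_deriv (cP * fps_deriv cF) $ n = (fps_const 12 * (cF :: 'a fps)) $ n" .
qed

lemma clausen_ode_F: "clausen_ode (cF ^ 2 :: 'a::field_char_0 fps)"
proof -
  define u :: "'a fps" where "u = cP * fps_deriv cF"
  have du: "fps_deriv u = fps_const 12 * cF" unfolding u_def by (rule cF_ode)
  have 1: "cP * fps_deriv (cF ^ 2) = fps_const 2 * (cF * u)"
    by (simp add: u_def power2_eq_square numeral_fps_const algebra_simps)
  have 2: "cP * fps_deriv (fps_const 2 * (cF * u)) = fps_const 2 * u ^ 2 + fps_const 24 * (cP * cF ^ 2)"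
  proof -
    have "cP * fps_deriv (fps_const 2 * (cF * u)) = fps_const 2 * ((cP * fps_deriv cF) * u + cP * cF * fps_deriv u)"
      by (simp add: algebra_simps)
    also have "\<dots> = fps_const 2 * (u * u) + fps_const 2 * (fps_const 12 * (cP * cF * cF))"
      unfolding du u_def[symmetric] by (simp add: algebra_simps)
    finally show ?thesis by (simp add: power2_eq_square mult_ac)
  qed
  have 3: "fps_deriv (fps_const 2 * u ^ 2 + fps_const 24 * (cP * cF ^ 2)) =
      fps_const 48 * (u * cF) + fps_const 24 * (fps_deriv cP * cF ^ 2 + cP * fps_deriv (cF ^ 2))"
    by (simp add: power2_eq_square du algebra_simps)
  show ?thesis unfolding clausen_ode_def 1 2 3 unfolding 1
    by (simp add: algebra_simps)
qed

lemma cG_ode: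
  fixes G1 G2 :: "'a::field_char_0 fps"
  defines "G1 \<equiv> fps_X * fps_deriv cG" and "G2 \<equiv> fps_X * fps_deriv (fps_X * fps_deriv cG)"
  shows "(1 - fps_const 256 * fps_X) * fps_deriv G2 = fps_const 384 * G2 + fps_const 176 * G1 + fps_const 24 * cG"
proof (rule fps_ext)
  fix n
  have rec: "of_nat ((n + 1) ^ 3 * clausen_g (Suc n)) =
      (of_nat (8 * (4 * n + 1) * (2 * n + 1) * (4 * n + 3) * clausen_g n) :: 'a)"
    by (simp only: clausen_g_Suc)
  have G1: "G1 $ k = of_nat k * of_nat (clausen_g k)" for k
    by (cases k) (simp_all add: G1_def cG_def)
  have G2: "G2 $ k = of_nat k ^ 2 * of_nat (clausen_g k)" for k
  proof -
    have "G2 $ k = of_nat k * G1 $ k" unfolding G2_def G1_def[symmetric] by (cases k) simp_all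
    thus ?thesis by (simp add: G1 power2_eq_square)
  qed
  have "((1 - fps_const 256 * fps_X) * fps_deriv G2) $ n =
      of_nat (n + 1) * G2 $ (n + 1) - 256 * (of_nat n * G2 $ n)"
    by (cases n) (simp_all add: algebra_simps)
  also have "\<dots> = of_nat ((n + 1) ^ 3 * clausen_g (Suc n)) - 256 * of_nat n ^ 3 * of_nat (clausen_g n)"
    by (simp add: G2 power2_eq_square power3_eq_cube algebra_simps)
  also have "\<dots> = (fps_const 384 * G2 + fps_const 176 * G1 + fps_const 24 * cG) $ n"
    unfolding rec by (simp add: G1 G2 cG_def power2_eq_square power3_eq_cube algebra_simps)
  finally show "((1 - fps_const 256 * fps_X) * fps_deriv G2) $ n =
     (fps_const 384 * G2 + fps_const 176 * G1 + fps_const 24 * cG) $ n" .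
qed

text \<open>The substitution x \<mapsto> P turns x d/dx into \<theta>/P', and P'^2 = 1 - 256 P is the
  leading coefficient of the equation of G.\<close>
lemma clausen_ode_G: "clausen_ode (cG oo cP :: 'a::field_char_0 fps)"
proof -
  define G1 G2 :: "'a fps" where "G1 = fps_X * fps_deriv cG" and "G2 = fps_X * fps_deriv (fps_X * fps_deriv cG)"
  define P' :: "'a fps" where "P' = fps_deriv cP"
  have dP': "fps_deriv P' = - fps_const 128" by (simp add: P'_def cP_deriv)
  have comp: "cP * fps_deriv (A oo cP) = P' * ((fps_X * fps_deriv A) oo cP)" for A :: "'a fps"
    by (simp add: fps_compose_deriv[OF cP_nth_0] fps_compose_mult_distrib[OF cP_nth_0]
        fps_X_fps_compose_startby0[OF cP_nth_0] P'_def mult_ac)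
  have 1: "cP * fps_deriv (cG oo cP) = P' * (G1 oo cP)" unfolding comp G1_def ..
  have G2: "G2 = fps_X * fps_deriv G1" by (simp add: G1_def G2_def)
  have 2: "cP * fps_deriv (P' * (G1 oo cP)) = P' ^ 2 * (G2 oo cP) - fps_const 128 * (cP * (G1 oo cP))"
  proof -
    have "cP * fps_deriv (P' * (G1 oo cP)) = P' * (cP * fps_deriv (G1 oo cP)) + fps_deriv P' * (cP * (G1 oo cP))"
      by (simp add: algebra_simps)
    also have "\<dots> = P' ^ 2 * (G2 oo cP) - fps_const 128 * (cP * (G1 oo cP))"
      unfolding comp G2 dP' by (simp add: power2_eq_square algebra_simps del: fps_const_neg)
    finally show ?thesis .
  qed
  have cube: "P' ^ 2 * (fps_deriv G2 oo cP) = fps_const 384 * (G2 oo cP) + fps_const 176 * (G1 oo cP) + fps_const 24 * (cG oo cP)"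
  proof -
    have "P' ^ 2 * (fps_deriv G2 oo cP) = ((1 - fps_const 256 * fps_X) * fps_deriv G2) oo cP"
      unfolding P'_def cP_deriv_square
      by (simp add: fps_compose_mult_distrib[OF cP_nth_0] fps_compose_sub_distrib fps_X_fps_compose_startby0[OF cP_nth_0])
    also have "\<dots> = (fps_const 384 * G2 + fps_const 176 * G1 + fps_const 24 * cG) oo cP"
      unfolding G1_def G2_def by (simp only: cG_ode)
    finally show ?thesis by (simp add: fps_compose_add_distrib fps_compose_mult_distrib[OF cP_nth_0])
  qed
  have dG2: "fps_deriv (G2 oo cP) = (fps_deriv G2 oo cP) * P'"
    by (simp add: fps_compose_deriv[OF cP_nth_0] P'_def)
  have "fps_deriv (P' ^ 2 * (G2 oo cP) - fps_const 128 * (cP * (G1 oo cP))) =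
      P' * (P' ^ 2 * (fps_deriv G2 oo cP)) + fps_const 2 * (P' * fps_deriv P' * (G2 oo cP))
      - fps_const 128 * (P' * (G1 oo cP) + cP * fps_deriv (G1 oo cP))"
    unfolding fps_deriv_sub fps_deriv_mult dG2
    by (simp add: power2_eq_square P'_def[symmetric] algebra_simps)
  also have "\<dots> = fps_const 48 * (P' * (G1 oo cP)) + fps_const 24 * (P' * (cG oo cP))"
    unfolding cube comp G2[symmetric] dP'
    unfolding numeral_fps_const[symmetric] by Groebner_Basis.algebra
  finally show ?thesis unfolding clausen_ode_def 1 2 unfolding P'_def .
qed

theorem clausen_identity: "cF ^ 2 = (cG oo cP :: 'a::field_char_0 fps)"
proof (rule clausen_ode_unique[OF clausen_ode_F clausen_ode_G])
  have "cF $ 0 = (1 :: 'a)" "cG $ 0 = (1 :: 'a)" by (simp_all add: cF_def cG_def clausen_f_def clausen_g_def)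
  thus "(cF ^ 2) $ 0 = (cG oo cP :: 'a fps) $ 0" by (simp add: power2_eq_square)
qed

section \<open>Truncation modulo p\<close>

lemma prime_dvd_central_binomial:
  assumes "prime p" "n < p" "p \<le> 2 * n" shows "p dvd ((2 * n) choose n)"
proof -
  have "p dvd fact (2 * n)" using assms by (simp add: prime_dvd_fact_iff)
  also have "fact (2 * n) = fact n * fact n * ((2 * n) choose n)"
    using binomial_fact_lemma[of n "2 * n"] by simp
  finally have "p dvd fact n * fact n * ((2 * n) choose n)" .
  moreover have "\<not> p dvd fact n" using assms by (simp add: prime_dvd_fact_iff)
  ultimately show ?thesis using assms(1) by (simp add: prime_dvd_mult_iff)
qed

text \<open>Both sides satisfy the same recurrence modulo p, since 2(2j + 1) = -4(h - j) + 2p.\<close>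
lemma central_binomial_cong:
  assumes "prime p" "p = Suc (2 * h)" "j < p"
  shows "[int ((2 * j) choose j) = (- 4) ^ j * int (h choose j)] (mod int p)"
  using assms(3)
proof (induction j)
  case (Suc j)
  have IH: "[int ((2 * j) choose j) = (- 4) ^ j * int (h choose j)] (mod int p)" using Suc by simp
  have "int (Suc j) * int ((2 * Suc j) choose Suc j) = 2 * (2 * int j + 1) * int ((2 * j) choose j)"
    using arg_cong[OF central_binomial_Suc[of j], of int] by (simp only: of_nat_mult of_nat_add of_nat_numeral of_nat_1 int_ops)
  also have "[\<dots> = 2 * (2 * int j + 1) * ((- 4) ^ j * int (h choose j))] (mod int p)"
    by (rule cong_scalar_left[OF IH])
  also have "[2 * (2 * int j + 1) * ((- 4) ^ j * int (h choose j)) =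
      - 4 * (int h - int j) * ((- 4) ^ j * int (h choose j))] (mod int p)"
  proof (rule cong_scalar_right)
    have "2 * (2 * int j + 1) - (- 4 * (int h - int j)) = 2 * int p" using assms(2) by simp
    thus "[2 * (2 * int j + 1) = - 4 * (int h - int j)] (mod int p)" by (simp add: cong_iff_dvd_diff)
  qed
  also have "- 4 * (int h - int j) * ((- 4) ^ j * int (h choose j)) = int (Suc j) * ((- 4) ^ Suc j * int (h choose Suc j))"
  proof -
    have e: "int (Suc j) * int (h choose Suc j) = (int h - int j) * int (h choose j)"
    proof (cases "j \<le> h")
      case True
      have "Suc j * (h choose Suc j) = (h - j) * (h choose j)"
        using binomial_absorb_comp[of h j] binomial_absorption[of j h] by (cases h) (auto simp: mult.commute)
      hence "int (Suc j * (h choose Suc j)) = int ((h - j) * (h choose j))" by simp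
      thus ?thesis using True by (simp only: of_nat_mult of_nat_diff)
    qed (simp add: binomial_eq_0)
    have "- 4 * (int h - int j) * ((- 4) ^ j * int (h choose j)) =
        (- 4) ^ Suc j * ((int h - int j) * int (h choose j))" by (simp only: power_Suc mult_ac)
    also have "\<dots> = int (Suc j) * ((- 4) ^ Suc j * int (h choose Suc j))"
      unfolding e[symmetric] by (simp only: mult_ac)
    finally show ?thesis .
  qed
  finally have "[int (Suc j) * int ((2 * Suc j) choose Suc j) =
      int (Suc j) * ((- 4) ^ Suc j * int (h choose Suc j))] (mod int p)" .
  moreover have "coprime (int (Suc j)) (int p)"
  proof -
    have "\<not> p dvd Suc j" using Suc by (auto dest: dvd_imp_le)
    thus ?thesis using assms(1) by (simp add: prime_imp_coprime coprime_commute del: of_nat_Suc)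
  qed
  ultimately show ?case using cong_mult_lcancel by blast
qed simp

text \<open>The error made by truncating both sides of Clausen's identity at degree t.\<close>
definition clausen_defect :: "nat \<Rightarrow> 'a::field_char_0 poly" where
  "clausen_defect t = (\<Sum>k\<le>t. monom (of_nat (clausen_f k)) k) ^ 2
     - (\<Sum>k\<le>t. smult (of_nat (clausen_g k)) ([:0, 1, -64:] ^ k))"

lemma cP_power_nth: "(cP ^ k :: 'a::field_char_0 fps) $ n = coeff ([:0, 1, -64:] ^ k) n"
proof -
  have "fps_of_poly [:0, 1, -64:] = (cP :: 'a fps)"
    by (simp add: cP_def fps_of_poly_pCons power2_eq_square numeral_fps_const algebra_simps)
  hence "(cP :: 'a fps) ^ k = fps_of_poly ([:0, 1, -64:] ^ k)" by (simp only: fps_of_poly_power)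
  thus ?thesis by simp
qed

lemma clausen_defect_exact:
  assumes "n \<le> t" shows "coeff (clausen_defect t :: 'a::field_char_0 poly) n = 0"
proof -
  define S :: "'a poly" where "S = (\<Sum>k\<le>t. monom (of_nat (clausen_f k)) k)"
  have cm: "coeff S i = of_nat (clausen_f i)" if "i \<le> t" for i
    using that by (simp add: S_def coeff_sum if_distrib cong: if_cong)
  have "coeff (S ^ 2) n = (\<Sum>i\<le>n. of_nat (clausen_f i) * of_nat (clausen_f (n - i)))"
    unfolding power2_eq_square coeff_mult using assms by (intro sum.cong) (auto simp: cm)
  also have "\<dots> = (cF ^ 2) $ n"
    by (simp add: power2_eq_square fps_mult_nth cF_def atMost_atLeast0)
  also have "\<dots> = (\<Sum>k=0..n. of_nat (clausen_g k) * (cP ^ k) $ n)"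
    unfolding clausen_identity fps_compose_nth by (simp add: cG_def)
  also have "\<dots> = (\<Sum>k\<in>{0..t}. of_nat (clausen_g k) * (cP ^ k) $ n)"
  proof (rule sum.mono_neutral_left)
    show "\<forall>i\<in>{0..t} - {0..n}. of_nat (clausen_g i) * ((cP :: 'a fps) ^ i) $ n = 0"
      using startsby_zero_power_prefix[OF cP_nth_0[where 'a = 'a]] by auto
  qed (use assms in auto)
  also have "\<dots> = coeff (\<Sum>k\<le>t. smult (of_nat (clausen_g k)) ([:0, 1, -64:] ^ k)) n"
    by (simp add: coeff_sum cP_power_nth atMost_atLeast0)
  finally show ?thesis by (simp add: clausen_defect_def S_def)
qed

text \<open>For h/2 < k < p the prime p lies between 2k and 4k or between k and 2k, so it divides one of
  the two central binomial coefficients.\<close>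
lemma prime_dvd_clausen:
  assumes "prime p" "p = Suc (2 * h)" "h div 2 < k" "k < p"
  shows "p dvd clausen_f k" "p dvd clausen_g k"
proof -
  have "p dvd ((4 * k) choose (2 * k)) \<or> p dvd ((2 * k) choose k)"
  proof (cases "p \<le> 2 * k")
    case True
    thus ?thesis using prime_dvd_central_binomial[of p k] assms by simp
  next
    case False
    moreover have "p \<le> 4 * k" using assms by linarith
    ultimately show ?thesis using prime_dvd_central_binomial[of p "2 * k"] assms by (simp add: mult.assoc[symmetric])
  qed
  thus "p dvd clausen_f k" "p dvd clausen_g k" by (auto simp: clausen_f_def clausen_g_def power2_eq_square)
qed

text \<open>The integer W to which both sums reduce.\<close>
definition wsum :: "nat \<Rightarrow> int" where
  "wsum h = (\<Sum>j\<le>h div 2. int (h choose (2 * j)) * int ((2 * j) choose j) ^ 2 * 16 ^ j * 9 ^ (h - 2 * j))"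

context residue_structure
begin

lemma I_of_int_cong: "[a = b] (mod int p) \<Longrightarrow> of_int a - of_int b \<in> I"
  using I_of_int[of "a - b"] by (simp add: cong_iff_dvd_diff)

lemma I_of_nat: "p dvd n \<Longrightarrow> of_nat n \<in> I"
  using I_of_int[of "int n"] by (simp add: int_dvd_int_iff)

lemma PI_sum: "(\<And>i. i \<in> A \<Longrightarrow> f i \<in> PI) \<Longrightarrow> sum f A \<in> PI"
  by (auto simp: PI_def coeff_sum intro: I_sum)

text \<open>Truncation at degree p - 1 is exact below degree p. The terms between h/2 and p are divisible
  by p, so truncating already at h/2 changes the result only modulo p, and then there is nothing in
  degree p or above.\<close>
lemma clausen_defect_PI:
  assumes "p = Suc (2 * h)"
  shows "clausen_defect (h div 2) \<in> PI"
  unfolding PI_def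
proof (intro CollectI allI)
  fix n
  show "coeff (clausen_defect (h div 2)) n \<in> I"
  proof (cases "n < p")
    case False
    have d1: "degree (\<Sum>k\<le>h div 2. monom (of_nat (clausen_f k)) k :: 'a poly) \<le> h div 2"
      by (intro degree_sum_le) (auto intro: order.trans[OF degree_monom_le])
    have d2: "degree (\<Sum>k\<le>h div 2. smult (of_nat (clausen_g k)) ([:0, 1, -64:] ^ k) :: 'a poly) \<le> 2 * (h div 2)"
    proof (intro degree_sum_le)
      fix k assume "k \<in> {..h div 2}"
      hence "degree ([:0, 1, -64:] ^ k :: 'a poly) \<le> 2 * (h div 2)"
        by (simp add: degree_power_eq)
      thus "degree (smult (of_nat (clausen_g k)) ([:0, 1, -64:] ^ k) :: 'a poly) \<le> 2 * (h div 2)"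
        using degree_smult_le order.trans by blast
    qed simp
    have "degree ((\<Sum>k\<le>h div 2. monom (of_nat (clausen_f k)) k :: 'a poly) ^ 2) \<le> 2 * (h div 2)"
      using degree_power_le[of "\<Sum>k\<le>h div 2. monom (of_nat (clausen_f k)) k :: 'a poly" 2] d1 by simp
    hence "degree (clausen_defect (h div 2) :: 'a poly) \<le> 2 * (h div 2)"
      unfolding clausen_defect_def using d2 by (rule degree_diff_le)
    moreover have "2 * (h div 2) < n" using False assms by linarith
    ultimately have "coeff (clausen_defect (h div 2)) n = (0 :: 'a)" by (intro coeff_eq_0) simp
    thus ?thesis using I_0 by simp
  next
    case True
    define t where "t = h div 2"
    have tp: "t \<le> p - 1" using assms by (simp add: t_def)
    define Ft Fp :: "'a poly" where "Ft = (\<Sum>k\<le>t. monom (of_nat (clausen_f k)) k)"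
      and "Fp = (\<Sum>k\<in>{..p - 1} - {..t}. monom (of_nat (clausen_f k)) k)"
    define Gt Gp :: "'a poly" where "Gt = (\<Sum>k\<le>t. smult (of_nat (clausen_g k)) ([:0, 1, -64:] ^ k))"
      and "Gp = (\<Sum>k\<in>{..p - 1} - {..t}. smult (of_nat (clausen_g k)) ([:0, 1, -64:] ^ k))"
    have sF: "(\<Sum>k\<le>p - 1. monom (of_nat (clausen_f k)) k) = Ft + Fp"
      unfolding Ft_def Fp_def using tp by (subst sum.subset_diff[of "{..t}"]) auto
    have sG: "(\<Sum>k\<le>p - 1. smult (of_nat (clausen_g k)) ([:0, 1, -64:] ^ k)) = Gt + Gp"
      unfolding Gt_def Gp_def using tp by (subst sum.subset_diff[of "{..t}"]) auto
    have k: "h div 2 < k \<and> k < p" if "k \<in> {..p - 1} - {..t}" for k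
      using that tp assms by (auto simp: t_def)
    have PP: "([:0, 1, -64:] :: 'a poly) \<in> PV"
      by (intro PV_pCons PV_0 V_0 V_1 V_minus V_numeral)
    have FpI: "Fp \<in> PI" unfolding Fp_def
    proof (rule PI_sum)
      fix k' assume "k' \<in> {..p - 1} - {..t}"
      hence "of_nat (clausen_f k') \<in> I" using prime_dvd_clausen(1)[OF prime_p assms] k by (intro I_of_nat) simp
      thus "monom (of_nat (clausen_f k')) k' \<in> PI" by (auto simp: PI_def I_0)
    qed
    have GpI: "Gp \<in> PI" unfolding Gp_def
    proof (rule PI_sum)
      fix k' assume "k' \<in> {..p - 1} - {..t}"
      hence "of_nat (clausen_g k') \<in> I" using prime_dvd_clausen(2)[OF prime_p assms] k by (intro I_of_nat) simp
      thus "smult (of_nat (clausen_g k')) ([:0, 1, -64:] ^ k') \<in> PI"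
        using PV_power[OF PP, of k'] by (auto simp: PI_def PV_def intro: I_mult)
    qed
    have FtV: "Ft \<in> PV" unfolding Ft_def by (intro PV_sum) (auto simp: PV_def V_0 V_of_nat)
    have "Fp \<in> PV" unfolding Fp_def by (intro PV_sum) (auto simp: PV_def V_0 V_of_nat)
    hence "Fp * (Ft + Ft + Fp) \<in> PI" using FpI FtV by (intro PI_mult PV_add)
    hence "coeff (Fp * (Ft + Ft + Fp)) n - coeff Gp n \<in> I" using GpI by (auto simp: PI_def intro: I_diff)
    moreover have "clausen_defect (p - 1) - clausen_defect t = Fp * (Ft + Ft + Fp) - Gp"
      unfolding clausen_defect_def sF sG Ft_def[symmetric] Gt_def[symmetric]
      by (simp add: power2_eq_square algebra_simps)
    hence "coeff (clausen_defect (p - 1)) n - coeff (clausen_defect t) n = coeff (Fp * (Ft + Ft + Fp)) n - coeff Gp n"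
      by (metis coeff_diff)
    moreover have "coeff (clausen_defect (p - 1)) n = (0 :: 'a)" using True by (intro clausen_defect_exact) simp
    ultimately have "- coeff (clausen_defect t) n \<in> I" by simp
    from I_minus[OF this] show ?thesis by (simp add: t_def)
  qed
qed

lemma truncated_clausen:
  assumes "p = Suc (2 * h)" "x \<in> V"
  shows "(\<Sum>k\<le>h div 2. of_nat (clausen_f k) * x ^ k) ^ 2 - (\<Sum>k\<le>h div 2. of_nat (clausen_g k) * (x - 64 * x ^ 2) ^ k) \<in> I"
proof -
  have "poly (clausen_defect (h div 2)) x \<in> I"
    unfolding poly_altdef using clausen_defect_PI[OF assms(1)]
    by (intro I_sum I_mult V_power assms(2)) (simp add: PI_def)
  also have "poly (clausen_defect (h div 2)) x =
     (\<Sum>k\<le>h div 2. of_nat (clausen_f k) * x ^ k) ^ 2 - (\<Sum>k\<le>h div 2. of_nat (clausen_g k) * (x - 64 * x ^ 2) ^ k)"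
    by (simp add: clausen_defect_def poly_sum poly_monom algebra_simps power2_eq_square)
  finally show ?thesis .
qed

end

lemma sum_even_indices:
  fixes g :: "nat \<Rightarrow> 'b::comm_monoid_add"
  assumes "\<And>i. odd i \<Longrightarrow> g i = 0"
  shows "(\<Sum>i\<le>n. g i) = (\<Sum>j\<le>n div 2. g (2 * j))"
proof -
  have "(\<Sum>j\<le>n div 2. g (2 * j)) = sum g ((\<lambda>j. 2 * j) ` {..n div 2})"
    by (subst sum.reindex) (auto simp: inj_on_def)
  also have "\<dots> = (\<Sum>i\<le>n. g i)"
  proof (rule sum.mono_neutral_left)
    show "\<forall>i\<in>{..n} - (*) 2 ` {..n div 2}. g i = 0"
    proof
      fix i assume i: "i \<in> {..n} - (*) 2 ` {..n div 2}"
      have "odd i"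
      proof
        assume "even i"
        then obtain j where "i = 2 * j" by (elim evenE)
        thus False using i by auto
      qed
      thus "g i = 0" by (rule assms)
    qed
  qed auto
  finally show ?thesis ..
qed

text \<open>Expand ((x^2 + c) + b x)^n; the term with (x^2 + c)^i contributes its middle coefficient,
  which vanishes for odd i.\<close>
lemma central_trinomial:
  fixes b c :: "'b::comm_ring_1"
  shows "coeff ([:c, b, 1:] ^ n) n =
    (\<Sum>j\<le>n div 2. of_nat (n choose (2 * j)) * of_nat ((2 * j) choose j) * b ^ (n - 2 * j) * c ^ j)"
proof -
  define w where "w i = (if even i then of_nat (i choose (i div 2)) * c ^ (i div 2) else 0)" for i
  have square: "coeff ((monom 1 2 + [:c:]) ^ i) i = w i" for i
  proof -
    have "coeff ((monom 1 2 + [:c:]) ^ i) i =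
        (\<Sum>j\<le>i. of_nat (i choose j) * (if 2 * j = i then c ^ (i - j) else 0))"
      unfolding binomial_ring coeff_sum
    proof (rule sum.cong)
      fix j assume "j \<in> {..i}"
      have "of_nat (i choose j) * monom 1 2 ^ j * [:c:] ^ (i - j) =
          smult (of_nat (i choose j)) (monom (c ^ (i - j)) (2 * j))"
        by (simp add: monom_power poly_const_pow of_nat_poly mult.commute smult_monom)
      thus "coeff (of_nat (i choose j) * monom 1 2 ^ j * [:c:] ^ (i - j)) i =
          of_nat (i choose j) * (if 2 * j = i then c ^ (i - j) else 0)" by simp
    qed simp
    also have "\<dots> = w i"
    proof (cases "even i")
      case True
      then obtain m where m: "i = 2 * m" by (elim evenE)
      have "(\<Sum>j\<le>i. of_nat (i choose j) * (if 2 * j = i then c ^ (i - j) else 0)) =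
          (\<Sum>j\<le>i. if j = m then of_nat (i choose m) * c ^ m else 0)"
        by (rule sum.cong) (auto simp: m)
      thus ?thesis by (simp add: w_def m)
    next
      case False
      thus ?thesis unfolding w_def by (auto intro!: sum.neutral)
    qed
    finally show ?thesis .
  qed
  have q: "[:c, b, 1:] = (monom 1 2 + [:c:]) + monom b 1"
    by (simp add: monom_altdef numeral_2_eq_2)
  have "coeff ([:c, b, 1:] ^ n) n = (\<Sum>i\<le>n. of_nat (n choose i) * (b ^ (n - i) * w i))"
    unfolding q binomial_ring[of "monom 1 2 + [:c:]"] coeff_sum
  proof (rule sum.cong)
    fix i assume i: "i \<in> {..n}"
    have "of_nat (n choose i) * (monom 1 2 + [:c:]) ^ i * monom b 1 ^ (n - i) =
        smult (of_nat (n choose i)) (monom (b ^ (n - i)) (n - i) * (monom 1 2 + [:c:]) ^ i)"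
      by (simp add: monom_power of_nat_poly mult_ac)
    thus "coeff (of_nat (n choose i) * (monom 1 2 + [:c:]) ^ i * monom b 1 ^ (n - i)) n =
        of_nat (n choose i) * (b ^ (n - i) * w i)"
      using i by (simp add: coeff_monom_mult square)
  qed simp
  also have "\<dots> = (\<Sum>j\<le>n div 2. of_nat (n choose (2 * j)) * (b ^ (n - 2 * j) * w (2 * j)))"
    by (rule sum_even_indices) (simp add: w_def)
  finally show ?thesis by (simp add: w_def mult_ac)
qed

section \<open>The sums modulo p\<close>

text \<open>Multiplication of the exponential generating function by exp(a z).\<close>
definition binomial_transform :: "'b::field_char_0 \<Rightarrow> (nat \<Rightarrow> 'b) \<Rightarrow> nat \<Rightarrow> 'b" where
  "binomial_transform a d n = (\<Sum>i\<le>n. of_nat (n choose i) * d i * a ^ (n - i))"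

definition egf :: "(nat \<Rightarrow> 'b::field_char_0) \<Rightarrow> 'b fps" where "egf d = Abs_fps (\<lambda>n. d n / fact n)"

lemma egf_mult_nth: "fact n * (egf d * egf e) $ n = (\<Sum>i\<le>n. of_nat (n choose i) * d i * e (n - i))"
  unfolding egf_def fps_mult_nth sum_distrib_left atMost_atLeast0
  by (rule sum.cong) (auto simp: binomial_fact field_simps)

lemma egf_eq_iff: "egf d = egf e \<longleftrightarrow> d = e"
  by (auto simp: egf_def fps_eq_iff)

lemma egf_binomial_transform: "egf (binomial_transform a d) = fps_exp a * egf d"
proof (rule fps_ext)
  fix n
  have "fps_exp a = egf (\<lambda>i. a ^ i)" by (simp add: egf_def fps_exp_def)
  hence "fact n * (egf d * fps_exp a) $ n = binomial_transform a d n"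
    by (simp add: egf_mult_nth binomial_transform_def)
  thus "egf (binomial_transform a d) $ n = (fps_exp a * egf d) $ n"
    by (simp add: egf_def[of "binomial_transform a d"] field_simps)
qed

lemma binomial_transform_add:
  "binomial_transform b (binomial_transform a d) = binomial_transform (a + b) d"
  unfolding egf_eq_iff[symmetric] egf_binomial_transform by (simp add: fps_exp_add_mult mult_ac)

lemma binomial_transform_scale:
  "u ^ n * binomial_transform a d n = binomial_transform (a * u) (\<lambda>i. u ^ i * d i) n"
  unfolding binomial_transform_def sum_distrib_left
proof (rule sum.cong)
  fix i assume "i \<in> {..n}"
  hence "u ^ n = u ^ i * u ^ (n - i)" by (simp flip: power_add)
  thus "u ^ n * (of_nat (n choose i) * d i * a ^ (n - i)) = of_nat (n choose i) * (u ^ i * d i) * (a * u) ^ (n - i)"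
    by (simp add: power_mult_distrib mult_ac)
qed simp

definition central :: "nat \<Rightarrow> 'b::field_char_0" where
  "central i = (if even i then of_nat (i choose (i div 2)) else 0)"

text \<open>binom(2n,n) is the middle coefficient of (1 + x)^(2n) = (x^2 + 2x + 1)^n.\<close>
lemma central_binomial_transform: "of_nat ((2 * n) choose n) = binomial_transform 2 (central :: nat \<Rightarrow> 'b::field_char_0) n"
proof -
  have e: "([:1, 2, 1:] :: 'b poly) ^ n = [:1, 1:] ^ (2 * n)"
    by (simp add: power_mult power2_eq_square)
  have "of_nat ((2 * n) choose n) = coeff (([:1, 2, 1:] :: 'b poly) ^ n) n"
    unfolding e using coeff_linear_poly_power[of n "2 * n" "1 :: 'b" 1] by simp
  also have "\<dots> = (\<Sum>j\<le>n div 2. of_nat (n choose (2 * j)) * central (2 * j) * 2 ^ (n - 2 * j))"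
    unfolding central_trinomial by (simp add: central_def)
  also have "\<dots> = binomial_transform 2 central n"
    unfolding binomial_transform_def by (rule sum_even_indices[symmetric]) (simp add: central_def)
  finally show ?thesis .
qed

text \<open>The sum over j of 1/(j!^2 (m-j)!^2) is binom(2m,m)/m!^2 by Vandermonde's identity.\<close>
lemma egf_central_square: "egf central * egf central = (egf (\<lambda>i. central i ^ 2) :: 'b::field_char_0 fps)"
proof (rule fps_ext)
  fix n
  have "fact n * (egf central * egf central) $ n = (central n ^ 2 :: 'b)"
  proof (cases "even n")
    case False
    have "central i * central (n - i) = (0 :: 'b)" if "i \<le> n" for i
      using False that by (auto simp: central_def)
    thus ?thesis unfolding egf_mult_nth using False by (auto intro!: sum.neutral simp: central_def mult.assoc)
  next
    case True
    then obtain m where m: "n = 2 * m" by (elim evenE)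
    have "fact n * (egf central * egf central) $ n = (\<Sum>i\<le>n. of_nat (n choose i) * central i * (central (n - i) :: 'b))"
      by (rule egf_mult_nth)
    also have "\<dots> = (\<Sum>j\<le>m. of_nat ((2 * m) choose (2 * j)) * of_nat ((2 * j) choose j) * of_nat ((2 * (m - j)) choose (m - j)))"
      by (subst sum_even_indices) (auto simp: central_def m simp flip: right_diff_distrib' intro!: sum.cong)
    also have "\<dots> = (\<Sum>j\<le>m. of_nat ((2 * m) choose m) * of_nat ((m choose j) ^ 2))"
    proof (rule sum.cong)
      fix j assume "j \<in> {..m}"
      then obtain k where k: "m = j + k" using le_Suc_ex by auto
      have f: "of_nat (a + b choose a) = (fact (a + b) / (fact a * fact b) :: 'b)" for a b
        by (simp add: binomial_fact)
      have e: "2 * m = 2 * j + 2 * k" "2 * j = j + j" "2 * k = k + k" "m - j = k" using k by simp_all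
      have "of_nat ((2 * m) choose (2 * j)) * of_nat ((2 * j) choose j) * of_nat ((2 * (m - j)) choose (m - j)) =
          (fact (2 * m) / (fact j * fact j * fact k * fact k) :: 'b)"
        unfolding e(4) unfolding e(1) f unfolding e(2,3) f by simp
      moreover have "of_nat ((2 * m) choose m) * of_nat ((m choose j) ^ 2) =
          (fact (2 * m) / (fact j * fact j * fact k * fact k) :: 'b)"
        using f[of m m, folded mult_2] f[of j k, folded k] by (simp add: power2_eq_square)
      ultimately show "of_nat ((2 * m) choose (2 * j)) * of_nat ((2 * j) choose j) * of_nat ((2 * (m - j)) choose (m - j)) =
          (of_nat ((2 * m) choose m) * of_nat ((m choose j) ^ 2) :: 'b)" by simp
    qed simp
    also have "\<dots> = of_nat ((2 * m) choose m) * of_nat ((2 * m) choose m)"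
      unfolding choose_square_sum[symmetric] by (simp only: sum_distrib_left of_nat_sum)
    finally show ?thesis by (simp add: central_def m power2_eq_square)
  qed
  thus "(egf central * egf central) $ n = egf (\<lambda>i. central i ^ 2 :: 'b) $ n"
    by (simp add: egf_def[of "\<lambda>i. central i ^ 2"] field_simps)
qed

text \<open>S is the binomial convolution of the central binomial coefficients with themselves, so its
  exponential generating function is the square of exp(2z) times that of \<open>central\<close>.\<close>
lemma S_binomial_transform: "(of_nat (S n) :: 'b::field_char_0) = binomial_transform 4 (\<lambda>i. central i ^ 2) n"
proof -
  let ?c = "\<lambda>k. of_nat ((2 * k) choose k) :: 'b"
  have e: "egf ?c = fps_exp 2 * egf central"
    unfolding central_binomial_transform egf_binomial_transform ..
  have "egf ?c * egf ?c = fps_exp (2 + 2) * egf (\<lambda>i. central i ^ 2)"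
    unfolding e fps_exp_add_mult egf_central_square[symmetric] by (simp only: mult_ac)
  also have "\<dots> = egf (binomial_transform 4 (\<lambda>i. central i ^ 2))" by (simp add: egf_binomial_transform)
  finally have "fact n * (egf ?c * egf ?c) $ n = binomial_transform 4 (\<lambda>i. central i ^ 2) n"
    by (simp add: egf_def[of "binomial_transform _ _"])
  thus ?thesis unfolding egf_mult_nth by (simp add: S_def atMost_atLeast0 right_diff_distrib')
qed

text \<open>The sum is the transform with parameter 1 of the sequence u^k S_k, which is itself a
  transform with parameter 4u; the parameters add. Scaling by c turns the total parameter 1 + 4u into 9
  and the weight u^(2j) into 16^j.\<close>
lemma sum_binomial_S:
  fixes u c :: "'b::field_char_0"
  assumes "(u * c) ^ 2 = 16" "(1 + 4 * u) * c = 9"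
  shows "c ^ h * (\<Sum>k\<le>h. of_nat (h choose k) * u ^ k * of_nat (S k)) = of_int (wsum h)"
proof -
  have "(\<Sum>k\<le>h. of_nat (h choose k) * u ^ k * of_nat (S k)) = binomial_transform 1 (\<lambda>k. u ^ k * of_nat (S k)) h"
    by (simp add: binomial_transform_def mult_ac)
  also have "\<dots> = binomial_transform 1 (binomial_transform (4 * u) (\<lambda>i. u ^ i * central i ^ 2)) h"
    unfolding S_binomial_transform binomial_transform_scale ..
  also have "\<dots> = binomial_transform (1 + 4 * u) (\<lambda>i. u ^ i * central i ^ 2) h"
    by (simp add: binomial_transform_add add.commute)
  finally have "c ^ h * (\<Sum>k\<le>h. of_nat (h choose k) * u ^ k * of_nat (S k)) =
      binomial_transform 9 (\<lambda>i. c ^ i * (u ^ i * central i ^ 2)) h"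
    by (simp only: binomial_transform_scale assms)
  also have "\<dots> = (\<Sum>j\<le>h div 2. of_nat (h choose (2 * j)) * (c ^ (2 * j) * (u ^ (2 * j) * central (2 * j) ^ 2)) * 9 ^ (h - 2 * j))"
    unfolding binomial_transform_def by (rule sum_even_indices) (simp add: central_def)
  also have "\<dots> = (\<Sum>j\<le>h div 2. of_nat (h choose (2 * j)) * (16 ^ j * of_nat ((2 * j) choose j) ^ 2) * 9 ^ (h - 2 * j))"
  proof (rule sum.cong)
    fix j
    have "c ^ (2 * j) * u ^ (2 * j) = 16 ^ j"
      unfolding assms(1)[symmetric] by (simp add: power_mult[symmetric] power_mult_distrib mult_ac)
    thus "of_nat (h choose (2 * j)) * (c ^ (2 * j) * (u ^ (2 * j) * central (2 * j) ^ 2)) * 9 ^ (h - 2 * j) =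
       of_nat (h choose (2 * j)) * (16 ^ j * of_nat ((2 * j) choose j) ^ 2) * (9 :: 'b) ^ (h - 2 * j)"
      by (simp add: central_def mult.assoc[symmetric])
  qed simp
  also have "\<dots> = of_int (wsum h)" by (simp add: wsum_def mult_ac)
  finally show ?thesis .
qed

context residue_structure
begin

text \<open>Here u = -4/m. The choices m = 25, c = 25 and m = 7, c = -7 both satisfy the two
  conditions.\<close>
lemma S_sum_residue:
  assumes h: "p = Suc (2 * h)" and m: "\<not> int p dvd m"
    and c: "(4 * c) ^ 2 = 16 * m ^ 2" "(m - 16) * c = 9 * m"
  defines "T \<equiv> (\<Sum>k=0..p-1. of_nat ((2 * k) choose k) * (of_nat (S k) / of_int m ^ k))"
  shows "T \<in> V" "of_int (c ^ h) * T - of_int (wsum h) \<in> I"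
proof -
  define v :: 'a where "v = inverse (of_int m)"
  have vV: "v \<in> V" unfolding v_def using m by (rule inverse_V)
  have m0: "(of_int m :: 'a) \<noteq> 0" using m by auto
  have Sv: "of_nat (S k) / of_int m ^ k = of_nat (S k) * v ^ k" for k
    by (simp add: v_def field_simps)
  show "T \<in> V" unfolding T_def Sv by (intro V_sum V_mult V_of_nat V_power vV)
  define u where "u = - 4 * v"
  have uk: "u ^ k = (- 4) ^ k * v ^ k" for k by (simp only: u_def power_mult_distrib)
  have "(\<Sum>k\<le>h. of_nat (h choose k) * u ^ k * of_nat (S k)) = (\<Sum>k=0..p-1. of_nat (h choose k) * u ^ k * of_nat (S k))"
    by (rule sum.mono_neutral_left) (auto simp: h)
  hence "T - (\<Sum>k\<le>h. of_nat (h choose k) * u ^ k * of_nat (S k)) =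
      (\<Sum>k=0..p-1. (of_int (int ((2 * k) choose k)) - of_int ((- 4) ^ k * int (h choose k))) * (of_nat (S k) * v ^ k))"
    unfolding T_def Sv by (simp add: sum_subtractf[symmetric] uk algebra_simps)
  also have "\<dots> \<in> I"
  proof (intro I_sum I_mult V_mult V_of_nat V_power vV I_of_int_cong)
    fix k assume "k \<in> {0..p - 1}"
    thus "[int ((2 * k) choose k) = (- 4) ^ k * int (h choose k)] (mod int p)"
      using h by (intro central_binomial_cong[OF prime_p h]) auto
  qed
  finally have "of_int (c ^ h) * (T - (\<Sum>k\<le>h. of_nat (h choose k) * u ^ k * of_nat (S k))) \<in> I"
    by (rule I_mult'[OF V_of_int])
  moreover have "of_int c ^ h * (\<Sum>k\<le>h. of_nat (h choose k) * u ^ k * of_nat (S k)) = of_int (wsum h)"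
  proof (rule sum_binomial_S)
    have c': "(4 * of_int c) ^ 2 = 16 * (of_int m ^ 2 :: 'a)" "(of_int m - 16) * of_int c = 9 * (of_int m :: 'a)"
      using arg_cong[OF c(1), of "of_int :: int \<Rightarrow> 'a"] arg_cong[OF c(2), of "of_int :: int \<Rightarrow> 'a"] by simp_all
    show "(u * of_int c) ^ 2 = 16" using c'(1) m0 by (simp add: u_def v_def field_simps)
    show "(1 + 4 * u) * of_int c = 9" using c'(2) m0 by (simp add: u_def v_def field_simps)
  qed
  ultimately show "of_int (c ^ h) * T - of_int (wsum h) \<in> I" by (simp add: right_diff_distrib)
qed

lemma not_dvd_coprime_23: 
  "\<not> int p dvd 2 ^ i * 3 ^ j"
proof
  assume "int p dvd 2 ^ i * 3 ^ j"
  hence "int p dvd 2 \<or> int p dvd 3"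
    using prime_p prime_dvd_power prime_dvd_mult_iff by (metis prime_nat_int_transfer)
  thus False using p_gt_7 zdvd_imp_le by fastforce
qed

end

section \<open>The Hasse invariant as a hypergeometric value\<close>

context cm_residue
begin

text \<open>With x = lam/(16 (3 al)^2) the expansion of the Hasse invariant as a central trinomial
  coefficient is (3 al)^h times the truncated series F at x. Clausen's identity replaces its square by
  the truncated series G at x - 64 x^2 = 1/81.\<close>
theorem hasse_square: "of_int (wsum h) * al ^ (p - 1) - hasse ^ 2 \<in> I"
proof -
  define H where "H = h"
  have ph: "p = Suc (2 * H)" unfolding H_def by (rule p_eq_h)
  define t where "t = H div 2"
  have k2: "2 * k < p" if "k \<le> t" for k using that ph by (simp add: t_def)
  define lam L where "lam = 3 * al - 1" and "L = lam * ab ^ 2"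
  \<comment> \<open>x is lam/(16 (3 al)^2): the denominator al^2 is removed by al ab = 2, and 576 = 16 * 9 * 4.\<close>
  define x y where "x = inverse (of_int 576) * L" and "y = (inverse (of_int 81) :: 'a)"
  have abal: "ab * al = 2" using al by Groebner_Basis.algebra
  have LL: "9 * L - L ^ 2 = 64" unfolding L_def lam_def using al by Groebner_Basis.algebra
  have abV: "ab \<in> V" by (intro V_diff V_1 al_V)
  have lamV: "lam \<in> V" unfolding lam_def by (intro V_diff V_mult V_numeral al_V V_1)
  have "\<not> int p dvd 576" using not_dvd_coprime_23[of 6 2] by simp
  hence xV: "x \<in> V" unfolding x_def L_def by (intro V_mult V_power abV lamV inverse_V)
  have "\<not> int p dvd 81" using not_dvd_coprime_23[of 0 4] by simp
  hence yV: "y \<in> V" unfolding y_def by (rule inverse_V)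
  have xy: "x - 64 * x ^ 2 = y"
  proof -
    have "x - 64 * x ^ 2 = inverse 5184 * (9 * L - L ^ 2)"
      by (simp add: x_def power2_eq_square field_simps)
    thus ?thesis unfolding LL y_def by simp
  qed
  define a b :: "nat \<Rightarrow> 'a" where "a k = of_int (int (H choose (2 * k)) * int ((2 * k) choose k) * 16 ^ k)"
    and "b k = of_int (int (H choose (2 * k)) * int ((2 * k) choose k) ^ 2 * 16 ^ k)" for k
  have cb: "[int ((4 * k) choose (2 * k)) = 16 ^ k * int (H choose (2 * k))] (mod int p)" if "k \<le> t" for k
    using central_binomial_cong[OF prime_p ph k2[OF that]] by (simp add: power_mult)
  have fa: "of_nat (clausen_f k) - a k \<in> I" if "k \<le> t" for k
  proof -
    have "[int ((4 * k) choose (2 * k)) * int ((2 * k) choose k) =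
        16 ^ k * int (H choose (2 * k)) * int ((2 * k) choose k)] (mod int p)"
      by (rule cong_scalar_right[OF cb[OF that]])
    from I_of_int_cong[OF this] show ?thesis by (simp add: clausen_f_def a_def mult_ac)
  qed
  have gb: "of_nat (clausen_g k) - b k \<in> I" if "k \<le> t" for k
  proof -
    have "[int ((4 * k) choose (2 * k)) * int ((2 * k) choose k) ^ 2 =
        16 ^ k * int (H choose (2 * k)) * int ((2 * k) choose k) ^ 2] (mod int p)"
      by (rule cong_scalar_right[OF cb[OF that]])
    from I_of_int_cong[OF this] show ?thesis by (simp add: clausen_g_def b_def mult_ac)
  qed
  define F G where "F = (\<Sum>k\<le>t. of_nat (clausen_f k) * x ^ k)" and "G = (\<Sum>k\<le>t. of_nat (clausen_g k) * y ^ k)"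
  define E where "E = (3 * al) ^ H"
  have EV: "E \<in> V" unfolding E_def by (intro V_power V_mult V_numeral al_V)
  have FV: "F \<in> V" unfolding F_def by (intro V_sum V_mult V_of_nat V_power xV)
  have clausen: "F ^ 2 - G \<in> I"
    using truncated_clausen[OF ph xV] unfolding xy F_def G_def t_def .
  have hasse: "hasse = E * (\<Sum>k\<le>t. a k * x ^ k)"
  proof -
    define q where "q = [:lam, 3 * al, 1:]"
    have "fpoly = monom 1 1 * q"
      unfolding fpoly_def q_def by (simp add: monom_altdef lam_def)
    hence "fpoly ^ H = monom 1 H * q ^ H" by (simp only: power_mult_distrib monom_power) simp
    hence "hasse = coeff (q ^ H) H"
      by (simp add: hasse_def H_def[symmetric] coeff_monom_mult)
    also have "\<dots> = (\<Sum>j\<le>t. of_nat (H choose (2 * j)) * of_nat ((2 * j) choose j) * (3 * al) ^ (H - 2 * j) * lam ^ j)"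
      unfolding q_def central_trinomial t_def ..
    also have "\<dots> = (\<Sum>k\<le>t. E * (a k * x ^ k))"
    proof (rule sum.cong)
      fix k assume "k \<in> {..t}"
      hence "H = (H - 2 * k) + 2 * k" by (simp add: t_def)
      hence e: "(3 * al) ^ H = (3 * al) ^ (H - 2 * k) * (3 * al) ^ (2 * k)"
        by (metis power_add)
      have "(3 * al) ^ 2 * (16 * x) = lam"
      proof -
        have "(3 * al) ^ 2 * (16 * x) = inverse 4 * ((ab * al) ^ 2 * lam)"
          by (simp add: x_def L_def power_mult_distrib mult_ac)
        thus ?thesis unfolding abal by simp
      qed
      hence "(3 * al) ^ (2 * k) * (16 ^ k * x ^ k) = lam ^ k"
        by (simp only: power_mult flip: power_mult_distrib)
      hence "(3 * al) ^ (H - 2 * k) * lam ^ k = E * (16 ^ k * x ^ k)"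
        unfolding E_def e by (simp only: mult.assoc)
      thus "of_nat (H choose (2 * k)) * of_nat ((2 * k) choose k) * (3 * al) ^ (H - 2 * k) * lam ^ k = E * (a k * x ^ k)"
        by (simp add: a_def mult_ac) (simp only: mult.left_commute)?
    qed simp
    finally show ?thesis by (simp add: sum_distrib_left)
  qed
  have 1: "E * F - hasse \<in> I"
  proof -
    have "E * F - hasse = E * (\<Sum>k\<le>t. (of_nat (clausen_f k) - a k) * x ^ k)"
      unfolding hasse F_def by (simp add: left_diff_distrib right_diff_distrib sum_subtractf)
    also have "\<dots> \<in> I" by (intro I_mult' EV I_sum I_mult V_power xV fa) simp
    finally show ?thesis .
  qed
  have W: "E ^ 2 * (\<Sum>k\<le>t. b k * y ^ k) = of_int (wsum H) * al ^ (2 * H)"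
  proof -
    have "9 ^ H * (\<Sum>k\<le>t. b k * y ^ k) = of_int (wsum H)"
      unfolding wsum_def t_def of_int_sum sum_distrib_left
    proof (rule sum.cong)
      fix k assume "k \<in> {..H div 2}"
      hence e: "(9 :: 'a) ^ H = 9 ^ (H - 2 * k) * 9 ^ (2 * k)" by (simp flip: power_add)
      have "(9 :: 'a) ^ (2 * k) * y ^ k = 1" unfolding power_mult y_def by (simp flip: power_mult_distrib)
      hence "9 ^ H * y ^ k = 9 ^ (H - 2 * k)" unfolding e by (simp only: mult.assoc mult_1_right)
      hence "b k * (9 ^ H * y ^ k) = b k * 9 ^ (H - 2 * k)" by (simp only:)
      thus "9 ^ H * (b k * y ^ k) =
          of_int (int (H choose (2 * k)) * int ((2 * k) choose k) ^ 2 * 16 ^ k * 9 ^ (H - 2 * k))"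
        by (simp add: b_def mult_ac)
    qed simp
    moreover have "E ^ 2 = al ^ (2 * H) * 9 ^ H"
      unfolding E_def by (simp add: power_mult_distrib power_mult[symmetric] mult.commute[of H]) (simp add: power_mult)
    ultimately show ?thesis by (simp add: mult_ac)
  qed
  have 2: "of_int (wsum H) * al ^ (2 * H) - E ^ 2 * G \<in> I"
  proof -
    have "E ^ 2 * G - of_int (wsum H) * al ^ (2 * H) = E ^ 2 * (\<Sum>k\<le>t. (of_nat (clausen_g k) - b k) * y ^ k)"
      unfolding W[symmetric] G_def by (simp add: left_diff_distrib right_diff_distrib sum_subtractf)
    also have "\<dots> \<in> I" by (intro I_mult' V_power EV I_sum I_mult yV gb) simp
    finally show ?thesis using I_minus by fastforce
  qed
  have "of_int (wsum H) * al ^ (2 * H) - hasse ^ 2 =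
     (of_int (wsum H) * al ^ (2 * H) - E ^ 2 * G) - E ^ 2 * (F ^ 2 - G) + (E * F - hasse) * (E * F + hasse)"
    by (simp add: algebra_simps power2_eq_square)
  also have "\<dots> \<in> I"
    by (intro I_add I_diff 2 I_mult'[OF _ clausen] I_mult[OF 1] V_add V_mult V_power EV FV hasse_V)
  finally have "of_int (wsum H) * al ^ (2 * H) - hasse ^ 2 \<in> I" .
  moreover have "2 * H = p - 1" using ph by simp
  ultimately show ?thesis unfolding H_def[symmetric] by simp
qed

end

section \<open>The residue of W and the congruences\<close>

lemma residue_structureI:
  fixes V :: "'b::field_char_0 set"
  assumes "1 \<in> V" "\<And>a b. a \<in> V \<Longrightarrow> b \<in> V \<Longrightarrow> a + b \<in> V" "\<And>a b. a \<in> V \<Longrightarrow> b \<in> V \<Longrightarrow> a * b \<in> V"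
    "\<And>a. a \<in> V \<Longrightarrow> - a \<in> V" "\<And>n. \<not> int p dvd n \<Longrightarrow> inverse (of_int n) \<in> V" "prime p" "p > 7"
  shows "residue_structure V ((*) (of_nat p) ` V) p"
proof unfold_locales
  have "0 \<in> V" using assms(2)[OF assms(1) assms(4)[OF assms(1)]] by simp
  thus "0 \<in> (*) (of_nat p) ` V" by force
  show "of_nat p \<in> (*) (of_nat p) ` V" using assms(1) by force
  show "a + b \<in> (*) (of_nat p) ` V" if "a \<in> (*) (of_nat p) ` V" "b \<in> (*) (of_nat p) ` V" for a b
    using that assms(2) by (auto simp flip: distrib_left)
  show "a * b \<in> (*) (of_nat p) ` V" if "a \<in> (*) (of_nat p) ` V" "b \<in> V" for a b
    using that assms(3) by (auto simp: mult.assoc)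
qed (use assms in auto)

lemma p_integral_rats_iff:
  assumes "prime p"
  shows "a \<in> p_integral_rats p \<longleftrightarrow> (\<exists>k m. \<not> int p dvd k \<and> of_int k * a = of_int m)"
proof
  obtain n d where nd: "quotient_of a = (n, d)" by (cases "quotient_of a")
  note q = quotient_of_div[OF nd] quotient_of_denom_pos[OF nd] quotient_of_coprime[OF nd]
  have mem: "a \<in> p_integral_rats p \<longleftrightarrow> \<not> int p dvd d" by (simp add: p_integral_rats_def nd)
  show "\<exists>k m. \<not> int p dvd k \<and> of_int k * a = of_int m" if "a \<in> p_integral_rats p"
    using that q unfolding mem by (intro exI[of _ d] exI[of _ n]) simp
  assume "\<exists>k m. \<not> int p dvd k \<and> of_int k * a = of_int m"
  then obtain k m where km: "\<not> int p dvd k" "of_int k * a = of_int m" by blast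
  have "of_int (k * n) = (of_int (m * d) :: rat)" using km(2) q by (simp add: field_simps)
  hence "k * n = m * d" by (simp only: of_int_eq_iff)
  hence "d dvd k * n" by simp
  hence "d dvd k" using q(3) by (simp add: coprime_commute coprime_dvd_mult_left_iff)
  thus "a \<in> p_integral_rats p" unfolding mem using km(1) dvd_trans by blast
qed

lemma p_integral_rats_residue:
  assumes p: "prime p" "p > 7"
  shows "residue_structure (p_integral_rats p) ((*) (of_nat p) ` p_integral_rats p) p"
proof (rule residue_structureI[OF _ _ _ _ _ p])
  note iff = p_integral_rats_iff[OF p(1)]
  have pi: "prime (int p)" using p by simp
  have pr: "\<not> int p dvd k * l" if "\<not> int p dvd k" "\<not> int p dvd l" for k l
    using that pi by (simp add: prime_dvd_mult_iff)
  show "1 \<in> p_integral_rats p" unfolding iff using p by (intro exI[of _ 1]) auto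
  show "a + b \<in> p_integral_rats p" "a * b \<in> p_integral_rats p"
    if ab: "a \<in> p_integral_rats p" "b \<in> p_integral_rats p" for a b
  proof -
    obtain k m l n where e: "\<not> int p dvd k" "of_int k * a = of_int m" "\<not> int p dvd l" "of_int l * b = of_int n"
      using ab unfolding iff by blast
    have "of_int (k * l) * (a + b) = of_int l * (of_int k * a) + of_int k * (of_int l * b)"
      by (simp add: algebra_simps)
    also have "\<dots> = of_int (l * m + k * n)" unfolding e by simp
    finally show "a + b \<in> p_integral_rats p" unfolding iff using pr e by blast
    have "of_int (k * l) * (a * b) = (of_int k * a) * (of_int l * b)" by (simp add: mult_ac)
    also have "\<dots> = of_int (m * n)" unfolding e by simp
    finally show "a * b \<in> p_integral_rats p" unfolding iff using pr e by blast
  qed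
  show "- a \<in> p_integral_rats p" if "a \<in> p_integral_rats p" for a
    using that unfolding iff by (metis mult_minus_right of_int_minus)
  show "inverse (of_int n) \<in> p_integral_rats p" if "\<not> int p dvd n" for n
  proof -
    have "n \<noteq> 0" using that by auto
    hence "of_int n * inverse (of_int n) = (of_int 1 :: rat)" by simp
    thus ?thesis unfolding iff using that by blast
  qed
qed

text \<open>The localization of Z[s] at the rational prime p.\<close>
definition quad_integral :: "nat \<Rightarrow> quad set" where
  "quad_integral p = {a. \<exists>k m n. \<not> int p dvd k \<and> of_int k * a = zs m n}"

lemma quad_integral_residue:
  assumes p: "prime p" "p > 7"
  shows "residue_structure (quad_integral p) ((*) (of_nat p) ` quad_integral p) p"
proof (rule residue_structureI[OF _ _ _ _ _ p])
  have pi: "prime (int p)" using p by simp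
  have pr: "\<not> int p dvd k * l" if "\<not> int p dvd k" "\<not> int p dvd l" for k l
    using that pi by (simp add: prime_dvd_mult_iff)
  have "of_int 1 * 1 = zs 1 0" by (simp flip: zs_simps(7))
  moreover have "\<not> int p dvd 1" using p by simp
  ultimately show "1 \<in> quad_integral p" unfolding quad_integral_def by blast
  show "a + b \<in> quad_integral p" "a * b \<in> quad_integral p"
    if ab: "a \<in> quad_integral p" "b \<in> quad_integral p" for a b
  proof -
    obtain k m m' l n n' where e: "\<not> int p dvd k" "of_int k * a = zs m m'" "\<not> int p dvd l" "of_int l * b = zs n n'"
      using ab unfolding quad_integral_def by blast
    have "of_int (k * l) * (a + b) = of_int l * (of_int k * a) + of_int k * (of_int l * b)"
      by (simp add: algebra_simps)
    also have "\<dots> = zs (l * m + k * n) (l * m' + k * n')" unfolding e by (simp add: zs_simps)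
    finally show "a + b \<in> quad_integral p" unfolding quad_integral_def using pr e by blast
    have "of_int (k * l) * (a * b) = (of_int k * a) * (of_int l * b)" by (simp add: mult_ac)
    also have "\<dots> = zs (m * n - 7 * m' * n') (m * n' + m' * n)" unfolding e by (rule zs_simps(4))
    finally show "a * b \<in> quad_integral p" unfolding quad_integral_def using pr e by blast
  qed
  show "- a \<in> quad_integral p" if "a \<in> quad_integral p" for a
  proof -
    obtain k m n where e: "\<not> int p dvd k" "of_int k * a = zs m n" using \<open>a \<in> quad_integral p\<close> unfolding quad_integral_def by blast
    have "of_int k * (- a) = zs (- m) (- n)" using e(2) by (simp flip: zs_simps(3))
    thus ?thesis using e(1) unfolding quad_integral_def by blast
  qed
  show "inverse (of_int n) \<in> quad_integral p" if "\<not> int p dvd n" for n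
  proof -
    have "n \<noteq> 0" using that by auto
    hence "of_int n * inverse (of_int n) = zs 1 0" by (simp add: zs_simps(7)[symmetric])
    thus ?thesis unfolding quad_integral_def using that by blast
  qed
qed

lemma of_int_in_quad_ideal:
  assumes p: "prime p" and z: "of_int z \<in> (*) (of_nat p) ` quad_integral p" shows "int p dvd z"
proof -
  obtain b k m n where b: "of_int z = of_nat p * b" "\<not> int p dvd k" "of_int k * b = zs m n"
    using z unfolding quad_integral_def by blast
  have "of_int (k * z) = of_nat p * (of_int k * b)" using b(1) by (simp add: mult_ac)
  hence "k * z = int p * m" unfolding b(3) by (simp add: zs_simps)
  hence "int p dvd k * z" by simp
  thus ?thesis using b(2) p by (simp add: prime_dvd_mult_iff)
qed

text \<open>Frobenius sends s to s (-7)^h = -s, so alpha^p - alpha is -s modulo p, and this is invertible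
  because p is different from 7.\<close>
theorem wsum_inert:
  assumes p: "prime p" "p > 7" and p7: "p mod 7 \<in> {3, 5, 6}"
  shows "int p dvd wsum ((p - 1) div 2)"
proof -
  define I where "I = (*) (of_nat p) ` quad_integral p"
  interpret residue_structure "quad_integral p" I p
    unfolding I_def by (rule quad_integral_residue[OF p])
  have p2: "\<not> int p dvd 2" using p by (auto dest: zdvd_imp_le)
  have two_alpha: "of_int 2 * alpha = zs 1 1" by (simp add: zs_def alpha_def quad_eq_iff)
  have alpha_V: "alpha \<in> quad_integral p" unfolding quad_integral_def using p2 two_alpha by blast
  interpret cm_residue "quad_integral p" I p alpha
    by unfold_locales (rule alpha_V)
  define H where "H = h"
  have ph: "p = Suc (2 * H)" unfolding H_def by (rule p_eq_h)
  define s where "s = zs 0 1"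
  have s2: "s ^ 2 = of_int (- 7)" by (simp add: s_def zs_simps power2_eq_square)
  have sV: "s \<in> quad_integral p"
  proof -
    have "of_int 1 * s = zs 0 1" by (simp add: s_def)
    thus ?thesis unfolding quad_integral_def using p by (intro CollectI exI[of _ 1] exI) auto
  qed
  have s7: "s ^ p + s \<in> I"
  proof -
    have "[(- 7) ^ H = - 1] (mod int p)"
      using Legendre_minus_7(2)[OF p p7] by (simp add: H_def h_def)
    hence "of_int ((- 7) ^ H) - of_int (- 1) \<in> I" by (rule I_of_int_cong)
    hence "s * (of_int ((- 7) ^ H) - of_int (- 1)) \<in> I" by (rule I_mult'[OF sV])
    also have "s * (of_int ((- 7) ^ H) - of_int (- 1)) = s ^ p + s"
    proof -
      have "s ^ p = s * of_int ((- 7) ^ H)" unfolding ph by (simp add: power_mult s2)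
      thus ?thesis by (simp add: algebra_simps)
    qed
    finally show ?thesis .
  qed
  have fermat2: "[2 ^ p = 2] (mod int p)"
  proof -
    have "[2 ^ (p - 1) = 1] (mod p)" using p p2 by (intro fermat_theorem) (auto dest: dvd_imp_le)
    hence "[2 * 2 ^ (p - 1) = 2 * 1] (mod p)" by (rule cong_scalar_left)
    hence "[2 ^ p = 2] (mod p)" using p by (simp flip: power_Suc)
    thus ?thesis by (metis cong_int_iff of_nat_numeral of_nat_power)
  qed
  have "(1 + s) ^ p - 1 ^ p - s ^ p \<in> I" by (rule freshman_V[OF V_1 sV])
  also have "1 + s = 2 * alpha" by (simp add: s_def zs_def alpha_def quad_eq_iff)
  finally have 1: "2 ^ p * alpha ^ p - 1 - s ^ p \<in> I" by (simp add: power_mult_distrib)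
  have "(of_int (2 ^ p) - of_int 2) * alpha ^ p \<in> I"
    by (intro I_mult I_of_int_cong fermat2 V_power alpha_V)
  hence "(2 ^ p * alpha ^ p - 1 - s ^ p) + (s ^ p + s) - (2 ^ p - 2) * alpha ^ p \<in> I"
    by (intro I_diff I_add 1 s7) simp
  also have "(2 ^ p * alpha ^ p - 1 - s ^ p) + (s ^ p + s) - (2 ^ p - 2) * alpha ^ p = of_int 2 * (alpha ^ p - alpha + s)"
  proof -
    have "1 + s = 2 * alpha" by (simp add: s_def zs_def alpha_def quad_eq_iff)
    hence "s = 2 * alpha - 1" by (simp add: algebra_simps)
    thus ?thesis by (simp add: algebra_simps)
  qed
  finally have "alpha ^ p - alpha + s \<in> I" by (rule I_cancel_int[OF p2])
  hence "hasse * (alpha ^ p - alpha + s) \<in> I" by (rule I_mult'[OF hasse_V])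
  hence "hasse * (alpha ^ p - alpha + s) - hasse * (alpha ^ p - alpha) \<in> I" by (intro I_diff hasse_frobenius)
  hence "hasse * s \<in> I" by (simp add: algebra_simps)
  hence "- s * (hasse * s) \<in> I" by (rule I_mult'[OF V_minus[OF sV]])
  also have "- s * (hasse * s) = - (s ^ 2) * hasse" by (simp add: power2_eq_square)
  finally have "of_int 7 * hasse \<in> I" unfolding s2 by simp
  moreover have "\<not> int p dvd 7" using p by (auto dest: zdvd_imp_le)
  ultimately have "hasse \<in> I" using I_cancel_int by blast
  hence "hasse ^ 2 \<in> I" unfolding power2_eq_square by (intro I_mult hasse_V)
  hence "(of_int (wsum h) * alpha ^ (p - 1) - hasse ^ 2) + hasse ^ 2 \<in> I" by (intro I_add hasse_square)
  hence "of_int (wsum h) * alpha ^ (p - 1) \<in> I" by simp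
  hence "(1 - alpha) ^ (p - 1) * (of_int (wsum h) * alpha ^ (p - 1)) \<in> I"
    by (rule I_mult'[OF V_power[OF V_diff[OF V_1 alpha_V]]])
  also have "(1 - alpha) ^ (p - 1) * (of_int (wsum h) * alpha ^ (p - 1)) = of_int (2 ^ (p - 1)) * of_int (wsum h)"
  proof -
    have "(1 - alpha) * alpha = 2" using alpha_square by Groebner_Basis.algebra
    hence "(1 - alpha) ^ (p - 1) * alpha ^ (p - 1) = 2 ^ (p - 1)" by (simp flip: power_mult_distrib)
    thus ?thesis by (simp add: mult_ac)
  qed
  finally have "of_int (2 ^ (p - 1)) * of_int (wsum h) \<in> I" .
  moreover have "\<not> int p dvd 2 ^ (p - 1)" using not_dvd_coprime_23[of "p - 1" 0] by simp
  ultimately have "of_int (wsum h) \<in> I" using I_cancel_int by blast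
  thus ?thesis unfolding I_def h_def by (rule of_int_in_quad_ideal[OF p(1)])
qed

context split_prime
begin

text \<open>alpha is a unit modulo pi and the residue field has p elements, so alpha^(p-1) = 1 and W =
  A^2.\<close>
theorem wsum_split: "int p dvd wsum ((p - 1) div 2) - 4 * x ^ 2"
proof -
  interpret res: cm_residue V M p alpha
  proof
    show "of_nat p \<in> M" by (rule p_in_M)
    show "inverse (of_int n) \<in> V" if "\<not> int p dvd n" for n
      using that by (intro unit_inverse) (simp add: of_int_in_M_iff)
  qed (use p alpha_V V_1 V_add V_mult V_minus M_0 M_add M_mult in auto)
  define c where "c = alpha ^ (p - 1)"
  have cV: "c \<in> V" unfolding c_def by (intro V_power alpha_V)
  obtain b where "b \<in> V" "alpha ^ p - alpha = zs x y * b" using frobenius[OF alpha_V] by blast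
  moreover have "alpha ^ p = alpha * c" unfolding c_def using p by (simp flip: power_Suc)
  ultimately have "alpha * (c - 1) \<in> M" by (auto simp: M_def algebra_simps)
  hence c1: "c - 1 \<in> M" using M_prime[OF alpha_V V_diff[OF cV V_1]] alpha_notin_M by blast
  have h2: "2 * res.h = p - 1" using res.p_eq_h by simp
  have "res.hasse ^ 2 - of_int (4 * x ^ 2) \<in> M"
    using hasse_invariant_split unfolding res.hasse_def h2 unfolding res.h_def .
  note 1 = this
  have 2: "of_int (wsum res.h) * c - res.hasse ^ 2 \<in> M"
    unfolding c_def by (rule res.hasse_square)
  have 3: "of_int (wsum res.h) * (c - 1) \<in> M" by (rule M_mult'[OF V_of_int c1])
  have "(res.hasse ^ 2 - of_int (4 * x ^ 2)) + (of_int (wsum res.h) * c - res.hasse ^ 2)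
      - of_int (wsum res.h) * (c - 1) \<in> M" by (rule M_diff[OF M_add[OF 1 2] 3])
  also have "(res.hasse ^ 2 - of_int (4 * x ^ 2)) + (of_int (wsum res.h) * c - res.hasse ^ 2)
      - of_int (wsum res.h) * (c - 1) = of_int (wsum res.h - 4 * x ^ 2)" by (simp add: algebra_simps)
  finally show ?thesis unfolding of_int_in_M_iff res.h_def .
qed

end

text \<open>Any representation of p comes with its own square root of -7 modulo p, namely -x/y.\<close>
lemma wsum_norm_form:
  assumes p: "prime p" "p > 7" and xy: "int p = x ^ 2 + 7 * y ^ 2"
  shows "int p dvd wsum ((p - 1) div 2) - 4 * x ^ 2"
proof -
  have "\<not> int p dvd y" using norm_y_not_dvd[OF p(1) xy] .
  hence "coprime y (int p)" using p prime_imp_coprime[of "int p" y] by (simp add: coprime_commute)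
  then obtain w where "[y * w = 1] (mod int p)" using cong_solve_coprime_int by blast
  hence "int p dvd y * w - 1" by (simp add: cong_iff_dvd_diff)
  hence "int p dvd - x * (y * w - 1)" by (rule dvd_mult)
  also have "- x * (y * w - 1) = x + y * (- x * w)" by (simp add: algebra_simps)
  finally interpret split_prime p x y "- x * w" by unfold_locales (use p xy in auto)
  show ?thesis by (rule wsum_split)
qed

theorem theorem3p7:
  fixes p :: nat
  assumes "prime p" and "p > 7"
  shows "[(\<Sum>k=0..p-1. of_nat ((2 * k) choose k) * (of_nat (S k) / 7 ^ k))
          \<equiv> (\<Sum>k=0..p-1. of_nat ((2 * k) choose k) * (of_nat (S k) / 25 ^ k))] (rmod p) \<and>
    (p mod 7 \<in> {1, 2, 4} \<longrightarrow>
       (\<exists>x y :: int. int p = x ^ 2 + 7 * y ^ 2) \<and>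
       (\<forall>x y :: int. int p = x ^ 2 + 7 * y ^ 2 \<longrightarrow>
          [(\<Sum>k=0..p-1. of_nat ((2 * k) choose k) * (of_nat (S k) / 25 ^ k))
           \<equiv> of_int (4 * x ^ 2)] (rmod p))) \<and>
    (p mod 7 \<in> {3, 5, 6} \<longrightarrow>
       [(\<Sum>k=0..p-1. of_nat ((2 * k) choose k) * (of_nat (S k) / 25 ^ k)) \<equiv> 0] (rmod p))"
proof -
  note p = assms
  define V I where "V = p_integral_rats p" and "I = (*) (of_nat p) ` p_integral_rats p"
  interpret residue_structure V I p unfolding V_def I_def by (rule p_integral_rats_residue[OF p])
  have rcong: "[a \<equiv> b] (rmod p)" if "a \<in> V" "b \<in> V" "a - b \<in> I" for a b
    using that by (auto simp: rat_cong_def V_def I_def)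
  define h where "h = (p - 1) div 2"
  have "odd p" using prime_odd_nat p by simp
  hence ph: "p = Suc (2 * h)" by (auto elim!: oddE simp: h_def)
  define W where "W = wsum h"
  define T7 T25 :: rat where "T7 = (\<Sum>k=0..p-1. of_nat ((2 * k) choose k) * (of_nat (S k) / 7 ^ k))"
    and "T25 = (\<Sum>k=0..p-1. of_nat ((2 * k) choose k) * (of_nat (S k) / 25 ^ k))"
  have p7: "\<not> int p dvd 7" using p by (auto dest: zdvd_imp_le)
  have p5: "\<not> p dvd 5" using p by (auto dest: dvd_imp_le)
  have p25: "\<not> int p dvd 25"
  proof
    assume "int p dvd 25"
    hence "p dvd 5 ^ 2" using int_dvd_int_iff[of p 25] by simp
    thus False using p5 p(1) prime_dvd_power by blast
  qed
  have T7: "T7 \<in> V" "of_int ((- 7) ^ h) * T7 - of_int W \<in> I"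
    using S_sum_residue[OF ph p7, of "- 7"] by (simp_all add: T7_def W_def)
  have T25: "T25 \<in> V" "of_int (25 ^ h) * T25 - of_int W \<in> I"
    using S_sum_residue[OF ph p25, of 25] by (simp_all add: T25_def W_def)
  have "[25 ^ h = 1] (mod int p)"
  proof -
    have "[5 ^ (p - 1) = 1] (mod p)" using p p5 by (intro fermat_theorem)
    moreover have "(5 :: nat) ^ (p - 1) = 25 ^ h" unfolding ph by (simp add: power_mult)
    ultimately have "[25 ^ h = 1] (mod p)" by simp
    thus ?thesis by (metis cong_int_iff of_nat_1 of_nat_numeral of_nat_power)
  qed
  hence "(of_int W - of_int (25 ^ h) * T25) + (of_int (25 ^ h) - of_int 1) * T25 \<in> I"
    using I_minus[OF T25(2)] T25(1) by (intro I_add I_mult I_of_int_cong) simp_all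
  hence W25: "of_int W - T25 \<in> I" by (simp add: algebra_simps)
  have p_mod: "p mod 7 \<in> {1, 2, 4} \<or> p mod 7 \<in> {3, 5, 6}"
  proof -
    have "p mod 7 \<noteq> 0"
    proof
      assume "p mod 7 = 0"
      hence "7 dvd p" by auto
      moreover have "prime (7 :: nat)" by simp
      ultimately show False using p primes_dvd_imp_eq by blast
    qed
    moreover have "p mod 7 < 7" by simp
    ultimately show ?thesis by auto
  qed
  have inert: "of_int W \<in> I" if "p mod 7 \<in> {3, 5, 6}"
    using wsum_inert[OF p that] by (simp add: W_def h_def I_of_int)
  have W7: "T7 - of_int W \<in> I"
    using p_mod
  proof
    assume "p mod 7 \<in> {1, 2, 4}"
    hence "[(- 7) ^ h = 1] (mod int p)" using Legendre_minus_7(1)[OF p] by (simp add: h_def)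
    hence "(of_int ((- 7) ^ h) * T7 - of_int W) - (of_int ((- 7) ^ h) - of_int 1) * T7 \<in> I"
      by (intro I_diff T7 I_mult I_of_int_cong)
    thus ?thesis by (simp add: algebra_simps)
  next
    assume inert_p: "p mod 7 \<in> {3, 5, 6}"
    hence "[(- 7) ^ h = - 1] (mod int p)" using Legendre_minus_7(2)[OF p] by (simp add: h_def)
    hence "(of_int ((- 7) ^ h) - of_int (- 1)) * T7 - (of_int ((- 7) ^ h) * T7 - of_int W) - of_int W - of_int W \<in> I"
      using inert[OF inert_p] by (intro I_diff T7 I_mult I_of_int_cong)
    thus ?thesis by (simp add: algebra_simps)
  qed
  have "T7 - T25 \<in> I" using I_add[OF W7 W25] by simp
  hence "[T7 \<equiv> T25] (rmod p)" by (rule rcong[OF T7(1) T25(1)])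
  moreover have "[T25 \<equiv> of_int (4 * x ^ 2)] (rmod p)" if xy: "int p = x ^ 2 + 7 * y ^ 2" for x y
  proof -
    have "of_int (W - 4 * x ^ 2) \<in> I"
      using wsum_norm_form[OF p xy] unfolding W_def h_def by (rule I_of_int)
    hence "of_int (W - 4 * x ^ 2) - (of_int W - T25) \<in> I" using W25 by (rule I_diff)
    hence "T25 - of_int (4 * x ^ 2) \<in> I" by simp
    thus ?thesis by (rule rcong[OF T25(1) V_of_int])
  qed
  moreover have "[T25 \<equiv> 0] (rmod p)" if "p mod 7 \<in> {3, 5, 6}"
  proof -
    have "of_int W - (of_int W - T25) \<in> I" using inert[OF that] W25 by (rule I_diff)
    thus ?thesis by (intro rcong T25 V_0) simp
  qed
  ultimately show ?thesis
    using norm_form_representation[OF p] unfolding T7_def T25_def by blast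
qed

end
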